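(* Let $\beta>0$ and $f\in C^1([0,1])$. For every integer $n\ge2$ let $u_n\in PC_{1/n}(0,1)$ be a minimizer of $$\int_0^{1-1/n}\log\Bigl(1+\Bigl(\frac{u(x+1/n)-u(x)}{1/n}\Bigr)^2\Bigr)dx+\beta\int_0^1(u(x)-f(x))^2\,dx$$ over $PC_{1/n}(0,1)$. Let $x_n=k_n/n$ with $k_n\in\{0,\dots,n-1\}$ and $x_n\to x_\infty\in(0,1)$. Let $\omega(n)=(\log n/n)^{1/3}$ and define, for $y\in[-x_n/\omega(n),(1-x_n)/\omega(n)]$, $$w_n(y):=\frac{u_n(x_n+\omega(n)y)-f(x_n)}{\omega(n)},\qquad v_n(y):=\frac{u_n(x_n+\omega(n)y)-u_n(x_n)}{\omega(n)}.$$ Let $H:=\bigl(1/(\beta|f'(x_\infty)|^2)\bigr)^{1/3}$ and $V:=f'(x_\infty)H$, with the understanding that if $f'(x_\infty)=0$ the canonical $(H,V)$-staircase is identically $0$ (so that $\mathrm{Obl}(H,V)$ and $\mathrm{Orz}(H,V)$ consist only of the zero function). Then: (1) For every sequence $n_k\to+\infty$ there exist a subsequence $n_{k_h}$ and $w_\infty\in\mathrm{Obl}(H,V)$ such that $w_{n_{k_h}}\to w_\infty$ locally strictly in $BV_{loc}(\mathbb{R})$. (2) For every sequence $n_k\to+\infty$ there exist a subsequence $n_{k_h}$ and $v_\infty\in\mathrm{Orz}(H,V)$ such that $v_{n_{k_h}}\to v_\infty$ locally strictly in $BV_{loc}(\mathbb{R})$. (3) For every $w\in\mathrm{Obl}(H,V)$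 there exists a sequence $\{x_n'\}\subset(0,1)$ such that $\limsup_{n\to+\infty}(x_n'-x_n)/\omega(n)\le H$ and $y\mapsto \bigl(u_n(x_n'+\omega(n)y)-f(x_n')\bigr)/\omega(n)$ converges to $w$ locally strictly in $BV_{loc}(\mathbb{R})$. (4) For every $v\in\mathrm{Orz}(H,V)$ there exists a sequence $\{x_n'\}\subset(0,1)$ such that $\limsup_{n\to+\infty}(x_n'-x_n)/\omega(n)\le H$ and $y\mapsto \bigl(u_n(x_n'+\omega(n)y)-u_n(x_n')\bigr)/\omega(n)$ converges to $v$ locally strictly in $BV_{loc}(\mathbb{R})$.
   Context: $PC_{1/n}(0,1)$ is the space of functions $u:[0,1]\to\mathbb{R}$ constant on each $[k/n,(k+1)/n)$, $k\in\{0,\dots,n-1\}$, with $u(1):=u(1-1/n)$. Strict convergence on $(a,b)$: $u_n\to u$ in $L^1((a,b))$ and $|Du_n|((a,b))\to|Du|((a,b))$. A sequence of functions (each defined on an interval, the intervals eventually containing any bounded interval) converges locally strictly in $BV_{loc}(\mathbb{R})$ to $u$ if it converges strictly on every bounded interval $(a,b)$ whose endpoints are not jump points of $u$. Canonical staircase: $S(x)=2\lfloor (x+1)/2\rfloor$ and, for $H>0$, $V\in\mathbb{R}$, $S_{H,V}(x)=V\,S(x/H)$. $\mathrm{Obl}(H,V)$ (oblique translations) is the set of functions $x\mapsto S_{H,V}(x-H\tau_0)+V\tau_0$ with $\tau_0\in[-1,1]$; $\mathrm{Orz}(H,V)$ (graph translations of horizontal type) is the set of functions $x\mapsto S_{H,V}(x-H\tau_0)$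 with $\tau_0\in[-1,1]$. *)

theory Defs
  imports "HOL-Analysis.Analysis"
begin

text \<open>Piecewise constant functions on the grid of step 1/n (only values on [0,1] matter).\<close>
definition PC :: "nat \<Rightarrow> (real \<Rightarrow> real) \<Rightarrow> bool" where
  "PC n u \<longleftrightarrow>
     (\<forall>k<n. \<forall>x. real k / real n \<le> x \<and> x < (real k + 1) / real n \<longrightarrow> u x = u (real k / real n))
     \<and> u 1 = u (1 - 1 / real n)"

definition PM_energy :: "real \<Rightarrow> (real \<Rightarrow> real) \<Rightarrow> nat \<Rightarrow> (real \<Rightarrow> real) \<Rightarrow> real" where
  "PM_energy \<beta> f n u =
     integral {0..1 - 1 / real n} (\<lambda>x. ln (1 + ((u (x + 1 / real n) - u x) / (1 / real n))^2))
     + \<beta> * integral {0..1} (\<lambda>x. (u x - f x)^2)"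

definition PM_minimizer :: "real \<Rightarrow> (real \<Rightarrow> real) \<Rightarrow> nat \<Rightarrow> (real \<Rightarrow> real) \<Rightarrow> bool" where
  "PM_minimizer \<beta> f n u \<longleftrightarrow> PC n u \<and> (\<forall>v. PC n v \<longrightarrow> PM_energy \<beta> f n u \<le> PM_energy \<beta> f n v)"

definition test_fns :: "real \<Rightarrow> real \<Rightarrow> ((real \<Rightarrow> real) \<times> (real \<Rightarrow> real)) set" where
  "test_fns a b = {(\<phi>, \<phi>'). (\<forall>x. (\<phi> has_real_derivative \<phi>' x) (at x)) \<and> continuous_on UNIV \<phi>'
       \<and> (\<exists>c d. a < c \<and> c \<le> d \<and> d < b \<and> (\<forall>x. x < c \<or> d < x \<longrightarrow> \<phi> x = 0))
       \<and> (\<forall>x. \<bar>\<phi> x\<bar> \<le> 1)}"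

definition total_var :: "(real \<Rightarrow> real) \<Rightarrow> real \<Rightarrow> real \<Rightarrow> ereal" where
  "total_var u a b = (SUP p \<in> test_fns a b. ereal (integral {a..b} (\<lambda>x. u x * snd p x)))"

definition jump_point :: "(real \<Rightarrow> real) \<Rightarrow> real \<Rightarrow> bool" where
  "jump_point u x \<longleftrightarrow> (\<exists>l r. l \<noteq> r \<and> (u \<longlongrightarrow> l) (at_left x) \<and> (u \<longlongrightarrow> r) (at_right x))"

text \<open>Local strict convergence in BV_loc(R) of functions g n defined on [lo n, hi n].\<close>
definition loc_strict_conv ::
  "(nat \<Rightarrow> real) \<Rightarrow> (nat \<Rightarrow> real) \<Rightarrow> (nat \<Rightarrow> real \<Rightarrow> real) \<Rightarrow> (real \<Rightarrow> real) \<Rightarrow> bool" where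
  "loc_strict_conv lo hi g u \<longleftrightarrow>
     filterlim lo at_bot sequentially \<and> filterlim hi at_top sequentially \<and>
     (\<forall>a b. a < b \<and> \<not> jump_point u a \<and> \<not> jump_point u b \<longrightarrow>
        ((\<lambda>n. \<integral>\<^sup>+ x \<in> {a<..<b}. ennreal \<bar>g n x - u x\<bar> \<partial>lborel) \<longlonglongrightarrow> 0)
        \<and> ((\<lambda>n. total_var (g n) a b) \<longlonglongrightarrow> total_var u a b))"

definition staircase :: "real \<Rightarrow> real" where
  "staircase x = 2 * real_of_int \<lfloor>(x + 1) / 2\<rfloor>"

definition staircase_HV :: "real \<Rightarrow> real \<Rightarrow> real \<Rightarrow> real" where
  "staircase_HV H V x = V * staircase (x / H)"

definition Obl :: "real \<Rightarrow> real \<Rightarrow> (real \<Rightarrow> real) set" where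
  "Obl H V = {(\<lambda>x. staircase_HV H V (x - H * \<tau>) + V * \<tau>) | \<tau>. \<tau> \<in> {-1..1}}"

definition Orz :: "real \<Rightarrow> real \<Rightarrow> (real \<Rightarrow> real) set" where
  "Orz H V = {(\<lambda>x. staircase_HV H V (x - H * \<tau>)) | \<tau>. \<tau> \<in> {-1..1}}"

definition omega :: "nat \<Rightarrow> real" where
  "omega n = (ln (real n) / real n) powr (1/3)"

end

theory Submission
  imports Defs "HOL-Real_Asymp.Real_Asymp"
begin

text \<open>
  On the scale \<open>\<omega>(n)\<close> the energy of a minimizer, divided by \<open>\<omega>(n)\<^sup>3\<close>, counts an increment of order one as
  \<open>ln (1 + (n \<omega>(n))\<^sup>2) / ln n \<rightarrow> 4/3\<close>, whatever its size, while all other increments have vanishing total variation.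
  Up to small errors a blow-up is therefore a step function that minimizes
  \<open>4/3 * #jumps + \<beta> \<integral> (w - M y)\<^sup>2 dy\<close>, with \<open>M = f'(x\<^sub>\<infinity>)\<close>, on every bounded window with its values at the ends
  kept fixed. If \<open>M \<noteq> 0\<close>, a window delimited by two jumps and containing \<open>N\<close> plateaus is compared with equal
  partitions into \<open>m\<close> plateaus. The case \<open>m = N\<close> makes the plateaus almost equal in length and centred on the line \<open>M y\<close>,
  and \<open>m = N - 1, N + 1\<close> force their common length to \<open>2 H\<close> as the window grows. If \<open>M = 0\<close>, competitors with
  two jumps and with one jump leave at most one jump, and then the bound on the energy makes the blow-up small.

  In both cases the blow-up at \<open>x\<^sub>n\<close> is close to an oblique translation with some parameter \<open>\<tau>\<^sub>n\<close>, along the whole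
  sequence, so no subsequence is needed to move the centre. Shifting the centre by \<open>\<omega>(n) s\<close> changes
  \<open>\<tau>\<^sub>n\<close> to \<open>\<tau>\<^sub>n - s / H\<close>, which yields every translation. Strictness holds because the large jumps
  all have the sign of \<open>M\<close>, so the variation on a window is almost the difference of the end values.
\<close>

section \<open>Sums over blocks of a grid\<close>

text \<open>A plateau of length \<open>l\<close> centred on the line contributes
  \<open>\<alpha> + c l^3\<close> with \<open>c = \<beta> M^2 / 12\<close>. This cost per unit
  length is least where \<open>2 c l^3 = \<alpha>\<close>, which for \<open>\<alpha> = 4/3\<close>
  reads \<open>l = 2 H\<close>: hence the formula for \<open>H\<close>. Two obstacles shape the
  argument. The blow-ups are not known to be bounded, so a jump created at the end of a window could
  be huge. A polynomial bound on the minimizers tames it, since the logarithmic cost of such a jump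
  stays bounded; this bounds the energy, which provides cells with bounded values near every point,
  and from such cells the sharp cost \<alpha> becomes available. Next, fixing the end values could
  cost a competitor extra jumps and blur the comparison. Windows that start and end with a jump
  avoid this: \<open>N\<close> plateaus come with \<open>N + 1\<close> jumps, exactly as in a
  partition into \<open>N\<close> blocks. Every estimate holds eventually and simultaneously for all
  windows of a given radius. No limit of the blow-ups is extracted, and compactness enters only at
  the end, for the finitely many real parameters of the limit.\<close>

lemma sum_shifted_squares:
  "(\<Sum>i<P. (real i + s)^2) = real P * (real P - 1) * (2 * real P - 1) / 6 + s * real P * (real P - 1) + real P * s^2"
  by (induction P) (auto simp: field_simps power2_eq_square)

lemma sum_shifted:
  "(\<Sum>i<P. real i + s) = real P * (real P - 1) / 2 + real P * s"
  by (induction P) (auto simp: field_simps)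

text \<open>Rescaled left endpoint of cell \<open>i\<close>, with cell \<kappa> as the origin. The
  origin is a real number, so cells to its left get negative positions instead of truncated
  differences.\<close>

definition gpos :: "real \<Rightarrow> real \<Rightarrow> nat \<Rightarrow> real" where
  "gpos \<kappa> \<delta> i = (real i - \<kappa>) * \<delta>"

text \<open>The mean position of the cells \<open>a, ..., b - 1\<close>; the \<open>- 1\<close>
  reflects that cell \<open>b\<close> is excluded. Multiplied by \<open>M\<close> it is the constant
  that best fits the samples \<open>M * gpos \<kappa> \<delta> i\<close>.\<close>

definition gmid :: "real \<Rightarrow> real \<Rightarrow> nat \<Rightarrow> nat \<Rightarrow> real" where
  "gmid \<kappa> \<delta> a b = ((real a + real b - 1) / 2 - \<kappa>) * \<delta>"

lemma sum_atLeastLessThan_lessThan: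
  fixes f :: "nat \<Rightarrow> real"
  assumes "a \<le> b"
  shows "sum f {a..<b} = (\<Sum>i<b - a. f (i + a))"
  using sum.shift_bounds_nat_ivl[of f 0 a "b - a"] assms by (simp add: lessThan_atLeast0)

lemma sum_gpos_centered:
  assumes "a \<le> b"
  shows "(\<Sum>i\<in>{a..<b}. gmid \<kappa> \<delta> a b - gpos \<kappa> \<delta> i) = 0"
proof -
  have "(\<Sum>i\<in>{a..<b}. gmid \<kappa> \<delta> a b - gpos \<kappa> \<delta> i)
      = (\<Sum>i<b - a. - \<delta> * (real i + (- (real b - real a - 1) / 2)))"
    unfolding sum_atLeastLessThan_lessThan[OF assms]
    by (intro sum.cong) (auto simp: gmid_def gpos_def field_simps)
  also have "\<dots> = 0"
    unfolding sum_distrib_left[symmetric] sum_shifted using assms by (simp add: of_nat_diff field_simps)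
  finally show ?thesis .
qed

text \<open>Variance of an arithmetic progression, the source of the constant 12. The term with
  \<open>\<delta>^2\<close> is the discretisation error relative to \<open>l^3 / 12\<close>.\<close>

lemma sum_gpos_centered_sq:
  assumes "a \<le> b"
  shows "\<delta> * (\<Sum>i\<in>{a..<b}. (gmid \<kappa> \<delta> a b - gpos \<kappa> \<delta> i)^2)
     = (((real b - real a) * \<delta>)^3 - (real b - real a) * \<delta> * \<delta>^2) / 12"
proof -
  have "(\<Sum>i\<in>{a..<b}. (gmid \<kappa> \<delta> a b - gpos \<kappa> \<delta> i)^2)
      = (\<Sum>i<b - a. \<delta>^2 * (real i + (- (real b - real a - 1) / 2))^2)"
    unfolding sum_atLeastLessThan_lessThan[OF assms]
    by (intro sum.cong) (auto simp: gmid_def gpos_def field_simps power2_eq_square)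
  also have "\<dots> = \<delta>^2 * ((real b - real a)^3 - (real b - real a)) / 12"
    unfolding sum_distrib_left[symmetric] sum_shifted_squares using assms
    by (simp add: of_nat_diff) (simp add: power2_eq_square power3_eq_cube algebra_simps add_divide_distrib diff_divide_distrib)
  finally have eq: "(\<Sum>i\<in>{a..<b}. (gmid \<kappa> \<delta> a b - gpos \<kappa> \<delta> i)^2)
      = \<delta>^2 * ((real b - real a)^3 - (real b - real a)) / 12" .
  show ?thesis unfolding eq by (simp add: power2_eq_square power3_eq_cube algebra_simps)
qed

lemma gmid_dist:
  assumes "a \<le> i" "i < b" "\<delta> \<ge> 0"
  shows "\<bar>gmid \<kappa> \<delta> a b - gpos \<kappa> \<delta> i\<bar> \<le> (real b - real a) * \<delta>"
proof -
  have "gmid \<kappa> \<delta> a b - gpos \<kappa> \<delta> i = ((real a + real b - 1) / 2 - real i) * \<delta>"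
    by (simp add: gmid_def gpos_def algebra_simps)
  moreover have "\<bar>(real a + real b - 1) / 2 - real i\<bar> \<le> real b - real a"
    using assms by (simp add: field_simps abs_if)
  ultimately show ?thesis using assms by (simp add: abs_mult mult_right_mono)
qed

text \<open>The discretisation error has the favourable sign here and is dropped. An error
  \<epsilon> in the samples produces a cross term of order \<open>\<epsilon> l^2\<close>, since
  every cell lies within \<open>l\<close> of the mean position.\<close>

lemma block_upper:
  assumes "a \<le> b" "\<delta> \<ge> 0" "\<epsilon> \<ge> 0"
    and G: "\<And>i. a \<le> i \<Longrightarrow> i < b \<Longrightarrow> \<bar>G i - M * gpos \<kappa> \<delta> i\<bar> \<le> \<epsilon>"
  defines "l \<equiv> (real b - real a) * \<delta>"
  shows "\<delta> * (\<Sum>i\<in>{a..<b}. (M * gmid \<kappa> \<delta> a b - G i)^2) \<le> M^2 * l^3 / 12 + 2 * \<epsilon> * \<bar>M\<bar> * l^2 + \<epsilon>^2 * l"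
proof -
  have l0: "l \<ge> 0" using assms by (simp add: l_def)
  have "(M * gmid \<kappa> \<delta> a b - G i)^2 \<le> M^2 * (gmid \<kappa> \<delta> a b - gpos \<kappa> \<delta> i)^2 + (2 * \<epsilon> * \<bar>M\<bar> * l + \<epsilon>^2)"
    if i: "i \<in> {a..<b}" for i
  proof -
    define t where "t = M * (gmid \<kappa> \<delta> a b - gpos \<kappa> \<delta> i)"
    define e where "e = M * gpos \<kappa> \<delta> i - G i"
    have e: "\<bar>e\<bar> \<le> \<epsilon>" using G[of i] i by (simp add: e_def abs_minus_commute)
    have t: "\<bar>t\<bar> \<le> \<bar>M\<bar> * l" unfolding t_def abs_mult l_def
      using gmid_dist[of a i b \<delta> \<kappa>] i assms by (intro mult_left_mono) auto
    have "t * e \<le> \<bar>t\<bar> * \<bar>e\<bar>" by (metis abs_ge_self abs_mult)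
    also have "\<dots> \<le> (\<bar>M\<bar> * l) * \<epsilon>" using e t l0 by (intro mult_mono) auto
    finally have "t * e \<le> \<bar>M\<bar> * l * \<epsilon>" .
    moreover have "e^2 \<le> \<epsilon>^2" using e by (metis abs_ge_zero power2_abs power_mono)
    moreover have "(t + e)^2 = t^2 + 2 * (t * e) + e^2" by (simp add: power2_eq_square algebra_simps)
    ultimately have "(t + e)^2 \<le> t^2 + (2 * \<epsilon> * \<bar>M\<bar> * l + \<epsilon>^2)" by (simp add: mult.commute mult.left_commute)
    moreover have "M * gmid \<kappa> \<delta> a b - G i = t + e" by (simp add: t_def e_def algebra_simps)
    ultimately show ?thesis by (simp add: t_def power_mult_distrib)
  qed
  then have "(\<Sum>i\<in>{a..<b}. (M * gmid \<kappa> \<delta> a b - G i)^2)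
    \<le> (\<Sum>i\<in>{a..<b}. M^2 * (gmid \<kappa> \<delta> a b - gpos \<kappa> \<delta> i)^2 + (2 * \<epsilon> * \<bar>M\<bar> * l + \<epsilon>^2))"
    by (intro sum_mono)
  also have "\<dots> = M^2 * (\<Sum>i\<in>{a..<b}. (gmid \<kappa> \<delta> a b - gpos \<kappa> \<delta> i)^2) + (real b - real a) * (2 * \<epsilon> * \<bar>M\<bar> * l + \<epsilon>^2)"
    using assms by (simp add: sum.distrib sum_distrib_left of_nat_diff)
  finally have "\<delta> * (\<Sum>i\<in>{a..<b}. (M * gmid \<kappa> \<delta> a b - G i)^2)
     \<le> \<delta> * (M^2 * (\<Sum>i\<in>{a..<b}. (gmid \<kappa> \<delta> a b - gpos \<kappa> \<delta> i)^2) + (real b - real a) * (2 * \<epsilon> * \<bar>M\<bar> * l + \<epsilon>^2))"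
    using assms by (intro mult_left_mono)
  also have "\<dots> = M^2 * (\<delta> * (\<Sum>i\<in>{a..<b}. (gmid \<kappa> \<delta> a b - gpos \<kappa> \<delta> i)^2)) + l * (2 * \<epsilon> * \<bar>M\<bar> * l + \<epsilon>^2)"
    by (simp add: l_def algebra_simps)
  also have "\<dots> = M^2 * (l^3 - l * \<delta>^2) / 12 + l * (2 * \<epsilon> * \<bar>M\<bar> * l + \<epsilon>^2)"
    using sum_gpos_centered_sq[OF assms(1), of \<delta> \<kappa>] by (simp add: l_def)
  also have "\<dots> \<le> M^2 * l^3 / 12 + l * (2 * \<epsilon> * \<bar>M\<bar> * l + \<epsilon>^2)"
  proof -
    have "M^2 * (l^3 - l * \<delta>^2) \<le> M^2 * l^3" using l0 by (intro mult_left_mono) auto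
    then show ?thesis by simp
  qed
  finally show ?thesis by (simp add: power2_eq_square algebra_simps)
qed

text \<open>Since the positions are centred, the fidelity splits into the variance and the squared
  offset of \<open>w\<close> from the midpoint of the line. The offset is truncated by
  \<open>2 * \<epsilon>\<close>, which absorbs the oscillation of \<open>W\<close> and the error of
  \<open>G\<close> together.\<close>

lemma block_lower:
  assumes "a \<le> b" "\<delta> \<ge> 0" "\<epsilon> \<ge> 0"
    and G: "\<And>i. a \<le> i \<Longrightarrow> i < b \<Longrightarrow> \<bar>G i - M * gpos \<kappa> \<delta> i\<bar> \<le> \<epsilon>"
    and W: "\<And>i. a \<le> i \<Longrightarrow> i < b \<Longrightarrow> \<bar>W i - w\<bar> \<le> \<epsilon>"
  defines "l \<equiv> (real b - real a) * \<delta>"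
  shows "M^2 * (l^3 - l * \<delta>^2) / 12 + l * (max 0 (\<bar>w - M * gmid \<kappa> \<delta> a b\<bar> - 2 * \<epsilon>))^2 - 4 * \<epsilon> * \<bar>M\<bar> * l^2
     \<le> \<delta> * (\<Sum>i\<in>{a..<b}. (W i - G i)^2)"
proof -
  have l0: "l \<ge> 0" using assms by (simp add: l_def)
  define A where "A = w - M * gmid \<kappa> \<delta> a b"
  define Q where "Q = (max 0 (\<bar>A\<bar> - 2 * \<epsilon>))^2"
  define t where "t i = gmid \<kappa> \<delta> a b - gpos \<kappa> \<delta> i" for i
  \<comment> \<open>The offset \<open>A\<close> has no a priori bound, so its product with
    \<open>t i\<close> must not be estimated. It is kept exactly and cancels on summation.\<close>
  have pt: "M^2 * (t i)^2 + 2 * A * M * t i + (Q - 4 * \<epsilon> * \<bar>M\<bar> * l) \<le> (W i - G i)^2"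
    if i: "i \<in> {a..<b}" for i
  proof -
    define s where "s = (W i - w) - (G i - M * gpos \<kappa> \<delta> i)"
    have s: "\<bar>s\<bar> \<le> 2 * \<epsilon>" using G[of i] W[of i] i by (simp add: s_def)
    have t: "\<bar>M * t i\<bar> \<le> \<bar>M\<bar> * l" unfolding t_def abs_mult l_def
      using gmid_dist[of a i b \<delta> \<kappa>] i assms by (intro mult_left_mono) auto
    have "\<bar>s * (M * t i)\<bar> \<le> (2 * \<epsilon>) * (\<bar>M\<bar> * l)"
      unfolding abs_mult[of s] using s t l0 assms by (intro mult_mono) auto
    then have st: "- (2 * \<epsilon> * \<bar>M\<bar> * l) \<le> s * (M * t i)" by (simp add: abs_le_iff)
    have "Q \<le> (A + s)^2"
    proof -
      have "max 0 (\<bar>A\<bar> - 2 * \<epsilon>) \<le> \<bar>A + s\<bar>" using s by linarith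
      then have "(max 0 (\<bar>A\<bar> - 2 * \<epsilon>))^2 \<le> \<bar>A + s\<bar>^2" by (intro power_mono) auto
      then show ?thesis by (simp add: Q_def)
    qed
    moreover have "W i - G i = A + s + M * t i" by (simp add: A_def s_def t_def algebra_simps)
    then have "(W i - G i)^2 = (A + s)^2 + 2 * A * M * t i + 2 * (s * (M * t i)) + M^2 * (t i)^2"
      by (simp add: power2_eq_square algebra_simps)
    ultimately show ?thesis using st by simp
  qed
  have "M^2 * (\<Sum>i\<in>{a..<b}. (t i)^2) + (real b - real a) * (Q - 4 * \<epsilon> * \<bar>M\<bar> * l)
     = (\<Sum>i\<in>{a..<b}. M^2 * (t i)^2 + 2 * A * M * t i + (Q - 4 * \<epsilon> * \<bar>M\<bar> * l))"
    using sum_gpos_centered[OF assms(1), of \<kappa> \<delta>] assms(1)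
    by (simp add: sum.distrib of_nat_diff sum_distrib_left[symmetric] t_def)
  also have "\<dots> \<le> (\<Sum>i\<in>{a..<b}. (W i - G i)^2)" using pt by (intro sum_mono)
  finally have "\<delta> * (M^2 * (\<Sum>i\<in>{a..<b}. (t i)^2) + (real b - real a) * (Q - 4 * \<epsilon> * \<bar>M\<bar> * l))
     \<le> \<delta> * (\<Sum>i\<in>{a..<b}. (W i - G i)^2)" using assms(2) by (intro mult_left_mono)
  moreover have "\<delta> * (M^2 * (\<Sum>i\<in>{a..<b}. (t i)^2) + (real b - real a) * (Q - 4 * \<epsilon> * \<bar>M\<bar> * l))
    = M^2 * (\<delta> * (\<Sum>i\<in>{a..<b}. (t i)^2)) + l * (Q - 4 * \<epsilon> * \<bar>M\<bar> * l)" by (simp add: l_def algebra_simps)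
  moreover have sq: "\<delta> * (\<Sum>i\<in>{a..<b}. (t i)^2) = (l^3 - l * \<delta>^2) / 12"
    using sum_gpos_centered_sq[OF assms(1), of \<delta> \<kappa>] by (simp add: l_def t_def)
  ultimately have "M^2 * ((l^3 - l * \<delta>^2) / 12) + l * (Q - 4 * \<epsilon> * \<bar>M\<bar> * l)
      \<le> \<delta> * (\<Sum>i\<in>{a..<b}. (W i - G i)^2)" by metis
  moreover have "l * (Q - 4 * \<epsilon> * \<bar>M\<bar> * l) = l * Q - 4 * \<epsilon> * \<bar>M\<bar> * l^2"
    by (simp add: power2_eq_square algebra_simps)
  ultimately show ?thesis by (simp add: Q_def A_def)
qed

section \<open>Local minimality and step competitors\<close>

text \<open>Cell \<open>a\<close> is left out of the fidelity sum because competitors agree with the minimizer there.\<close>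

definition en :: "real \<Rightarrow> real \<Rightarrow> (real \<Rightarrow> real) \<Rightarrow> (nat \<Rightarrow> real) \<Rightarrow> (nat \<Rightarrow> real) \<Rightarrow> nat \<Rightarrow> nat \<Rightarrow> real" where
  "en \<beta> \<delta> \<phi> G Z a b = (\<Sum>i\<in>{a..<b}. \<phi> (Z (Suc i) - Z i)) + \<beta> * \<delta> * (\<Sum>i\<in>{Suc a..<b}. (Z i - G i)^2)"

text \<open>Competitors differ from \<open>W\<close> only strictly between \<open>a\<close> and
  \<open>b\<close>; \<open>b < n\<close> keeps every increment involved inside the grid.\<close>

definition locmin :: "real \<Rightarrow> real \<Rightarrow> (real \<Rightarrow> real) \<Rightarrow> (nat \<Rightarrow> real) \<Rightarrow> (nat \<Rightarrow> real) \<Rightarrow> nat \<Rightarrow> bool" where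
  "locmin \<beta> \<delta> \<phi> G W n \<longleftrightarrow> (\<forall>a b Z. a < b \<longrightarrow> b < n \<longrightarrow> (\<forall>i. i \<le> a \<or> b \<le> i \<longrightarrow> Z i = W i)
      \<longrightarrow> en \<beta> \<delta> \<phi> G W a b \<le> en \<beta> \<delta> \<phi> G Z a b)"

lemma sum_blocks:
  fixes h :: "nat \<Rightarrow> real" and \<kappa> :: "nat \<Rightarrow> nat"
  assumes "\<And>i j. i \<le> j \<Longrightarrow> j \<le> m \<Longrightarrow> \<kappa> i \<le> \<kappa> j"
  shows "sum h {\<kappa> 0..<\<kappa> m} = (\<Sum>j<m. sum h {\<kappa> j..<\<kappa> (Suc j)})"
  using assms
proof (induction m)
  case (Suc m)
  have "sum h {\<kappa> 0..<\<kappa> (Suc m)} = sum h {\<kappa> 0..<\<kappa> m} + sum h {\<kappa> m..<\<kappa> (Suc m)}"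
    using Suc.prems by (simp add: sum.atLeastLessThan_concat)
  with Suc show ?case by simp
qed simp

lemma block_index_exists:
  fixes \<kappa> :: "nat \<Rightarrow> nat"
  assumes "\<kappa> 0 \<le> i" "i < \<kappa> m"
  obtains j where "j < m" "\<kappa> j \<le> i" "i < \<kappa> (Suc j)"
proof -
  define j where "j = (LEAST j. i < \<kappa> j)"
  have j: "i < \<kappa> j" "\<And>j'. j' < j \<Longrightarrow> \<not> i < \<kappa> j'" unfolding j_def
    using assms by (auto intro: LeastI dest: not_less_Least)
  have "j \<le> m" unfolding j_def using assms by (intro Least_le)
  moreover have "j \<noteq> 0" using j assms by (metis not_le)
  ultimately show thesis using that[of "j - 1"] j(1) j(2)[of "j - 1"] by auto
qed

text \<open>With both end values fixed, \<open>m\<close> blocks produce at most \<open>m + 1\<close>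
  increments. The bound \<open>B\<close> is required for all pairs of values rather than for
  neighbouring blocks, because blocks may be empty and then non-consecutive values meet.\<close>

lemma block_competitor:
  fixes \<kappa> :: "nat \<Rightarrow> nat" and v :: "nat \<Rightarrow> real"
  assumes min: "locmin \<beta> \<delta> \<phi> G W n" and ab: "a < b" "b < n"
    and \<kappa>: "\<kappa> 0 = Suc a" "\<kappa> m = b" "\<And>i j. i \<le> j \<Longrightarrow> j \<le> m \<Longrightarrow> \<kappa> i \<le> \<kappa> j"
    and \<phi>0: "\<phi> 0 = 0"
    and B: "\<And>p q. p \<in> insert (W a) (insert (W b) (v ` {..<m})) \<Longrightarrow>
                   q \<in> insert (W a) (insert (W b) (v ` {..<m})) \<Longrightarrow> \<phi> (p - q) \<le> B"
    and B0: "B \<ge> 0"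
  shows "en \<beta> \<delta> \<phi> G W a b \<le> (real m + 1) * B + \<beta> * \<delta> * (\<Sum>j<m. \<Sum>i\<in>{\<kappa> j..<\<kappa> (Suc j)}. (v j - G i)^2)"
proof -
  define Z where "Z i = (if a < i \<and> i < b then v (LEAST j. i < \<kappa> (Suc j)) else W i)" for i
  have Zb: "Z i = v j" if "j < m" "\<kappa> j \<le> i" "i < \<kappa> (Suc j)" for i j
  proof -
    have "(LEAST j. i < \<kappa> (Suc j)) = j"
    proof (rule Least_equality)
      fix j' assume j': "i < \<kappa> (Suc j')"
      show "j \<le> j'"
      proof (rule ccontr)
        assume "\<not> j \<le> j'"
        then have "\<kappa> (Suc j') \<le> \<kappa> j" using that by (intro \<kappa>) auto
        with j' that show False by simp
      qed
    qed (use that in auto)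
    moreover have "\<kappa> 0 \<le> \<kappa> j" "\<kappa> (Suc j) \<le> \<kappa> m" using that by (auto intro: \<kappa>)
    ultimately show ?thesis using that \<kappa> by (simp add: Z_def)
  qed
  have Zin: "Z i \<in> insert (W a) (insert (W b) (v ` {..<m}))" if i: "a \<le> i" "i \<le> b" for i
  proof (cases "a < i \<and> i < b")
    case True
    then obtain j where "j < m" "\<kappa> j \<le> i" "i < \<kappa> (Suc j)" using block_index_exists[of \<kappa> i m] \<kappa> by auto
    then show ?thesis using Zb by auto
  next
    case False
    then have "i = a \<or> i = b" using i by auto
    then show ?thesis by (auto simp: Z_def)
  qed
  have jumps: "(\<Sum>i\<in>{a..<b}. \<phi> (Z (Suc i) - Z i)) \<le> (real m + 1) * B"
  proof -
    \<comment> \<open>An increment can be nonzero only if cell \<open>Suc i\<close> opens a block or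
      equals \<open>b\<close>; these are the indices \<open>\<kappa> j - 1\<close> with
      \<open>j \<le> m\<close>.\<close>
    define I where "I = (\<lambda>j. \<kappa> j - 1) ` {..m}"
    have "(\<Sum>i\<in>{a..<b}. \<phi> (Z (Suc i) - Z i)) = (\<Sum>i\<in>{a..<b} \<inter> I. \<phi> (Z (Suc i) - Z i))"
    proof (rule sum.mono_neutral_right)
      show "\<forall>i\<in>{a..<b} - {a..<b} \<inter> I. \<phi> (Z (Suc i) - Z i) = 0"
      proof
        fix i assume i: "i \<in> {a..<b} - {a..<b} \<inter> I"
        have "i \<noteq> a" using i \<kappa>(1) unfolding I_def by (metis DiffE IntI atMost_iff diff_Suc_1 imageI le0)
        moreover have "Suc i \<noteq> b" using i \<kappa>(2) unfolding I_def by (metis DiffE IntI atMost_iff diff_Suc_1 imageI order_refl)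
        ultimately have ii: "a < i" "Suc i < b" using i by auto
        then obtain j where j: "j < m" "\<kappa> j \<le> i" "i < \<kappa> (Suc j)" using block_index_exists[of \<kappa> i m] \<kappa> by auto
        have "Suc i \<noteq> \<kappa> (Suc j)" using i j(1) unfolding I_def by (metis DiffE IntI Suc_leI atMost_iff diff_Suc_1 imageI)
        then have "Z (Suc i) = v j" "Z i = v j" using j by (auto intro!: Zb)
        then show "\<phi> (Z (Suc i) - Z i) = 0" using \<phi>0 by simp
      qed
    qed auto
    also have "\<dots> \<le> (\<Sum>i\<in>{a..<b} \<inter> I. B)"
    proof (rule sum_mono)
      fix i assume "i \<in> {a..<b} \<inter> I"
      then show "\<phi> (Z (Suc i) - Z i) \<le> B" by (intro B Zin) auto
    qed
    also have "\<dots> = real (card ({a..<b} \<inter> I)) * B" by simp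
    also have "\<dots> \<le> (real m + 1) * B"
    proof -
      have "card ({a..<b} \<inter> I) \<le> card I" unfolding I_def by (intro card_mono) auto
      also have "\<dots> \<le> card {..m}" unfolding I_def by (intro card_image_le) auto
      finally have "real (card ({a..<b} \<inter> I)) \<le> real m + 1" by simp
      then show ?thesis using B0 by (intro mult_right_mono)
    qed
    finally show ?thesis .
  qed
  have "(\<Sum>i\<in>{Suc a..<b}. (Z i - G i)^2) = (\<Sum>j<m. \<Sum>i\<in>{\<kappa> j..<\<kappa> (Suc j)}. (Z i - G i)^2)"
    using sum_blocks[of m \<kappa> "\<lambda>i. (Z i - G i)^2"] \<kappa> by simp
  also have "\<dots> = (\<Sum>j<m. \<Sum>i\<in>{\<kappa> j..<\<kappa> (Suc j)}. (v j - G i)^2)"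
    by (intro sum.cong refl) (simp add: Zb)
  finally have fid: "(\<Sum>i\<in>{Suc a..<b}. (Z i - G i)^2) = (\<Sum>j<m. \<Sum>i\<in>{\<kappa> j..<\<kappa> (Suc j)}. (v j - G i)^2)" .
  have "en \<beta> \<delta> \<phi> G W a b \<le> en \<beta> \<delta> \<phi> G Z a b"
    using min ab unfolding locmin_def by (auto simp: Z_def)
  also have "\<dots> \<le> (real m + 1) * B + \<beta> * \<delta> * (\<Sum>j<m. \<Sum>i\<in>{\<kappa> j..<\<kappa> (Suc j)}. (v j - G i)^2)"
    unfolding en_def fid using jumps by simp
  finally show ?thesis .
qed

text \<open>Each block takes the value of the line at its mean position, so all values stay below
  \<open>\<bar>M\<bar> * R\<close> and the cost of an increment is only needed up to size
  \<open>2 * C\<close>.\<close>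

lemma equal_partition_competitor:
  assumes min: "locmin \<beta> \<delta> \<phi> G W n" and ab: "a < b" "b < n" and m: "m \<ge> 1"
    and nn: "\<beta> \<ge> 0" "\<delta> \<ge> 0" "\<epsilon> \<ge> 0" "B \<ge> 0" and \<phi>0: "\<phi> 0 = 0"
    and C: "\<bar>W a\<bar> \<le> C" "\<bar>W b\<bar> \<le> C"
    and win: "\<bar>gpos \<kappa>' \<delta> a\<bar> \<le> R" "\<bar>gpos \<kappa>' \<delta> b\<bar> \<le> R" "\<bar>M\<bar> * R \<le> C"
    and B: "\<And>d. \<bar>d\<bar> \<le> 2 * C \<Longrightarrow> \<phi> d \<le> B"
    and G: "\<And>i. a \<le> i \<Longrightarrow> i < b \<Longrightarrow> \<bar>G i - M * gpos \<kappa>' \<delta> i\<bar> \<le> \<epsilon>"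
  defines "l \<equiv> (real b - real a - 1) * \<delta> / real m + \<delta>"
  shows "en \<beta> \<delta> \<phi> G W a b \<le> (real m + 1) * B + \<beta> * real m * (M^2 * l^3 / 12 + 2 * \<epsilon> * \<bar>M\<bar> * l^2 + \<epsilon>^2 * l)"
proof -
  define P where "P = b - Suc a"
  have P: "real P = real b - real a - 1" using ab by (simp add: P_def of_nat_diff)
  \<comment> \<open>Rounding down makes every block at most one cell longer than the average. This
    is the additional \<delta> in \<open>l\<close>.\<close>
  define \<kappa> where "\<kappa> j = Suc a + (j * P) div m" for j
  have \<kappa>mono: "\<kappa> i \<le> \<kappa> j" if "i \<le> j" for i j unfolding \<kappa>_def using that by (simp add: div_le_mono mult_le_mono1)
  have \<kappa>0: "\<kappa> 0 = Suc a" by (simp add: \<kappa>_def)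
  have \<kappa>m: "\<kappa> m = b" using m ab by (simp add: \<kappa>_def P_def)
  have bl: "real (\<kappa> (Suc j)) - real (\<kappa> j) \<le> real P / real m + 1" for j
  proof -
    have "real ((Suc j * P) div m) \<le> real (Suc j * P) / real m" by (rule of_nat_div_le_of_nat)
    moreover have "real (j * P) / real m < real ((j * P) div m) + 1"
      using m by (metis One_nat_def floor_divide_of_nat_eq floor_less_cancel less_eq_Suc_le floor_of_nat of_int_floor_le of_int_of_nat_eq real_of_int_floor_add_one_gt)
    moreover have "real (Suc j * P) / real m = real (j * P) / real m + real P / real m"
      by (simp add: add_divide_distrib algebra_simps)
    ultimately show ?thesis unfolding \<kappa>_def by simp
  qed
  define v where "v j = M * gmid \<kappa>' \<delta> (\<kappa> j) (\<kappa> (Suc j))" for j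
  have v: "\<bar>v j\<bar> \<le> C" if "j < m" for j
  proof -
    have "Suc a \<le> \<kappa> j" "\<kappa> (Suc j) \<le> b" "\<kappa> j \<le> \<kappa> (Suc j)"
      using that \<kappa>mono[of 0 j] \<kappa>mono[of "Suc j" m] \<kappa>mono[of j "Suc j"] \<kappa>0 \<kappa>m by auto
    then have b: "real a \<le> (real (\<kappa> j) + real (\<kappa> (Suc j)) - 1) / 2" "(real (\<kappa> j) + real (\<kappa> (Suc j)) - 1) / 2 \<le> real b" by auto
    have "gpos \<kappa>' \<delta> a \<le> gmid \<kappa>' \<delta> (\<kappa> j) (\<kappa> (Suc j))" unfolding gpos_def gmid_def using b nn by (intro mult_right_mono) auto
    moreover have "gmid \<kappa>' \<delta> (\<kappa> j) (\<kappa> (Suc j)) \<le> gpos \<kappa>' \<delta> b" unfolding gpos_def gmid_def using b nn by (intro mult_right_mono) auto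
    ultimately have "\<bar>gmid \<kappa>' \<delta> (\<kappa> j) (\<kappa> (Suc j))\<bar> \<le> R" using win by linarith
    then have "\<bar>v j\<bar> \<le> \<bar>M\<bar> * R" unfolding v_def abs_mult by (intro mult_left_mono) auto
    then show ?thesis using win by simp
  qed
  have "en \<beta> \<delta> \<phi> G W a b \<le> (real m + 1) * B + \<beta> * \<delta> * (\<Sum>j<m. \<Sum>i\<in>{\<kappa> j..<\<kappa> (Suc j)}. (v j - G i)^2)"
  proof (rule block_competitor[OF min ab \<kappa>0 \<kappa>m _ \<phi>0 _ nn(4)])
    fix p q assume "p \<in> insert (W a) (insert (W b) (v ` {..<m}))" "q \<in> insert (W a) (insert (W b) (v ` {..<m}))"
    then have "\<bar>p\<bar> \<le> C" "\<bar>q\<bar> \<le> C" using C v by auto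
    then show "\<phi> (p - q) \<le> B" by (intro B) linarith
  qed (rule \<kappa>mono)
  also have "\<beta> * \<delta> * (\<Sum>j<m. \<Sum>i\<in>{\<kappa> j..<\<kappa> (Suc j)}. (v j - G i)^2)
     = \<beta> * (\<Sum>j<m. \<delta> * (\<Sum>i\<in>{\<kappa> j..<\<kappa> (Suc j)}. (v j - G i)^2))"
    by (simp add: sum_distrib_left mult.assoc)
  also have "\<dots> \<le> \<beta> * (\<Sum>j<m. (M^2 * l^3 / 12 + 2 * \<epsilon> * \<bar>M\<bar> * l^2 + \<epsilon>^2 * l))"
  proof (intro mult_left_mono sum_mono)
    fix j assume "j \<in> {..<m}"
    then have j: "Suc a \<le> \<kappa> j" "\<kappa> (Suc j) \<le> b" "\<kappa> j \<le> \<kappa> (Suc j)"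
      using \<kappa>mono[of 0 j] \<kappa>mono[of "Suc j" m] \<kappa>mono[of j "Suc j"] \<kappa>0 \<kappa>m by auto
    define l' where "l' = (real (\<kappa> (Suc j)) - real (\<kappa> j)) * \<delta>"
    have l'0: "0 \<le> l'" using j nn by (simp add: l'_def)
    have "l' \<le> (real P / real m + 1) * \<delta>" unfolding l'_def using bl nn by (intro mult_right_mono)
    also have "\<dots> = l" by (simp add: l_def P algebra_simps)
    finally have ll: "l' \<le> l" .
    have "\<delta> * (\<Sum>i\<in>{\<kappa> j..<\<kappa> (Suc j)}. (v j - G i)^2) \<le> M^2 * l'^3 / 12 + 2 * \<epsilon> * \<bar>M\<bar> * l'^2 + \<epsilon>^2 * l'"
      unfolding v_def l'_def using j nn by (intro block_upper) (auto intro!: G)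
    also have "\<dots> \<le> M^2 * l^3 / 12 + 2 * \<epsilon> * \<bar>M\<bar> * l^2 + \<epsilon>^2 * l"
      using ll l'0 nn by (intro add_mono mult_left_mono divide_right_mono power_mono) auto
    finally show "\<delta> * (\<Sum>i\<in>{\<kappa> j..<\<kappa> (Suc j)}. (v j - G i)^2) \<le> M^2 * l^3 / 12 + 2 * \<epsilon> * \<bar>M\<bar> * l^2 + \<epsilon>^2 * l" .
  qed (use nn in auto)
  finally show ?thesis by (simp add: mult.assoc)
qed

section \<open>Asymptotics of local minimizers\<close>

lemma small_eps:
  fixes K \<eta> :: real
  assumes "\<eta> > 0"
  obtains \<epsilon> where "\<epsilon> > 0" "\<epsilon> \<le> 1" "\<epsilon> \<le> \<eta>" "K * \<epsilon> \<le> \<eta>"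
proof -
  define \<epsilon> where "\<epsilon> = min 1 (\<eta> / (\<bar>K\<bar> + 1))"
  have e: "\<epsilon> > 0" "\<epsilon> \<le> 1" using assms by (auto simp: \<epsilon>_def)
  have "(\<bar>K\<bar> + 1) * \<epsilon> \<le> (\<bar>K\<bar> + 1) * (\<eta> / (\<bar>K\<bar> + 1))" unfolding \<epsilon>_def by (intro mult_left_mono) auto
  also have "\<dots> = \<eta>" by (simp add: add_nonneg_eq_0_iff)
  finally have "\<bar>K\<bar> * \<epsilon> + \<epsilon> \<le> \<eta>" by (simp add: distrib_right)
  moreover have "K * \<epsilon> \<le> \<bar>K\<bar> * \<epsilon>" "0 \<le> \<bar>K\<bar> * \<epsilon>" using e by (auto intro: mult_right_mono)
  ultimately have "\<epsilon> \<le> \<eta>" "K * \<epsilon> \<le> \<eta>" using e by linarith+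
  with e show thesis by (rule that)
qed

lemma gpos_diff: "gpos \<kappa> \<delta> b - gpos \<kappa> \<delta> a = (real b - real a) * \<delta>"
  by (simp add: gpos_def algebra_simps)

lemma gpos_mono: "\<delta> \<ge> 0 \<Longrightarrow> a \<le> b \<Longrightarrow> gpos \<kappa> \<delta> a \<le> gpos \<kappa> \<delta> b"
  by (simp add: gpos_def mult_right_mono)

lemma abs_diff_le_sum:
  fixes w :: "nat \<Rightarrow> real"
  assumes "a \<le> b" shows "\<bar>w b - w a\<bar> \<le> (\<Sum>i\<in>{a..<b}. \<bar>w (Suc i) - w i\<bar>)"
  using sum_Suc_diff'[OF assms, of w] sum_abs[of "\<lambda>i. w (Suc i) - w i" "{a..<b}"] by simp

lemma ex_cell_le_average:
  fixes h :: "nat \<Rightarrow> real"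
  assumes "a < b" "b - a \<ge> 2"
  shows "\<exists>i. a < i \<and> i < b \<and> (real b - real a - 1) * h i \<le> (\<Sum>i\<in>{Suc a..<b}. h i)"
proof (rule ccontr)
  assume n: "\<not> ?thesis"
  define S where "S = (\<Sum>i\<in>{Suc a..<b}. h i)"
  have pos: "real b - real a - 1 > 0" using assms by linarith
  have "S < (\<Sum>i\<in>{Suc a..<b}. h i)"
  proof -
    have "(\<Sum>i\<in>{Suc a..<b}. S / (real b - real a - 1)) < (\<Sum>i\<in>{Suc a..<b}. h i)"
    proof (rule sum_strict_mono)
      fix i assume "i \<in> {Suc a..<b}"
      then show "S / (real b - real a - 1) < h i" using n pos by (auto simp: S_def field_simps)
    qed (use assms in auto)
    moreover have "(\<Sum>i\<in>{Suc a..<b}. S / (real b - real a - 1)) = S"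
    proof -
      have "real (card {Suc a..<b}) = real b - real a - 1" using assms by (simp add: of_nat_diff)
      then show ?thesis using pos unfolding sum_constant by (simp only:) simp
    qed
    ultimately show ?thesis by simp
  qed
  then show False by (simp add: S_def)
qed

text \<open>\<open>\<delta> n\<close> is the mesh after rescaling, \<open>\<phi> n\<close> the cost of an increment, \<open>\<alpha>\<close> its limit, \<open>W n\<close> and \<open>G n\<close> the cell values of the
  blow-up and of the forcing term, and \<open>k n\<close> the cell of the centre. Increments of size at least \<open>\<theta> n\<close> cost about \<open>\<alpha>\<close>;
  summing \<open>phi_small\<close> over a window bounds the variation due to the others.\<close>

locale blow =
  fixes \<beta> M \<alpha> C1 :: real and \<delta> \<theta> :: "nat \<Rightarrow> real" and \<phi> :: "nat \<Rightarrow> real \<Rightarrow> real"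
    and W G :: "nat \<Rightarrow> nat \<Rightarrow> real" and k :: "nat \<Rightarrow> nat"
  assumes beta: "\<beta> > 0" and alpha: "\<alpha> > 0" and C1: "C1 \<ge> 0"
    and dpos: "\<forall>\<^sub>F n in sequentially. \<delta> n > 0" and d0: "\<delta> \<longlonglongrightarrow> 0"
    and phi_nonneg: "\<forall>\<^sub>F n in sequentially. \<forall>d. \<phi> n d \<ge> 0" and phi0: "\<And>n. \<phi> n 0 = 0"
    and minim: "\<forall>\<^sub>F n in sequentially. locmin \<beta> (\<delta> n) (\<phi> n) (G n) (W n) n"
    and room: "\<And>R. \<forall>\<^sub>F n in sequentially. real (k n) * \<delta> n \<ge> R \<and> (real n - real (k n)) * \<delta> n \<ge> R"
    and Gapp: "\<And>R \<epsilon>. \<epsilon> > 0 \<Longrightarrow> \<forall>\<^sub>F n in sequentially. \<forall>i. \<bar>gpos (k n) (\<delta> n) i\<bar> \<le> R \<longrightarrow> \<bar>G n i - M * gpos (k n) (\<delta> n) i\<bar> \<le> \<epsilon>"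
    and phi_up: "\<And>C \<epsilon>. \<epsilon> > 0 \<Longrightarrow> \<forall>\<^sub>F n in sequentially. \<forall>d. \<bar>d\<bar> \<le> C \<longrightarrow> \<phi> n d \<le> \<alpha> + \<epsilon>"
    and phi_low: "\<And>\<epsilon>. \<epsilon> > 0 \<Longrightarrow> \<forall>\<^sub>F n in sequentially. \<forall>d. \<bar>d\<bar> \<ge> \<theta> n \<longrightarrow> \<phi> n d \<ge> \<alpha> - \<epsilon>"
    and phi_small: "\<And>\<epsilon>. \<epsilon> > 0 \<Longrightarrow> \<forall>\<^sub>F n in sequentially. \<forall>d. \<bar>d\<bar> < \<theta> n \<longrightarrow> \<bar>d\<bar> \<le> \<epsilon> * \<delta> n + \<epsilon> * \<phi> n d"
    and crude: "\<And>C. \<forall>\<^sub>F n in sequentially. \<forall>p q. (\<bar>p\<bar> \<le> C \<or> (\<exists>i<n. p = W n i)) \<longrightarrow> (\<bar>q\<bar> \<le> C \<or> (\<exists>i<n. q = W n i))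
                  \<longrightarrow> \<phi> n (p - q) \<le> C1"
begin

abbreviation y :: "nat \<Rightarrow> nat \<Rightarrow> real" where "y n i \<equiv> gpos (real (k n)) (\<delta> n) i"
abbreviation mid :: "nat \<Rightarrow> nat \<Rightarrow> nat \<Rightarrow> real" where "mid n a b \<equiv> gmid (real (k n)) (\<delta> n) a b"
abbreviation enW :: "nat \<Rightarrow> nat \<Rightarrow> nat \<Rightarrow> real" where "enW n a b \<equiv> en \<beta> (\<delta> n) (\<phi> n) (G n) (W n) a b"

section \<open>A priori bounds on windows of fixed radius\<close>

definition big :: "nat \<Rightarrow> nat \<Rightarrow> bool" where "big n i \<longleftrightarrow> \<theta> n \<le> \<bar>W n (Suc i) - W n i\<bar>"

definition win :: "nat \<Rightarrow> real \<Rightarrow> nat \<Rightarrow> nat \<Rightarrow> bool" where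
  "win n R a b \<longleftrightarrow> a < b \<and> \<bar>y n a\<bar> \<le> R \<and> \<bar>y n b\<bar> \<le> R"

lemma d_small: "\<epsilon> > 0 \<Longrightarrow> \<forall>\<^sub>F n in sequentially. \<delta> n \<le> \<epsilon>"
  using order_tendstoD(2)[OF d0, of \<epsilon>] by (auto elim!: eventually_mono)

lemma win_lt: "\<forall>\<^sub>F n in sequentially. \<forall>i. \<bar>y n i\<bar> \<le> R \<longrightarrow> i < n"
  using dpos room[of "R + 1"]
proof eventually_elim
  case (elim n)
  show ?case
  proof (intro allI impI)
    fix i assume "\<bar>y n i\<bar> \<le> R"
    then have "(real i - real (k n)) * \<delta> n < (real n - real (k n)) * \<delta> n" using elim unfolding gpos_def by linarith
    then show "i < n" using elim(1) by (simp add: mult_less_cancel_right)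
  qed
qed

lemma win_mono:
  assumes "\<delta> n \<ge> 0" "\<bar>y n a\<bar> \<le> R" "\<bar>y n b\<bar> \<le> R" "a \<le> i" "i \<le> b"
  shows "\<bar>y n i\<bar> \<le> R"
  using gpos_mono[of "\<delta> n" a i "k n"] gpos_mono[of "\<delta> n" i b "k n"] assms by linarith

lemma win_sub: "\<delta> n \<ge> 0 \<Longrightarrow> win n R a b \<Longrightarrow> a \<le> a' \<Longrightarrow> a' < b' \<Longrightarrow> b' \<le> b \<Longrightarrow> win n R a' b'"
  unfolding win_def by (auto intro: win_mono[of n a R b])

lemma win_len: "win n R a b \<Longrightarrow> (real b - real a) * \<delta> n \<le> 2 * R"
  unfolding win_def gpos_diff[of "real (k n)", symmetric] by linarith

lemma win_R0: "win n R a b \<Longrightarrow> R \<ge> 0"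
  by (auto simp: win_def)

text \<open>The competitor vanishes inside the window. Its two end increments involve values of
  \<open>W\<close> of unknown size and are therefore charged with \<open>C1\<close>. For
  \<open>M = 0\<close> the bound is \<open>2 * C1\<close> up to an arbitrarily small error, whatever
  the radius; the case of zero slope rests on this.\<close>

lemma energy_bound:
  assumes "\<epsilon> > 0"
  shows "\<forall>\<^sub>F n in sequentially. \<forall>a b. win n R a b \<longrightarrow> enW n a b \<le> 2 * C1 + \<beta> * (2 * R) * (\<bar>M\<bar> * R + \<epsilon>)^2"
  using dpos win_lt[of R] minim Gapp[OF assms, of R] crude[of 0]
proof eventually_elim
  case (elim n)
  show ?case
  proof (intro allI impI)
    fix a b assume w: "win n R a b"
    then have ab: "a < b" "b < n" "\<bar>y n a\<bar> \<le> R" "\<bar>y n b\<bar> \<le> R" using elim(2) by (auto simp: win_def)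
    have R0: "R \<ge> 0" using win_R0[OF w] .
    have "enW n a b \<le> (real 1 + 1) * C1
       + \<beta> * \<delta> n * (\<Sum>j<1. \<Sum>i\<in>{(\<lambda>j. if j = 0 then Suc a else b) j..<(\<lambda>j. if j = 0 then Suc a else b) (Suc j)}. ((\<lambda>_. 0) j - G n i)^2)"
    proof (rule block_competitor[OF elim(3) ab(1,2)])
      fix p q assume "p \<in> insert (W n a) (insert (W n b) ((\<lambda>_. 0) ` {..<1::nat}))"
        "q \<in> insert (W n a) (insert (W n b) ((\<lambda>_. 0) ` {..<1::nat}))"
      moreover have "a < n" using ab by simp
      ultimately have "(\<bar>p\<bar> \<le> 0 \<or> (\<exists>i<n. p = W n i))" "(\<bar>q\<bar> \<le> 0 \<or> (\<exists>i<n. q = W n i))" using ab(2) by auto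
      then show "\<phi> n (p - q) \<le> C1" using elim(5) by blast
    qed (use phi0 C1 ab in auto)
    also have "\<dots> = 2 * C1 + \<beta> * (\<delta> n * (\<Sum>i\<in>{Suc a..<b}. (G n i)^2))" by simp
    also have "\<delta> n * (\<Sum>i\<in>{Suc a..<b}. (G n i)^2) \<le> \<delta> n * (\<Sum>i\<in>{a..<b}. (\<bar>M\<bar> * R + \<epsilon>)^2)"
    proof (intro mult_left_mono order.trans[OF sum_mono sum_mono2])
      fix i assume "i \<in> {Suc a..<b}"
      then have i: "\<bar>y n i\<bar> \<le> R" using win_mono[of n a R b i] elim(1) ab by auto
      then have g: "\<bar>G n i - M * y n i\<bar> \<le> \<epsilon>" using elim(4) by auto
      have "\<bar>M * y n i\<bar> \<le> \<bar>M\<bar> * R" unfolding abs_mult using i by (intro mult_left_mono) auto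
      then have "\<bar>G n i\<bar> \<le> \<bar>M\<bar> * R + \<epsilon>" using g by linarith
      then show "(G n i)^2 \<le> (\<bar>M\<bar> * R + \<epsilon>)^2" by (metis abs_ge_zero power2_abs power_mono)
    qed (use elim in auto)
    also have "\<delta> n * (\<Sum>i\<in>{a..<b}. (\<bar>M\<bar> * R + \<epsilon>)^2) = ((real b - real a) * \<delta> n) * (\<bar>M\<bar> * R + \<epsilon>)^2"
      using ab by (simp add: of_nat_diff algebra_simps)
    also have "\<dots> \<le> (2 * R) * (\<bar>M\<bar> * R + \<epsilon>)^2" using win_len[OF w] by (intro mult_right_mono) auto
    finally show "enW n a b \<le> 2 * C1 + \<beta> * (2 * R) * (\<bar>M\<bar> * R + \<epsilon>)^2" using beta by (simp add: mult.assoc)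
  qed
qed

lemma en_parts:
  assumes "\<delta> n > 0" "\<forall>d. \<phi> n d \<ge> 0"
  shows "(\<Sum>i\<in>{a..<b}. \<phi> n (W n (Suc i) - W n i)) \<le> enW n a b"
        "\<beta> * \<delta> n * (\<Sum>i\<in>{Suc a..<b}. (W n i - G n i)^2) \<le> enW n a b"
  unfolding en_def using assms beta by (auto intro!: sum_nonneg mult_nonneg_nonneg)

lemma energy_bound_ex:
  obtains C where "C \<ge> 0" "\<forall>\<^sub>F n in sequentially. \<forall>a b. win n R a b \<longrightarrow> enW n a b \<le> C"
proof
  show "\<forall>\<^sub>F n in sequentially. \<forall>a b. win n R a b \<longrightarrow> enW n a b \<le> \<bar>2 * C1 + \<beta> * (2 * R) * (\<bar>M\<bar> * R + 1)^2\<bar>"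
    using energy_bound[of 1 R] by (auto elim!: eventually_mono intro: order.trans[OF _ abs_ge_self])
qed simp

lemma small_variation:
  assumes "\<eta> > 0"
  shows "\<forall>\<^sub>F n in sequentially. \<forall>a b. win n R a b \<longrightarrow> (\<Sum>i\<in>{i\<in>{a..<b}. \<not> big n i}. \<bar>W n (Suc i) - W n i\<bar>) \<le> \<eta>"
proof -
  obtain C where C: "C \<ge> 0" "\<forall>\<^sub>F n in sequentially. \<forall>a b. win n R a b \<longrightarrow> enW n a b \<le> C" by (rule energy_bound_ex)
  obtain \<epsilon> where e: "\<epsilon> > 0" "(2 * R + C) * \<epsilon> \<le> \<eta>" using small_eps[OF assms] by metis
  show ?thesis
    using dpos phi_nonneg C(2) phi_small[OF e(1)]
  proof eventually_elim
    case (elim n)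
    show ?case
    proof (intro allI impI)
      fix a b assume w: "win n R a b"
      have ab: "a < b" using w by (simp add: win_def)
      have "(\<Sum>i\<in>{i\<in>{a..<b}. \<not> big n i}. \<bar>W n (Suc i) - W n i\<bar>) \<le> (\<Sum>i\<in>{i\<in>{a..<b}. \<not> big n i}. \<epsilon> * \<delta> n + \<epsilon> * \<phi> n (W n (Suc i) - W n i))"
        by (intro sum_mono) (use elim(4) in \<open>auto simp: big_def not_le\<close>)
      also have "\<dots> \<le> (\<Sum>i\<in>{a..<b}. \<epsilon> * \<delta> n + \<epsilon> * \<phi> n (W n (Suc i) - W n i))"
        using elim e by (intro sum_mono2) (auto intro!: add_nonneg_nonneg)
      also have "\<dots> = \<epsilon> * ((real b - real a) * \<delta> n) + \<epsilon> * (\<Sum>i\<in>{a..<b}. \<phi> n (W n (Suc i) - W n i))"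
        using ab by (simp add: sum.distrib sum_distrib_left of_nat_diff algebra_simps)
      also have "\<dots> \<le> \<epsilon> * (2 * R) + \<epsilon> * C"
      proof -
        have "enW n a b \<le> C" using elim(3) w by blast
        then have "(\<Sum>i\<in>{a..<b}. \<phi> n (W n (Suc i) - W n i)) \<le> C" using en_parts(1)[OF elim(1,2), of a b] by linarith
        then show ?thesis using win_len[OF w] e by (intro add_mono mult_left_mono) auto
      qed
      also have "\<dots> \<le> \<eta>" using e by (simp add: algebra_simps)
      finally show "(\<Sum>i\<in>{i\<in>{a..<b}. \<not> big n i}. \<bar>W n (Suc i) - W n i\<bar>) \<le> \<eta>" .
    qed
  qed
qed

lemma oscillation:
  assumes "\<eta> > 0"
  shows "\<forall>\<^sub>F n in sequentially. \<forall>a b. a \<le> b \<and> \<bar>y n a\<bar> \<le> R \<and> \<bar>y n b\<bar> \<le> R \<and> (\<forall>i\<in>{a..<b}. \<not> big n i)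
     \<longrightarrow> \<bar>W n b - W n a\<bar> \<le> \<eta>"
  using small_variation[OF assms, of R]
proof eventually_elim
  case (elim n)
  show ?case
  proof (intro allI impI)
    fix a b assume w: "a \<le> b \<and> \<bar>y n a\<bar> \<le> R \<and> \<bar>y n b\<bar> \<le> R \<and> (\<forall>i\<in>{a..<b}. \<not> big n i)"
    show "\<bar>W n b - W n a\<bar> \<le> \<eta>"
    proof (cases "a = b")
      case False
      then have "win n R a b" using w by (auto simp: win_def)
      then have "(\<Sum>i\<in>{i\<in>{a..<b}. \<not> big n i}. \<bar>W n (Suc i) - W n i\<bar>) \<le> \<eta>" using elim by blast
      moreover have "{i\<in>{a..<b}. \<not> big n i} = {a..<b}" using w by auto
      ultimately show ?thesis using abs_diff_le_sum[of a b "W n"] w by auto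
    qed (use assms in auto)
  qed
qed

lemma big_count:
  obtains K :: nat where "\<forall>\<^sub>F n in sequentially. \<forall>a b. win n R a b \<longrightarrow> card {i\<in>{a..<b}. big n i} \<le> K"
proof -
  obtain C where C: "C \<ge> 0" "\<forall>\<^sub>F n in sequentially. \<forall>a b. win n R a b \<longrightarrow> enW n a b \<le> C" by (rule energy_bound_ex)
  have "\<forall>\<^sub>F n in sequentially. \<forall>a b. win n R a b \<longrightarrow> card {i\<in>{a..<b}. big n i} \<le> nat \<lceil>2 * C / \<alpha>\<rceil>"
    using dpos phi_nonneg C(2) phi_low[OF half_gt_zero[OF alpha]]
  proof eventually_elim
    case (elim n)
    show ?case
    proof (intro allI impI)
      fix a b assume w: "win n R a b"
      have "real (card {i\<in>{a..<b}. big n i}) * (\<alpha> / 2) = (\<Sum>i\<in>{i\<in>{a..<b}. big n i}. \<alpha> / 2)" by simp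
      also have "\<dots> \<le> (\<Sum>i\<in>{i\<in>{a..<b}. big n i}. \<phi> n (W n (Suc i) - W n i))"
        by (intro sum_mono) (use elim(4) in \<open>auto simp: big_def\<close>)
      also have "\<dots> \<le> (\<Sum>i\<in>{a..<b}. \<phi> n (W n (Suc i) - W n i))" using elim by (intro sum_mono2) auto
      also have "\<dots> \<le> C" using en_parts(1)[OF elim(1,2), of a b] elim(3) w by force
      finally have "real (card {i\<in>{a..<b}. big n i}) \<le> 2 * C / \<alpha>" using alpha by (simp add: field_simps)
      then show "card {i\<in>{a..<b}. big n i} \<le> nat \<lceil>2 * C / \<alpha>\<rceil>" by linarith
    qed
  qed
  then show thesis by (rule that)
qed

text \<open>Coefficient of the fidelity \<open>c l^3\<close> of a plateau of length \<open>l\<close>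
  whose value is that of the line at its midpoint.\<close>

definition c :: real where "c = \<beta> * M^2 / 12"

text \<open>Since the values at \<open>a\<close> and \<open>b\<close> are bounded by
  \<open>C\<close>, each of the \<open>m + 1\<close> increments costs about \<alpha> instead of
  \<open>C1\<close>. The fidelity of \<open>m\<close> equal plateaus is
  \<open>m * c * (l / m)^3 = c * l^3 / m^2\<close>.\<close>

lemma partition_bound:
  assumes "\<eta> > 0"
  shows "\<forall>\<^sub>F n in sequentially. \<forall>a b m. win n R a b \<and> \<bar>W n a\<bar> \<le> C \<and> \<bar>W n b\<bar> \<le> C \<and> 1 \<le> m \<and> m \<le> mm
     \<longrightarrow> enW n a b \<le> (real m + 1) * \<alpha> + c * ((real b - real a - 1) * \<delta> n)^3 / (real m)^2 + \<eta>"
proof (cases "R \<ge> 0 \<and> C \<ge> 0")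
  case True
  \<comment> \<open>Bounds the length of every block: at most the window length \<open>2 * R\<close>
    and one further mesh, taken to be at most 1.\<close>
  define L where "L = 2 * R + 1"
  have L: "L \<ge> 1" using True by (simp add: L_def)
  define K where "K = real mm + 1 + \<beta> * real mm * (M^2 * L^2 / 4 + 2 * \<bar>M\<bar> * L^2 + L)"
  obtain \<epsilon> where e: "\<epsilon> > 0" "\<epsilon> \<le> 1" "K * \<epsilon> \<le> \<eta>" using small_eps[OF assms] by metis
  show ?thesis
    using dpos win_lt[of R] minim Gapp[OF e(1), of R] phi_up[OF e(1), of "2 * (C + \<bar>M\<bar> * R)"] d_small[OF e(1)]
  proof eventually_elim
    case (elim n)
    show ?case
    proof (intro allI impI)
      fix a b m assume w: "win n R a b \<and> \<bar>W n a\<bar> \<le> C \<and> \<bar>W n b\<bar> \<le> C \<and> 1 \<le> m \<and> m \<le> mm"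
      then have ab: "a < b" "b < n" "\<bar>y n a\<bar> \<le> R" "\<bar>y n b\<bar> \<le> R" and m: "1 \<le> m" "m \<le> mm" using elim(2) by (auto simp: win_def)
      define q where "q = (real b - real a - 1) * \<delta> n / real m"
      define l where "l = q + \<delta> n"
      have q0: "q \<ge> 0" using ab m elim(1) by (simp add: q_def)
      have "(real b - real a - 1) * \<delta> n \<le> 2 * R" using win_len[of n R a b] w elim(1) by (simp add: algebra_simps)
      moreover have "q \<le> (real b - real a - 1) * \<delta> n"
      proof -
        have "0 \<le> (real b - real a - 1) * \<delta> n" using ab elim(1) by simp
        then have "(real b - real a - 1) * \<delta> n * 1 \<le> (real b - real a - 1) * \<delta> n * real m" using m by (intro mult_left_mono) auto
        then show ?thesis unfolding q_def using m by (simp add: divide_le_eq)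
      qed
      ultimately have l: "0 \<le> l" "l \<le> L" using q0 elim(1,6) e by (auto simp: l_def L_def)
      have C': "\<bar>W n a\<bar> \<le> C + \<bar>M\<bar> * R" "\<bar>W n b\<bar> \<le> C + \<bar>M\<bar> * R" "\<bar>M\<bar> * R \<le> C + \<bar>M\<bar> * R"
        using w True by (auto intro: add_increasing2)
      have "enW n a b \<le> (real m + 1) * (\<alpha> + \<epsilon>) + \<beta> * real m * (M^2 * l^3 / 12 + 2 * \<epsilon> * \<bar>M\<bar> * l^2 + \<epsilon>^2 * l)"
        unfolding l_def q_def
      proof (rule equal_partition_competitor[OF elim(3) ab(1,2) m(1), where R = R and C = "C + \<bar>M\<bar> * R" and \<kappa>' = "real (k n)"])
        show "\<And>i. a \<le> i \<Longrightarrow> i < b \<Longrightarrow> \<bar>G n i - M * y n i\<bar> \<le> \<epsilon>"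
          using win_mono[of n a R b] elim(1,4) ab by auto
      qed (use beta elim e alpha phi0 C' ab in auto)
      also have "\<dots> \<le> (real m + 1) * (\<alpha> + \<epsilon>) + \<beta> * real m * (M^2 * (q^3 + 3 * \<epsilon> * L^2) / 12 + 2 * \<epsilon> * \<bar>M\<bar> * L^2 + \<epsilon> * L)"
      proof -
        have "l^3 = q^3 + \<delta> n * (3 * q^2 + 3 * q * \<delta> n + (\<delta> n)^2)"
          unfolding l_def by (simp add: power2_eq_square power3_eq_cube algebra_simps)
        also have "3 * q^2 + 3 * q * \<delta> n + (\<delta> n)^2 \<le> 3 * l^2"
          unfolding l_def using q0 elim(1) by (simp add: power2_eq_square algebra_simps)
        also have "\<dots> \<le> 3 * L^2" using l by (simp add: power_mono)
        finally have "l^3 \<le> q^3 + \<delta> n * (3 * L^2)" using elim(1) by simp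
        also have "\<delta> n * (3 * L^2) \<le> \<epsilon> * (3 * L^2)" using elim(6) by (intro mult_right_mono) auto
        finally have "l^3 \<le> q^3 + 3 * \<epsilon> * L^2" by simp
        moreover have "\<epsilon>^2 * l \<le> \<epsilon> * L"
        proof (intro mult_mono)
          show "\<epsilon>^2 \<le> \<epsilon>" using e by (simp add: power2_eq_square mult_le_cancel_left1)
        qed (use l e in auto)
        moreover have "2 * \<epsilon> * \<bar>M\<bar> * l^2 \<le> 2 * \<epsilon> * \<bar>M\<bar> * L^2" using l e by (intro mult_left_mono power_mono) auto
        ultimately have "M^2 * l^3 / 12 + 2 * \<epsilon> * \<bar>M\<bar> * l^2 + \<epsilon>^2 * l \<le> M^2 * (q^3 + 3 * \<epsilon> * L^2) / 12 + 2 * \<epsilon> * \<bar>M\<bar> * L^2 + \<epsilon> * L"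
          by (intro add_mono divide_right_mono mult_left_mono[of "l^3"]) auto
        then show ?thesis using beta by (intro add_left_mono mult_left_mono) auto
      qed
      also have "\<dots> = (real m + 1) * \<alpha> + c * (real m * q^3) + \<epsilon> * (real m + 1 + \<beta> * real m * (M^2 * L^2 / 4 + 2 * \<bar>M\<bar> * L^2 + L))"
        by (simp add: c_def algebra_simps)
      also have "\<dots> \<le> (real m + 1) * \<alpha> + c * (real m * q^3) + \<epsilon> * K"
        unfolding K_def using e m beta L by (intro add_left_mono mult_left_mono add_mono mult_right_mono) (auto intro!: add_nonneg_nonneg)
      also have "real m * q^3 = ((real b - real a - 1) * \<delta> n)^3 / (real m)^2"
        using m by (simp add: q_def field_simps power2_eq_square power3_eq_cube)
      finally show "enW n a b \<le> (real m + 1) * \<alpha> + c * ((real b - real a - 1) * \<delta> n)^3 / (real m)^2 + \<eta>"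
        using e(3) by (simp add: mult.commute)
    qed
  qed
next
  case False
  then show ?thesis by (intro always_eventually) (auto simp: win_def)
qed

text \<open>A plateau consists of the cells \<open>a, ..., b - 1\<close>; the increment from
  \<open>b - 1\<close> to \<open>b\<close> leaves it and may be large, hence the range
  \<open>{a..<b - 1}\<close>.\<close>

lemma plateau_lower:
  assumes "\<eta> > 0"
  shows "\<forall>\<^sub>F n in sequentially. \<forall>a b. win n R a b \<and> (\<forall>i\<in>{a..<b - 1}. \<not> big n i)
     \<longrightarrow> c * ((real b - real a) * \<delta> n)^3 + \<beta> * ((real b - real a) * \<delta> n) * (max 0 (\<bar>W n a - M * mid n a b\<bar> - \<eta>))^2
          - \<eta> * ((real b - real a) * \<delta> n) \<le> \<beta> * \<delta> n * (\<Sum>i\<in>{a..<b}. (W n i - G n i)^2)"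
proof (cases "R \<ge> 0")
  case True
  define K where "K = \<beta> * (M^2 / 12 + 8 * \<bar>M\<bar> * R)"
  have K0: "K \<ge> 0" using True beta by (simp add: K_def)
  obtain \<epsilon> where e: "\<epsilon> > 0" "\<epsilon> \<le> 1" "(K + 2) * \<epsilon> \<le> \<eta>" using small_eps[OF assms] by metis
  then have e2: "2 * \<epsilon> \<le> \<eta>" "K * \<epsilon> \<le> \<eta>"
    using mult_nonneg_nonneg[OF K0 less_imp_le[OF e(1)]] unfolding distrib_right by linarith+
  show ?thesis
    using dpos Gapp[OF e(1), of R] oscillation[OF e(1), of R] d_small[OF e(1)]
  proof eventually_elim
    case (elim n)
    show ?case
    proof (intro allI impI)
      fix a b assume w: "win n R a b \<and> (\<forall>i\<in>{a..<b - 1}. \<not> big n i)"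
      then have ab: "a < b" "\<bar>y n a\<bar> \<le> R" "\<bar>y n b\<bar> \<le> R" by (auto simp: win_def)
      define l where "l = (real b - real a) * \<delta> n"
      have l: "0 \<le> l" "l \<le> 2 * R" using win_len[of n R a b] w elim(1) ab by (auto simp: l_def)
      have yw: "\<bar>y n i\<bar> \<le> R" if "a \<le> i" "i < b" for i using win_mono[of n a R b i] elim(1) ab that by auto
      have "M^2 * (l^3 - l * (\<delta> n)^2) / 12 + l * (max 0 (\<bar>W n a - M * mid n a b\<bar> - 2 * \<epsilon>))^2 - 4 * \<epsilon> * \<bar>M\<bar> * l^2
         \<le> \<delta> n * (\<Sum>i\<in>{a..<b}. (W n i - G n i)^2)"
        unfolding l_def
      proof (rule block_lower)
        show "\<And>i. a \<le> i \<Longrightarrow> i < b \<Longrightarrow> \<bar>W n i - W n a\<bar> \<le> \<epsilon>"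
        proof -
          fix i assume i: "a \<le> i" "i < b"
          show "\<bar>W n i - W n a\<bar> \<le> \<epsilon>"
          proof (intro elim(3)[rule_format, of a i] conjI ballI)
            fix j assume "j \<in> {a..<i}"
            then have "j \<in> {a..<b - 1}" using i by auto
            then show "\<not> big n j" using w by blast
          qed (use i ab yw in auto)
        qed
      qed (use ab elim e yw in auto)
      then have "\<beta> * (M^2 * (l^3 - l * (\<delta> n)^2) / 12 + l * (max 0 (\<bar>W n a - M * mid n a b\<bar> - 2 * \<epsilon>))^2 - 4 * \<epsilon> * \<bar>M\<bar> * l^2)
         \<le> \<beta> * (\<delta> n * (\<Sum>i\<in>{a..<b}. (W n i - G n i)^2))" using beta by (intro mult_left_mono) auto
      moreover have "c * l^3 + \<beta> * l * (max 0 (\<bar>W n a - M * mid n a b\<bar> - 2 * \<epsilon>))^2 - \<eta> * l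
         \<le> \<beta> * (M^2 * (l^3 - l * (\<delta> n)^2) / 12 + l * (max 0 (\<bar>W n a - M * mid n a b\<bar> - 2 * \<epsilon>))^2 - 4 * \<epsilon> * \<bar>M\<bar> * l^2)"
      proof -
        have "(\<delta> n)^2 \<le> \<epsilon>"
          using elim(1,4) e by (smt (verit) mult_le_cancel_left2 power2_eq_square)
        then have "M^2 / 12 * (\<delta> n)^2 + 4 * \<epsilon> * \<bar>M\<bar> * l \<le> M^2 / 12 * \<epsilon> + 4 * \<epsilon> * \<bar>M\<bar> * (2 * R)"
          using l e by (intro add_mono mult_left_mono) auto
        then have "\<beta> * (M^2 / 12 * (\<delta> n)^2 + 4 * \<epsilon> * \<bar>M\<bar> * l) \<le> \<beta> * (M^2 / 12 * \<epsilon> + 4 * \<epsilon> * \<bar>M\<bar> * (2 * R))"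
          using beta by (intro mult_left_mono) auto
        also have "\<dots> \<le> \<eta>" using e2(2) by (simp add: K_def algebra_simps)
        finally have "\<beta> * (M^2 / 12 * (\<delta> n)^2 + 4 * \<epsilon> * \<bar>M\<bar> * l) * l \<le> \<eta> * l" using l by (intro mult_right_mono)
        moreover have eq: "\<beta> * (M^2 * (l^3 - l * (\<delta> n)^2) / 12 + l * (max 0 (\<bar>W n a - M * mid n a b\<bar> - 2 * \<epsilon>))^2 - 4 * \<epsilon> * \<bar>M\<bar> * l^2)
           = c * l^3 + \<beta> * l * (max 0 (\<bar>W n a - M * mid n a b\<bar> - 2 * \<epsilon>))^2 - \<beta> * (M^2 / 12 * (\<delta> n)^2 + 4 * \<epsilon> * \<bar>M\<bar> * l) * l"
          by (simp add: c_def power2_eq_square algebra_simps diff_divide_distrib)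
        ultimately show ?thesis unfolding eq by (intro diff_left_mono)
      qed
      moreover have "\<beta> * l * (max 0 (\<bar>W n a - M * mid n a b\<bar> - \<eta>))^2 \<le> \<beta> * l * (max 0 (\<bar>W n a - M * mid n a b\<bar> - 2 * \<epsilon>))^2"
        using e2 beta l by (intro mult_left_mono power_mono) auto
      ultimately show "c * ((real b - real a) * \<delta> n)^3 + \<beta> * ((real b - real a) * \<delta> n) * (max 0 (\<bar>W n a - M * mid n a b\<bar> - \<eta>))^2
          - \<eta> * ((real b - real a) * \<delta> n) \<le> \<beta> * \<delta> n * (\<Sum>i\<in>{a..<b}. (W n i - G n i)^2)"
        unfolding l_def[symmetric] by (simp only: mult.assoc)
    qed
  qed
next
  case False
  then show ?thesis by (intro always_eventually) (auto simp: win_def)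
qed

text \<open>An average over cells, turning a bound on the energy into a bound on \<open>W\<close> at
  some cell. The window has twice the length \<open>D\<close> and at least four cells, so that
  length \<open>D\<close> remains after cell \<open>a\<close> is discarded.\<close>

lemma bounded_cell:
  assumes "D > 0"
  shows "\<forall>\<^sub>F n in sequentially. \<forall>a b. win n R a b \<and> (real b - real a) * \<delta> n \<ge> 2 * D
     \<longrightarrow> (\<exists>i. a < i \<and> i < b \<and> \<beta> * D * (W n i - G n i)^2 \<le> \<beta> * \<delta> n * (\<Sum>i\<in>{Suc a..<b}. (W n i - G n i)^2))"
  using dpos d_small[of "D / 2", OF half_gt_zero[OF assms]]
proof eventually_elim
  case (elim n)
  show ?case
  proof (intro allI impI)
    fix a b assume w: "win n R a b \<and> (real b - real a) * \<delta> n \<ge> 2 * D"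
    then have ab: "a < b" by (simp add: win_def)
    have "4 * \<delta> n \<le> (real b - real a) * \<delta> n" using w elim by linarith
    then have 4: "4 \<le> real b - real a" using elim(1) by (simp add: mult_le_cancel_right)
    then have "b - a \<ge> 2" by linarith
    then obtain i where i: "a < i" "i < b" "(real b - real a - 1) * (W n i - G n i)^2 \<le> (\<Sum>i\<in>{Suc a..<b}. (W n i - G n i)^2)"
      using ex_cell_le_average[OF ab, of "\<lambda>i. (W n i - G n i)^2"] by auto
    have "\<beta> * D * (W n i - G n i)^2 \<le> \<beta> * ((real b - real a - 1) * \<delta> n) * (W n i - G n i)^2"
    proof -
      have "D \<le> (real b - real a - 1) * \<delta> n" using w elim assms unfolding left_diff_distrib by linarith
      then show ?thesis using beta by (intro mult_right_mono mult_left_mono) auto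
    qed
    also have "\<dots> = \<beta> * \<delta> n * ((real b - real a - 1) * (W n i - G n i)^2)" by simp
    also have "\<dots> \<le> \<beta> * \<delta> n * (\<Sum>i\<in>{Suc a..<b}. (W n i - G n i)^2)" using i beta elim by (intro mult_left_mono) auto
    finally show "\<exists>i. a < i \<and> i < b \<and> \<beta> * D * (W n i - G n i)^2 \<le> \<beta> * \<delta> n * (\<Sum>i\<in>{Suc a..<b}. (W n i - G n i)^2)"
      using i by blast
  qed
qed

text \<open>Without jumps a window of length \<open>l\<close> costs about \<open>c l^3\<close>,
  whereas two plateaus cost \<open>3 * \<alpha> + c * l^3 / 4\<close>; for long windows this is a
  contradiction. The end values are bounded because some cell is bounded and the oscillation is
  small. The threshold \<open>T\<close> precedes \<open>R\<close>, since it is used later to choose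
  the radius of a window.\<close>

lemma gap_bound:
  assumes M: "M \<noteq> 0"
  obtains T where "T \<ge> 1" "\<forall>R. \<forall>\<^sub>F n in sequentially. \<forall>a b. win n R a b \<and> (real b - real a) * \<delta> n \<ge> T \<longrightarrow> (\<exists>i\<in>{a..<b}. big n i)"
proof -
  have c: "c > 0" using M beta by (simp add: c_def)
  \<comment> \<open>Chosen so that the saving \<open>3/4 * c * S^3\<close> exceeds the cost
    \<open>3 * \<alpha>\<close> of three jumps by more than the accumulated errors, which are at
    most 2. One unit of length is added in the end because cell \<open>a\<close> carries no
    fidelity.\<close>
  define S where "S = 1 + (3 * \<alpha> + 3) / (3 / 4 * c)"
  have S: "S \<ge> 1" "3 / 4 * c * S^3 \<ge> 3 * \<alpha> + 3"
  proof -
    show S1: "S \<ge> 1" using c alpha by (simp add: S_def)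
    have "3 * \<alpha> + 3 \<le> 3 / 4 * c * S" using c by (simp add: S_def field_simps)
    also have "\<dots> \<le> 3 / 4 * c * S^3" using c S1 by (intro mult_left_mono self_le_power) auto
    finally show "3 / 4 * c * S^3 \<ge> 3 * \<alpha> + 3" .
  qed
  have "\<forall>\<^sub>F n in sequentially. \<forall>a b. win n R a b \<and> (real b - real a) * \<delta> n \<ge> S + 1 \<longrightarrow> (\<exists>i\<in>{a..<b}. big n i)" for R
  proof -
    define R' where "R' = max R 1"
    have R': "R' \<ge> 1" by (simp add: R'_def)
    obtain CE where CE: "CE \<ge> 0" "\<forall>\<^sub>F n in sequentially. \<forall>a b. win n R' a b \<longrightarrow> enW n a b \<le> CE" by (rule energy_bound_ex)
    define D where "D = 1 + CE / \<beta>"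
    have D: "D \<ge> 1" "\<beta> * D \<ge> CE" using CE beta by (auto simp: D_def field_simps)
    define C where "C = D + \<bar>M\<bar> * R' + 2"
    \<comment> \<open>The plateau estimate loses this error per unit length, hence at most 1 on a
      window of length \<open>2 * R'\<close>.\<close>
    have \<eta>: "1 / (2 * R') > 0" using R' by simp
    show ?thesis
      using dpos phi_nonneg CE(2) d_small[OF zero_less_one] oscillation[OF zero_less_one, of R'] Gapp[OF zero_less_one, of R']
        bounded_cell[OF zero_less_one, of R'] partition_bound[OF zero_less_one, of R' C 2] plateau_lower[OF \<eta>, of R']
    proof eventually_elim
      case (elim n)
      show ?case
      proof (intro allI impI, rule ccontr)
        fix a b assume w: "win n R a b \<and> (real b - real a) * \<delta> n \<ge> S + 1" and nb: "\<not> (\<exists>i\<in>{a..<b}. big n i)"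
        then have w': "win n R' a b" and ab: "a < b" by (auto simp: win_def R'_def)
        have yw: "\<bar>y n i\<bar> \<le> R'" if "a \<le> i" "i \<le> b" for i using win_mono[of n a R' b i] elim(1) w' that by (auto simp: win_def)
        obtain i where i: "a < i" "i < b" "\<beta> * 1 * (W n i - G n i)^2 \<le> \<beta> * \<delta> n * (\<Sum>i\<in>{Suc a..<b}. (W n i - G n i)^2)"
          using elim(7)[rule_format, of a b] w' w S(1) by auto
        have "enW n a b \<le> CE" using elim(3) w' by blast
        then have "\<beta> * (W n i - G n i)^2 \<le> CE" using i(3) en_parts(2)[OF elim(1,2), of a b] by linarith
        then have "\<beta> * (W n i - G n i)^2 \<le> \<beta> * D" using D by linarith
        then have "(W n i - G n i)^2 \<le> D" using beta by simp
        also have "\<dots> \<le> D^2" using D by (simp add: power2_eq_square)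
        finally have "\<bar>W n i - G n i\<bar> \<le> D" using D by (simp add: abs_le_square_iff[symmetric])
        moreover have "\<bar>G n i - M * y n i\<bar> \<le> 1" using elim(6) yw[of i] i by auto
        moreover have "\<bar>M * y n i\<bar> \<le> \<bar>M\<bar> * R'" unfolding abs_mult using yw[of i] i by (intro mult_left_mono) auto
        ultimately have Wi: "\<bar>W n i\<bar> \<le> C - 1" by (simp add: C_def)
        have "\<bar>W n i - W n a\<bar> \<le> 1" using elim(5)[rule_format, of a i] nb yw i ab by auto
        moreover have "\<bar>W n b - W n i\<bar> \<le> 1" using elim(5)[rule_format, of i b] nb yw i ab by auto
        ultimately have Wab: "\<bar>W n a\<bar> \<le> C" "\<bar>W n b\<bar> \<le> C" using Wi by linarith+
        define l where "l = (real b - real a - 1) * \<delta> n"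
        have l: "S \<le> l" "l \<le> 2 * R'" using w elim(1,4) win_len[OF w'] unfolding l_def left_diff_distrib by auto
        have up: "enW n a b \<le> 3 * \<alpha> + c * l^3 / 4 + 1"
          using elim(8)[rule_format, of a b 2] w' Wab by (simp add: l_def)
        have "Suc a < b" using i by simp
        then have "win n R' (Suc a) b" using win_sub[OF _ w'] elim(1) by auto
        have "c * l^3 + \<beta> * l * (max 0 (\<bar>W n (Suc a) - M * mid n (Suc a) b\<bar> - 1 / (2 * R')))^2 - 1 / (2 * R') * l
             \<le> \<beta> * \<delta> n * (\<Sum>i\<in>{Suc a..<b}. (W n i - G n i)^2)"
        proof -
          have l': "l = (real b - real (Suc a)) * \<delta> n" by (simp add: l_def)
          have "\<forall>i\<in>{Suc a..<b - 1}. \<not> big n i" using nb by auto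
          with \<open>win n R' (Suc a) b\<close> show ?thesis unfolding l' using elim(9) by blast
        qed
        moreover have "1 / (2 * R') * l \<le> 1" using l R' by (simp add: divide_le_eq)
        moreover have "0 \<le> \<beta> * l * (max 0 (\<bar>W n (Suc a) - M * mid n (Suc a) b\<bar> - 1 / (2 * R')))^2"
          using beta l S by (intro mult_nonneg_nonneg) auto
        ultimately have "c * l^3 - 1 \<le> enW n a b" using en_parts(2)[OF elim(1,2), of a b] by linarith
        with up have "3 / 4 * (c * l^3) \<le> 3 * \<alpha> + 2" by linarith
        moreover have "3 / 4 * c * S^3 \<le> 3 / 4 * c * l^3" using l S c by (intro mult_left_mono power_mono) auto
        ultimately show False using S by linarith
      qed
    qed
  qed
  then show thesis using that[of "S + 1"] S by auto
qed

text \<open>The window from \<open>j 0\<close> to \<open>Suc (j N)\<close> holds exactly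
  \<open>N + 1\<close> jumps, and its cells other than \<open>j 0\<close> are exactly the
  \<open>N\<close> plateaus. The competitor with \<open>m\<close> blocks has \<open>m + 1\<close>
  jumps, so one \<alpha> cancels and neither end of the window leaves a boundary term.\<close>

lemma main_inequality:
  assumes "\<eta> > 0"
  shows "\<forall>\<^sub>F n in sequentially. \<forall>N j m. strict_mono_on {..N} j \<and> {i\<in>{j 0..j N}. big n i} = j ` {..N}
      \<and> \<bar>y n (j 0)\<bar> \<le> R \<and> \<bar>y n (Suc (j N))\<bar> \<le> R \<and> \<bar>W n (j 0)\<bar> \<le> C \<and> \<bar>W n (Suc (j N))\<bar> \<le> C \<and> 1 \<le> m \<and> m \<le> Suc N \<longrightarrow>
     real N * \<alpha> + (\<Sum>i<N. c * ((real (j (Suc i)) - real (j i)) * \<delta> n)^3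
        + \<beta> * ((real (j (Suc i)) - real (j i)) * \<delta> n) * (max 0 (\<bar>W n (Suc (j i)) - M * mid n (Suc (j i)) (Suc (j (Suc i)))\<bar> - \<eta>))^2)
     \<le> real m * \<alpha> + c * ((real (j N) - real (j 0)) * \<delta> n)^3 / (real m)^2 + \<eta>"
proof -
  \<comment> \<open>A bound on the number of jumps independent of \<open>n\<close>: it limits both
    the sum of the errors over the jumps and the number \<open>m\<close> of blocks for which the
    upper bound has to be uniform.\<close>
  obtain K where K: "\<forall>\<^sub>F n in sequentially. \<forall>a b. win n R a b \<longrightarrow> card {i\<in>{a..<b}. big n i} \<le> K" by (rule big_count)
  obtain \<epsilon> where e: "\<epsilon> > 0" "\<epsilon> \<le> \<eta>" "(real K + 2 * \<bar>R\<bar> + 1) * \<epsilon> \<le> \<eta>" using small_eps[OF assms] by metis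
  show ?thesis
    using dpos phi_nonneg K phi_low[OF e(1)] partition_bound[OF e(1), of R C K] plateau_lower[OF e(1), of R]
  proof eventually_elim
    case (elim n)
    show ?case
    proof (intro allI impI, elim conjE)
      fix N j m
      assume sm: "strict_mono_on {..N} j" and J: "{i\<in>{j 0..j N}. big n i} = j ` {..N}"
        and yy: "\<bar>y n (j 0)\<bar> \<le> R" "\<bar>y n (Suc (j N))\<bar> \<le> R" and WW: "\<bar>W n (j 0)\<bar> \<le> C" "\<bar>W n (Suc (j N))\<bar> \<le> C"
        and m: "1 \<le> m" "m \<le> Suc N"
      have jm: "j i \<le> j i'" if "i \<le> i'" "i' \<le> N" for i i'
        using strict_mono_onD[OF sm, of i i'] that by (cases "i = i'") auto
      have js: "j i < j i'" if "i < i'" "i' \<le> N" for i i' using strict_mono_onD[OF sm, of i i'] that by auto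
      define a where "a = j 0"
      define b where "b = Suc (j N)"
      have ab: "a < b" using jm[of 0 N] by (simp add: a_def b_def)
      have w: "win n R a b" using ab yy by (simp add: win_def a_def b_def)
      have "{a..<b} = {j 0..j N}" by (auto simp: a_def b_def)
      then have setJ: "{i\<in>{a..<b}. big n i} = j ` {..N}" using J by simp
      have cardJ: "card (j ` {..N}) = Suc N" by (subst card_image) (use strict_mono_on_imp_inj_on[OF sm] in auto)
      have NK: "Suc N \<le> K" using elim(3) w setJ cardJ by metis
      have ju: "(real N + 1) * (\<alpha> - \<epsilon>) \<le> (\<Sum>i\<in>{a..<b}. \<phi> n (W n (Suc i) - W n i))"
      proof -
        have "(real N + 1) * (\<alpha> - \<epsilon>) = (\<Sum>i\<in>{i\<in>{a..<b}. big n i}. \<alpha> - \<epsilon>)" unfolding setJ by (simp add: cardJ)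
        also have "\<dots> \<le> (\<Sum>i\<in>{i\<in>{a..<b}. big n i}. \<phi> n (W n (Suc i) - W n i))"
          by (intro sum_mono) (use elim(4) in \<open>auto simp: big_def\<close>)
        also have "\<dots> \<le> (\<Sum>i\<in>{a..<b}. \<phi> n (W n (Suc i) - W n i))" using elim by (intro sum_mono2) auto
        finally show ?thesis .
      qed
      define l where "l i = (real (j (Suc i)) - real (j i)) * \<delta> n" for i
      define \<rho> where "\<rho> i = \<bar>W n (Suc (j i)) - M * mid n (Suc (j i)) (Suc (j (Suc i)))\<bar>" for i
      have l0: "l i \<ge> 0" if "i < N" for i using jm[of i "Suc i"] that elim(1) by (simp add: l_def)
      have pl: "c * (l i)^3 + \<beta> * l i * (max 0 (\<rho> i - \<eta>))^2 - \<epsilon> * l i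
          \<le> \<beta> * \<delta> n * (\<Sum>i\<in>{Suc (j i)..<Suc (j (Suc i))}. (W n i - G n i)^2)" if i: "i < N" for i
      proof -
        have *: "Suc (j i) < Suc (j (Suc i))" "a \<le> Suc (j i)" "Suc (j (Suc i)) \<le> b"
          using js[of i "Suc i"] jm[of 0 i] jm[of "Suc i" N] i by (auto simp: a_def b_def)
        have w': "win n R (Suc (j i)) (Suc (j (Suc i)))" using win_sub[OF _ w] * elim(1) by auto
        have "\<not> big n q" if q: "q \<in> {Suc (j i)..<Suc (j (Suc i)) - 1}" for q
        proof
          assume "big n q"
          then have "q \<in> j ` {..N}" using setJ q * by (simp add: set_eq_iff) (metis Suc_le_lessD less_le_trans less_or_eq_imp_le less_Suc_eq_le le_trans)
          then obtain i' where i': "i' \<le> N" "q = j i'" by auto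
          then have "j i < j i'" "j i' < j (Suc i)" using q by auto
          then have "i < i'" "i' < Suc i" using jm[of i' i] jm[of "Suc i" i'] i i' by (meson leD leI less_imp_le)+
          then show False by simp
        qed
        then have "c * (l i)^3 + \<beta> * l i * (max 0 (\<rho> i - \<epsilon>))^2 - \<epsilon> * l i
          \<le> \<beta> * \<delta> n * (\<Sum>i\<in>{Suc (j i)..<Suc (j (Suc i))}. (W n i - G n i)^2)"
          using elim(6)[rule_format, of "Suc (j i)" "Suc (j (Suc i))"] w' by (simp add: l_def \<rho>_def)
        moreover have "\<beta> * l i * (max 0 (\<rho> i - \<eta>))^2 \<le> \<beta> * l i * (max 0 (\<rho> i - \<epsilon>))^2"
          using e beta l0[OF i] by (intro mult_left_mono power_mono) auto
        ultimately show ?thesis by linarith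
      qed
      have suml: "(\<Sum>i<N. l i) = (real (j N) - real (j 0)) * \<delta> n"
        unfolding l_def sum_distrib_right[symmetric] by (subst sum_lessThan_telescope) simp
      also have "\<dots> \<le> 2 * R" using win_len[OF w] elim(1) by (simp add: a_def b_def algebra_simps)
      also have "\<dots> \<le> 2 * \<bar>R\<bar>" by simp
      finally have suml': "(\<Sum>i<N. l i) \<le> 2 * \<bar>R\<bar>" .
      have fid: "(\<Sum>i<N. c * (l i)^3 + \<beta> * l i * (max 0 (\<rho> i - \<eta>))^2) - \<epsilon> * (\<Sum>i<N. l i)
         \<le> \<beta> * \<delta> n * (\<Sum>i\<in>{Suc a..<b}. (W n i - G n i)^2)"
      proof -
        have "(\<Sum>i\<in>{Suc a..<b}. (W n i - G n i)^2) = (\<Sum>i<N. \<Sum>i\<in>{Suc (j i)..<Suc (j (Suc i))}. (W n i - G n i)^2)"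
          unfolding a_def b_def by (rule sum_blocks[of N "\<lambda>i. Suc (j i)"]) (simp add: jm)
        then have "\<beta> * \<delta> n * (\<Sum>i\<in>{Suc a..<b}. (W n i - G n i)^2)
          = (\<Sum>i<N. \<beta> * \<delta> n * (\<Sum>i\<in>{Suc (j i)..<Suc (j (Suc i))}. (W n i - G n i)^2))" by (simp add: sum_distrib_left)
        also have "\<dots> \<ge> (\<Sum>i<N. c * (l i)^3 + \<beta> * l i * (max 0 (\<rho> i - \<eta>))^2 - \<epsilon> * l i)"
          using pl by (intro sum_mono) auto
        finally show ?thesis by (simp add: sum_subtractf sum_distrib_left)
      qed
      have "enW n a b \<le> (real m + 1) * \<alpha> + c * ((real b - real a - 1) * \<delta> n)^3 / (real m)^2 + \<epsilon>"
        using elim(5)[rule_format, of a b m] w WW m NK by (simp add: a_def b_def)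
      moreover have "real b - real a - 1 = real (j N) - real (j 0)" by (simp add: a_def b_def)
      moreover have "enW n a b = (\<Sum>i\<in>{a..<b}. \<phi> n (W n (Suc i) - W n i)) + \<beta> * \<delta> n * (\<Sum>i\<in>{Suc a..<b}. (W n i - G n i)^2)"
        by (simp add: en_def)
      ultimately have "(real N + 1) * (\<alpha> - \<epsilon>) + (\<Sum>i<N. c * (l i)^3 + \<beta> * l i * (max 0 (\<rho> i - \<eta>))^2) - \<epsilon> * (\<Sum>i<N. l i)
         \<le> (real m + 1) * \<alpha> + c * ((real (j N) - real (j 0)) * \<delta> n)^3 / (real m)^2 + \<epsilon>"
        using fid ju by simp
      moreover have "\<epsilon> * (\<Sum>i<N. l i) \<le> \<epsilon> * (2 * \<bar>R\<bar>)" using suml' e by (intro mult_left_mono) auto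
      moreover have "(real N + 1) * \<epsilon> \<le> real K * \<epsilon>" using NK e by (intro mult_right_mono) auto
      ultimately have "real N * \<alpha> + (\<Sum>i<N. c * (l i)^3 + \<beta> * l i * (max 0 (\<rho> i - \<eta>))^2)
         \<le> real m * \<alpha> + c * ((real (j N) - real (j 0)) * \<delta> n)^3 / (real m)^2 + (real K + 2 * \<bar>R\<bar> + 1) * \<epsilon>"
        by (simp add: algebra_simps)
      then show "real N * \<alpha> + (\<Sum>i<N. c * ((real (j (Suc i)) - real (j i)) * \<delta> n)^3
        + \<beta> * ((real (j (Suc i)) - real (j i)) * \<delta> n) * (max 0 (\<bar>W n (Suc (j i)) - M * mid n (Suc (j i)) (Suc (j (Suc i)))\<bar> - \<eta>))^2)
     \<le> real m * \<alpha> + c * ((real (j N) - real (j 0)) * \<delta> n)^3 / (real m)^2 + \<eta>"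
        using e(3) unfolding l_def \<rho>_def by linarith
    qed
  qed
qed

end

text \<open>The jump cost is written as \<open>2 * c * lam^3\<close>, the value for which
  \<open>lam\<close> minimizes the cost per unit length. The case \<open>m = N\<close> measures how
  far the lengths are from their mean \<open>q\<close>, by strict convexity of the cube;
  \<open>m = N - 1\<close> and \<open>m = Suc N\<close> act as one-sided difference quotients in the
  number of plateaus and locate \<open>q\<close>.\<close>

lemma near_equidistant:
  fixes l \<rho> :: "nat \<Rightarrow> real"
  assumes N: "N \<ge> 3" and pos: "c > 0" "\<beta> > 0" "lam > 0"
    and l0: "\<And>i. i < N \<Longrightarrow> l i \<ge> 0" and L: "(\<Sum>i<N. l i) = real N * q"
    and ineq: "\<And>m. m \<in> {N - 1, N, Suc N} \<Longrightarrow> real N * (2 * c * lam^3) + (\<Sum>i<N. c * (l i)^3 + \<beta> * l i * (\<rho> i)^2)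
        \<le> real m * (2 * c * lam^3) + c * (real N * q)^3 / (real m)^2 + \<eta>"
  shows "(\<Sum>i<N. c * ((l i - q)^2 * (l i + 2 * q)) + \<beta> * l i * (\<rho> i)^2) \<le> \<eta>"
    and "lam^3 \<le> q^3 * (1 + 4 / real N) + \<eta> / (2 * c)"
    and "q^3 \<le> (lam^3 + \<eta> / (2 * c)) * (1 + 3 / real N)"
    and "q \<ge> 0"
proof -
  have "0 \<le> real N * q" unfolding L[symmetric] using l0 by (intro sum_nonneg) auto
  then show q0: "q \<ge> 0" using N by (simp add: zero_le_mult_iff)
  \<comment> \<open>The difference between \<open>l^3\<close> and its tangent line at
    \<open>q\<close>. The linear part sums to a known quantity, as the mean of the lengths is
    \<open>q\<close>.\<close>
  have pt: "c * ((l i - q)^2 * (l i + 2 * q)) = c * (l i)^3 - 3 * c * q^2 * l i + 2 * c * q^3" for i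
    by (simp add: power2_eq_square power3_eq_cube algebra_simps)
  have S: "(\<Sum>i<N. c * ((l i - q)^2 * (l i + 2 * q)) + \<beta> * l i * (\<rho> i)^2)
     = (\<Sum>i<N. c * (l i)^3 + \<beta> * l i * (\<rho> i)^2) - c * real N * q^3"
  proof -
    have "(\<Sum>i<N. c * ((l i - q)^2 * (l i + 2 * q)) + \<beta> * l i * (\<rho> i)^2)
      = (\<Sum>i<N. (c * (l i)^3 + \<beta> * l i * (\<rho> i)^2) - 3 * c * q^2 * l i + 2 * c * q^3)"
      unfolding pt by (intro sum.cong) auto
    also have "\<dots> = (\<Sum>i<N. c * (l i)^3 + \<beta> * l i * (\<rho> i)^2) - 3 * c * q^2 * (\<Sum>i<N. l i) + real N * (2 * c * q^3)"
      by (simp add: sum.distrib sum_subtractf sum_distrib_left)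
    also have "\<dots> = (\<Sum>i<N. c * (l i)^3 + \<beta> * l i * (\<rho> i)^2) - c * real N * q^3"
      unfolding L by (simp add: power2_eq_square power3_eq_cube algebra_simps)
    finally show ?thesis .
  qed
  have "c * (real N * q)^3 / (real N)^2 = c * real N * q^3"
    using N by (simp add: power2_eq_square power3_eq_cube)
  then show "(\<Sum>i<N. c * ((l i - q)^2 * (l i + 2 * q)) + \<beta> * l i * (\<rho> i)^2) \<le> \<eta>"
    unfolding S using ineq[of N] by simp
  have low: "c * real N * q^3 \<le> (\<Sum>i<N. c * (l i)^3 + \<beta> * l i * (\<rho> i)^2)"
  proof -
    have "0 \<le> (\<Sum>i<N. c * ((l i - q)^2 * (l i + 2 * q)) + \<beta> * l i * (\<rho> i)^2)"
      using pos l0 q0 by (intro sum_nonneg add_nonneg_nonneg mult_nonneg_nonneg) auto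
    then show ?thesis unfolding S by simp
  qed
  have q3: "q^3 \<ge> 0" using q0 by simp
  have Nr: "real N \<ge> 3" using N by simp
  show "lam^3 \<le> q^3 * (1 + 4 / real N) + \<eta> / (2 * c)"
  proof -
    have r: "real (N - 1) = real N - 1" using N by (simp add: of_nat_diff)
    have "real N * (2 * c * lam^3) + c * real N * q^3 \<le> (real N - 1) * (2 * c * lam^3) + c * (real N * q)^3 / (real N - 1)^2 + \<eta>"
      using ineq[of "N - 1"] low unfolding r by simp
    then have 1: "2 * c * lam^3 \<le> c * q^3 * ((real N)^3 / (real N - 1)^2 - real N) + \<eta>"
      by (simp add: power_mult_distrib algebra_simps)
    \<comment> \<open>The left side is \<open>2 + 3 / N\<close> to leading order; the larger
      constant on the right reduces the claim to a quadratic inequality valid for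
      \<open>N \<ge> 3\<close>.\<close>
    have "(real N)^3 / (real N - 1)^2 - real N \<le> 2 * (1 + 4 / real N)"
    proof -
      have "(real N)^4 \<le> (2 * (real N + 4) + (real N)^2) * (real N - 1)^2"
      proof -
        have "0 \<le> 5 * (real N)^2 - 14 * real N + 8"
        proof -
          have "5 * (real N)^2 - 14 * real N + 8 = 5 * (real N * (real N - 3)) + real N + 8" by (simp add: power2_eq_square algebra_simps)
          then show ?thesis using Nr by simp
        qed
        then show ?thesis by (simp add: power2_eq_square power4_eq_xxxx algebra_simps)
      qed
      then have "(real N)^4 / (real N - 1)^2 \<le> 2 * (real N + 4) + (real N)^2" using Nr by (simp add: divide_le_eq)
      then have "((real N)^4 / (real N - 1)^2 - (real N)^2) / real N \<le> 2 * (real N + 4) / real N"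
        using Nr by (intro divide_right_mono) auto
      moreover have "((real N)^4 / (real N - 1)^2 - (real N)^2) / real N = (real N)^3 / (real N - 1)^2 - real N"
        using Nr by (simp add: diff_divide_distrib power2_eq_square power3_eq_cube power4_eq_xxxx)
      moreover have "2 * (real N + 4) / real N = 2 * (1 + 4 / real N)" using Nr by (simp add: field_simps)
      ultimately show ?thesis by simp
    qed
    then have "c * q^3 * ((real N)^3 / (real N - 1)^2 - real N) \<le> c * q^3 * (2 * (1 + 4 / real N))"
      using pos q3 by (intro mult_left_mono) auto
    with 1 have "2 * c * lam^3 \<le> c * q^3 * (2 * (1 + 4 / real N)) + \<eta>" by linarith
    also have "\<dots> = 2 * c * (q^3 * (1 + 4 / real N) + \<eta> / (2 * c))" using pos by (simp add: field_simps)
    finally show ?thesis using pos by simp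
  qed
  show "q^3 \<le> (lam^3 + \<eta> / (2 * c)) * (1 + 3 / real N)"
  proof -
    have "real N * (2 * c * lam^3) + c * real N * q^3 \<le> (real N + 1) * (2 * c * lam^3) + c * (real N * q)^3 / (real N + 1)^2 + \<eta>"
      using ineq[of "Suc N"] low by (simp add: add.commute)
    then have 1: "c * q^3 * (real N - (real N)^3 / (real N + 1)^2) \<le> 2 * c * lam^3 + \<eta>"
      by (simp add: power_mult_distrib algebra_simps)
    \<comment> \<open>Cleared form of \<open>N - N^3 / (N + 1)^2 \<ge> 2 * N / (N + 3)\<close>, the
      counterpart for one additional plateau.\<close>
    have "2 * (real N)^3 + 4 * (real N)^2 + 2 * real N \<le> 2 * (real N)^3 + 7 * (real N)^2 + 3 * real N" by simp
    then have "2 * real N * (real N + 1)^2 \<le> (real N + 3) * (real N * (real N + 1)^2 - (real N)^3)"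
      by (simp add: power2_eq_square power3_eq_cube algebra_simps)
    then have "2 * real N / (real N + 3) \<le> (real N * (real N + 1)^2 - (real N)^3) / (real N + 1)^2"
      using Nr by (simp add: frac_le_eq divide_le_eq le_divide_eq mult.commute)
    also have "\<dots> = real N - (real N)^3 / (real N + 1)^2"
      using Nr by (simp add: diff_divide_distrib)
    finally have "c * q^3 * (2 * real N / (real N + 3)) \<le> 2 * c * lam^3 + \<eta>"
      using 1 pos q3 by (smt (verit) mult_left_mono mult_nonneg_nonneg)
    then have "c * q^3 * (2 * real N / (real N + 3)) * ((real N + 3) / (2 * c * real N)) \<le> (2 * c * lam^3 + \<eta>) * ((real N + 3) / (2 * c * real N))"
      using pos Nr by (intro mult_right_mono) auto
    moreover have "c * q^3 * (2 * real N / (real N + 3)) * ((real N + 3) / (2 * c * real N)) = q^3"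
    proof -
      have "real N + 3 \<noteq> 0" "c \<noteq> 0" "real N \<noteq> 0" using pos Nr by linarith+
      then show ?thesis by simp
    qed
    moreover have "(2 * c * lam^3 + \<eta>) * ((real N + 3) / (2 * c * real N)) = (lam^3 + \<eta> / (2 * c)) * (1 + 3 / real N)"
      using pos Nr by (simp add: field_simps)
    ultimately show ?thesis by simp
  qed
qed

text \<open>The total error \<epsilon>0 does not shrink with \<open>N\<close>: every summand of the
  convexity defect is nonnegative and thus bounded by the whole sum. Hence one can fix the number of
  plateaus first and let the error vanish afterwards.\<close>

lemma near_equidistant_limit:
  fixes c \<beta> lam \<eta> :: real
  assumes pos: "c > 0" "\<beta> > 0" "lam > 0" "\<eta> > 0"
  obtains N0 \<epsilon>0 where "\<epsilon>0 > 0"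
    "\<forall>N l \<rho> q. N \<ge> N0 \<longrightarrow> (\<forall>i<N. l i \<ge> 0) \<longrightarrow> (\<Sum>i<N. l i) = real N * q
      \<longrightarrow> (\<forall>m\<in>{N - 1, N, Suc N}. real N * (2 * c * lam^3) + (\<Sum>i<N. c * (l i)^3 + \<beta> * l i * (\<rho> i)^2)
        \<le> real m * (2 * c * lam^3) + c * (real N * q)^3 / (real m)^2 + \<epsilon>0)
      \<longrightarrow> (\<forall>i<N. \<bar>l i - lam\<bar> \<le> \<eta> \<and> \<bar>\<rho> i\<bar> \<le> \<eta>)"
proof -
  \<comment> \<open>Half of \<eta>, because a length is compared with \<open>q\<close> and
    \<open>q\<close> with \<open>lam\<close>; the bound \<open>lam / 4\<close> keeps
    \<open>q \<ge> 3/4 * lam\<close> and every length at least \<open>lam / 2\<close>.\<close>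
  define e1 where "e1 = min (\<eta> / 2) (lam / 4)"
  have e1: "e1 > 0" "2 * e1 \<le> \<eta>" "e1 \<le> lam / 4" using pos by (auto simp: e1_def)
  \<comment> \<open>Tolerance for \<open>q^3\<close>: since
    \<open>\<bar>q - lam\<bar> * lam^2 \<le> \<bar>q^3 - lam^3\<bar>\<close>, it forces
    \<open>\<bar>q - lam\<bar> \<le> e1\<close>.\<close>
  define \<kappa> where "\<kappa> = e1 * lam^2"
  have \<kappa>: "\<kappa> > 0" using e1 pos by (simp add: \<kappa>_def)
  define N0 where "N0 = nat \<lceil>3 + 6 * lam^3 / \<kappa> + 8 * (2 * lam^3 + \<kappa>) / \<kappa>\<rceil>"
  \<comment> \<open>The three bounds serve, in this order, the mean \<open>q\<close>, the deviation
    of each length from \<open>q\<close>, and the offsets \<rho>.\<close>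
  define \<epsilon>0 where "\<epsilon>0 = min (c * \<kappa> / 2) (min (c * lam * e1^2) (\<beta> * lam * \<eta>^2 / 2))"
  have \<epsilon>0: "\<epsilon>0 > 0" "\<epsilon>0 \<le> c * \<kappa> / 2" "\<epsilon>0 \<le> c * lam * e1^2" "\<epsilon>0 \<le> \<beta> * lam * \<eta>^2 / 2"
    using pos e1 \<kappa> by (auto simp: \<epsilon>0_def)
  show thesis
  proof (rule that[OF \<epsilon>0(1), of N0], intro allI impI)
    fix N l \<rho> q i
    assume N: "N \<ge> N0" and l0': "\<forall>i<N. (l i :: real) \<ge> 0" and L: "(\<Sum>i<N. l i) = real N * q"
      and ineq': "\<forall>m\<in>{N - 1, N, Suc N}. real N * (2 * c * lam^3) + (\<Sum>i<N. c * (l i)^3 + \<beta> * l i * (\<rho> i)^2)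
        \<le> real m * (2 * c * lam^3) + c * (real N * q)^3 / (real m)^2 + \<epsilon>0"
      and i: "i < N"
    have l0: "\<And>i. i < N \<Longrightarrow> l i \<ge> 0" using l0' by blast
    note ineq = ineq'[rule_format]
    have lam3: "lam^3 > 0" using pos by simp
    have Nr: "real N \<ge> 3 + 6 * lam^3 / \<kappa> + 8 * (2 * lam^3 + \<kappa>) / \<kappa>" using N unfolding N0_def by linarith
    have p: "6 * lam^3 / \<kappa> > 0" "8 * (2 * lam^3 + \<kappa>) / \<kappa> > 0" using lam3 \<kappa> by (auto intro!: divide_pos_pos add_pos_pos)
    have N3: "N \<ge> 3" using Nr p by linarith
    have "6 * lam^3 / \<kappa> \<le> real N" "8 * (2 * lam^3 + \<kappa>) / \<kappa> \<le> real N" using Nr p by linarith+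
    then have Nb: "3 * lam^3 / real N \<le> \<kappa> / 2" "4 * (2 * lam^3 + \<kappa>) / real N \<le> \<kappa> / 2"
      using \<kappa> N3 by (auto simp: field_simps)
    note ne = near_equidistant[OF N3 pos(1-3) l0 L ineq]
    have q0: "q \<ge> 0" by (rule ne(4))
    have ec: "\<epsilon>0 / (2 * c) \<le> \<kappa> / 4" using \<epsilon>0 pos by (simp add: field_simps)
    have "q^3 \<le> (lam^3 + \<epsilon>0 / (2 * c)) * (1 + 3 / real N)" by (rule ne(3))
    also have "\<dots> = lam^3 + 3 * lam^3 / real N + \<epsilon>0 / (2 * c) * (1 + 3 / real N)" by (simp add: algebra_simps)
    also have "\<epsilon>0 / (2 * c) * (1 + 3 / real N) \<le> \<kappa> / 4 * 2"
    proof (intro mult_mono)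
      have "3 / real N \<le> 1" using N3 by simp
      then show "1 + 3 / real N \<le> 2" by linarith
    qed (use ec \<kappa> in auto)
    finally have up: "q^3 \<le> lam^3 + \<kappa>" using Nb by simp
    have "lam^3 \<le> q^3 * (1 + 4 / real N) + \<epsilon>0 / (2 * c)" by (rule ne(2))
    also have "\<dots> = q^3 + 4 * q^3 / real N + \<epsilon>0 / (2 * c)" by (simp add: algebra_simps)
    also have "4 * q^3 / real N \<le> 4 * (2 * lam^3 + \<kappa>) / real N"
    proof (rule divide_right_mono)
      have "q^3 \<le> 2 * lam^3 + \<kappa>" using up lam3 by linarith
      then show "4 * q^3 \<le> 4 * (2 * lam^3 + \<kappa>)" by (rule mult_left_mono) simp
    qed simp
    finally have lo: "lam^3 \<le> q^3 + \<kappa>" using Nb ec \<kappa> by linarith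
    have "\<bar>q - lam\<bar> * lam^2 \<le> \<bar>q - lam\<bar> * (q^2 + q * lam + lam^2)" using q0 pos by (intro mult_left_mono) auto
    also have "\<dots> = \<bar>(q - lam) * (q^2 + q * lam + lam^2)\<bar>" using q0 pos by (simp add: abs_mult)
    also have "(q - lam) * (q^2 + q * lam + lam^2) = q^3 - lam^3" by (simp add: power2_eq_square power3_eq_cube algebra_simps)
    also have "\<bar>q^3 - lam^3\<bar> \<le> \<kappa>" using up lo by simp
    finally have "\<bar>q - lam\<bar> * lam^2 \<le> e1 * lam^2" by (simp add: \<kappa>_def)
    then have ql: "\<bar>q - lam\<bar> \<le> e1" using pos by (simp add: mult_le_cancel_right)
    then have q34: "q \<ge> 3 / 4 * lam" using e1 by linarith
    show "\<bar>l i - lam\<bar> \<le> \<eta> \<and> \<bar>\<rho> i\<bar> \<le> \<eta>"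
    proof -
      have nn: "0 \<le> c * ((l i - q)^2 * (l i + 2 * q))" "0 \<le> \<beta> * l i * (\<rho> i)^2" if "i < N" for i
        using pos l0[OF that] q0 by (auto intro!: mult_nonneg_nonneg)
      have "c * ((l i - q)^2 * (l i + 2 * q)) + \<beta> * l i * (\<rho> i)^2
         \<le> (\<Sum>i<N. c * ((l i - q)^2 * (l i + 2 * q)) + \<beta> * l i * (\<rho> i)^2)"
        using i nn by (intro member_le_sum) (auto intro!: add_nonneg_nonneg)
      also have "\<dots> \<le> \<epsilon>0" by (rule ne(1))
      finally have s: "c * ((l i - q)^2 * (l i + 2 * q)) \<le> \<epsilon>0" "\<beta> * l i * (\<rho> i)^2 \<le> \<epsilon>0" using nn[OF i] by linarith+
      have "c * lam * (l i - q)^2 \<le> c * ((l i - q)^2 * (l i + 2 * q))"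
      proof -
        have "lam \<le> l i + 2 * q" using q34 l0[OF i] pos by linarith
        then have "c * ((l i - q)^2 * lam) \<le> c * ((l i - q)^2 * (l i + 2 * q))" using pos by (intro mult_left_mono) auto
        then show ?thesis by (simp add: mult_ac)
      qed
      also have "\<dots> \<le> c * lam * e1^2" using s \<epsilon>0 by linarith
      finally have "(l i - q)^2 \<le> e1^2" using pos by simp
      then have lq: "\<bar>l i - q\<bar> \<le> e1" using e1 by (simp add: abs_le_square_iff[symmetric])
      have "l i \<ge> lam / 2" using lq ql e1 by linarith
      then have "\<beta> * (lam / 2) * (\<rho> i)^2 \<le> \<beta> * l i * (\<rho> i)^2" using pos by (intro mult_right_mono mult_left_mono) auto
      also have "\<dots> \<le> \<beta> * (lam / 2) * \<eta>^2" using s \<epsilon>0 by (simp add: field_simps)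
      finally have "(\<rho> i)^2 \<le> \<eta>^2" using pos by simp
      then have "\<bar>\<rho> i\<bar> \<le> \<eta>" using pos by (simp add: abs_le_square_iff[symmetric])
      then show "\<bar>l i - lam\<bar> \<le> \<eta> \<and> \<bar>\<rho> i\<bar> \<le> \<eta>" using lq ql e1 by linarith
    qed
  qed
qed

section \<open>Spacing and height of the plateaus for nonzero slope\<close>

context blow begin

lemma cell_at: "\<forall>\<^sub>F n in sequentially. \<forall>t. \<bar>t\<bar> \<le> R \<longrightarrow> (\<exists>i<n. y n i \<le> t \<and> t < y n i + \<delta> n)"
  using dpos room[of "R + 1"]
proof eventually_elim
  case (elim n)
  show ?case
  proof (intro allI impI)
    fix t assume t: "\<bar>t\<bar> \<le> R"
    define i where "i = nat \<lfloor>real (k n) + t / \<delta> n\<rfloor>"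
    have "- t \<le> real (k n) * \<delta> n" using t elim(2) by linarith
    then have p: "real (k n) + t / \<delta> n \<ge> 0" using elim(1) by (simp add: field_simps)
    have i: "real i \<le> real (k n) + t / \<delta> n" "real (k n) + t / \<delta> n < real i + 1"
      using p unfolding i_def by linarith+
    have a: "y n i \<le> t" using i(1) elim(1) by (simp add: gpos_def field_simps)
    have b: "t < y n i + \<delta> n" using i(2) elim(1) by (simp add: gpos_def field_simps)
    have "(real i - real (k n)) * \<delta> n < (real n - real (k n)) * \<delta> n" using a t elim(2) unfolding gpos_def by linarith
    then have "i < n" using elim(1) by (simp add: mult_less_cancel_right)
    then show "\<exists>i<n. y n i \<le> t \<and> t < y n i + \<delta> n" using a b by blast
  qed
qed

text \<open>Supplies windows with bounded end values near any prescribed endpoints, so that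
  competitors there pay \<alpha> and not \<open>C1\<close> for each jump.\<close>

lemma bounded_cell_near:
  obtains C where "C \<ge> 0" "\<forall>\<^sub>F n in sequentially. \<forall>t. \<bar>t\<bar> \<le> R \<longrightarrow> (\<exists>i. t \<le> y n i \<and> y n i \<le> t + 2 \<and> \<bar>W n i\<bar> \<le> C)"
proof -
  define R' where "R' = \<bar>R\<bar> + 3"
  obtain CE where CE: "CE \<ge> 0" "\<forall>\<^sub>F n in sequentially. \<forall>a b. win n R' a b \<longrightarrow> enW n a b \<le> CE" by (rule energy_bound_ex)
  define D where "D = 1 + 2 * CE / \<beta>"
  have D: "D \<ge> 1" "\<beta> * D \<ge> 2 * CE" using CE beta by (auto simp: D_def field_simps)
  define C where "C = D + \<bar>M\<bar> * R' + 2"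
  have h: "(1/2::real) > 0" by simp
  have "\<forall>\<^sub>F n in sequentially. \<forall>t. \<bar>t\<bar> \<le> R \<longrightarrow> (\<exists>i. t \<le> y n i \<and> y n i \<le> t + 2 \<and> \<bar>W n i\<bar> \<le> C)"
    using dpos phi_nonneg CE(2) d_small[OF h] Gapp[OF zero_less_one, of R'] bounded_cell[OF h, of R'] cell_at[of "R + 2"]
  proof eventually_elim
    case (elim n)
    show ?case
    proof (intro allI impI)
      fix t assume t: "\<bar>t\<bar> \<le> R"
      obtain a where a: "y n a \<le> t" "t < y n a + \<delta> n" using elim(7)[rule_format, of t] t by auto
      obtain b where b: "y n b \<le> t + 2" "t + 2 < y n b + \<delta> n" using elim(7)[rule_format, of "t + 2"] t by force
      have len: "(real b - real a) * \<delta> n \<ge> 1" unfolding gpos_diff[of "real (k n)", symmetric] using a b elim(4) by linarith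
      have ab: "a < b"
      proof (rule ccontr)
        assume "\<not> a < b"
        then have "(real b - real a) * \<delta> n \<le> 0" using elim(1) by (simp add: mult_nonpos_nonneg)
        with len show False by simp
      qed
      have w: "win n R' a b" using a b ab t elim(1,4) unfolding win_def R'_def by linarith
      obtain i where i: "a < i" "i < b" "\<beta> * (1/2) * (W n i - G n i)^2 \<le> \<beta> * \<delta> n * (\<Sum>i\<in>{Suc a..<b}. (W n i - G n i)^2)"
        using elim(6)[rule_format, of a b] w len by auto
      have "enW n a b \<le> CE" using elim(3) w by blast
      then have "\<beta> * (1/2) * (W n i - G n i)^2 \<le> CE" using i(3) en_parts(2)[OF elim(1,2), of a b] by linarith
      then have "\<beta> * (W n i - G n i)^2 \<le> \<beta> * D" using D by linarith
      then have "(W n i - G n i)^2 \<le> D" using beta by simp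
      also have "\<dots> \<le> D^2" using D by (simp add: power2_eq_square)
      finally have 1: "\<bar>W n i - G n i\<bar> \<le> D" using D by (simp add: abs_le_square_iff[symmetric])
      have yi: "\<bar>y n i\<bar> \<le> R'" using win_mono[of n a R' b i] w i elim(1) by (auto simp: win_def)
      then have 2: "\<bar>G n i - M * y n i\<bar> \<le> 1" using elim(5) by blast
      have "\<bar>M * y n i\<bar> \<le> \<bar>M\<bar> * R'" unfolding abs_mult using yi by (intro mult_left_mono) auto
      then have "\<bar>W n i\<bar> \<le> C" using 1 2 unfolding C_def by linarith
      moreover have "y n i \<ge> t"
      proof -
        have "y n a + \<delta> n = y n (Suc a)" by (simp add: gpos_def algebra_simps)
        also have "\<dots> \<le> y n i" using i elim(1) by (intro gpos_mono) auto
        finally show ?thesis using a by linarith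
      qed
      moreover have "y n i \<le> t + 2" using gpos_mono[of "\<delta> n" i b "real (k n)"] i b elim(1) by linarith
      ultimately show "\<exists>i. t \<le> y n i \<and> y n i \<le> t + 2 \<and> \<bar>W n i\<bar> \<le> C" by blast
    qed
  qed
  moreover have "C \<ge> 0" using D by (simp add: C_def R'_def)
  ultimately show thesis using that by blast
qed

text \<open>Jumps occur with gaps at most about \<open>T\<close>, so a window much larger than
  \<open>R\<close> contains as many plateaus as the rigidity estimate demands. Cutting it at its
  first and last jump costs at most about \<open>T\<close> on either side and leaves
  \<open>[-R, R]\<close> covered.\<close>

lemma plateau_structure:
  assumes M: "M \<noteq> 0" and lam: "lam > 0" "\<alpha> = 2 * c * lam^3" and R: "R > 0" and \<eta>: "\<eta> > 0"
  obtains R2 where "\<forall>\<^sub>F n in sequentially. \<exists>N j. strict_mono_on {..N} j \<and> {i\<in>{j 0..j N}. big n i} = j ` {..N}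
      \<and> \<bar>y n (j 0)\<bar> \<le> R2 \<and> \<bar>y n (Suc (j N))\<bar> \<le> R2 \<and> y n (j 0) \<le> - R \<and> R \<le> y n (j N)
      \<and> (\<forall>i<N. \<bar>y n (j (Suc i)) - y n (j i) - lam\<bar> \<le> \<eta> \<and> \<bar>W n (Suc (j i)) - M * ((y n (j i) + y n (j (Suc i))) / 2)\<bar> \<le> \<eta>)"
proof -
  have cpos: "c > 0" using M beta by (simp add: c_def)
  obtain T where T: "T \<ge> 1" "\<forall>R. \<forall>\<^sub>F n in sequentially. \<forall>a b. win n R a b \<and> (real b - real a) * \<delta> n \<ge> T \<longrightarrow> (\<exists>i\<in>{a..<b}. big n i)"
    by (rule gap_bound[OF M])
  obtain N0 \<epsilon>0 where ne: "\<epsilon>0 > 0"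
    "\<forall>N l \<rho> q. N \<ge> N0 \<longrightarrow> (\<forall>i<N. l i \<ge> 0) \<longrightarrow> (\<Sum>i<N. l i) = real N * q
      \<longrightarrow> (\<forall>m\<in>{N - 1, N, Suc N}. real N * (2 * c * lam^3) + (\<Sum>i<N. c * (l i)^3 + \<beta> * l i * (\<rho> i)^2)
        \<le> real m * (2 * c * lam^3) + c * (real N * q)^3 / (real m)^2 + \<epsilon>0)
      \<longrightarrow> (\<forall>i<N. \<bar>l i - lam\<bar> \<le> \<eta> / 2 \<and> \<bar>\<rho> i\<bar> \<le> \<eta> / 2)"
    by (rule near_equidistant_limit[OF cpos beta lam(1) half_gt_zero[OF \<eta>]])
  \<comment> \<open>The first and last jumps are at least \<open>2 * R1 - 2 * T - 3\<close> apart
    and each gap is at most \<open>T + 1\<close>; this radius therefore yields at least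
    \<open>N0 + 2\<close> plateaus.\<close>
  define R1 where "R1 = R + T + 4 + (real N0 + 2) * (T + 1)"
  have R1: "R1 \<ge> R + T + 4" using T by (simp add: R1_def)
  define R2 where "R2 = R1 + 2"
  obtain C where C: "C \<ge> 0" "\<forall>\<^sub>F n in sequentially. \<forall>t. \<bar>t\<bar> \<le> R1 \<longrightarrow> (\<exists>i. t \<le> y n i \<and> y n i \<le> t + 2 \<and> \<bar>W n i\<bar> \<le> C)"
    by (rule bounded_cell_near)
  define \<eta>' where "\<eta>' = min \<epsilon>0 (\<eta> / 4)"
  have \<eta>': "\<eta>' > 0" "\<eta>' \<le> \<epsilon>0" "\<eta>' \<le> \<eta> / 4" using ne(1) \<eta> by (auto simp: \<eta>'_def)
  have \<eta>M: "\<eta> / (2 * (\<bar>M\<bar> + 1)) > 0" using \<eta> by simp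
  have "\<forall>\<^sub>F n in sequentially. \<exists>N j. strict_mono_on {..N} j \<and> {i\<in>{j 0..j N}. big n i} = j ` {..N}
      \<and> \<bar>y n (j 0)\<bar> \<le> R2 \<and> \<bar>y n (Suc (j N))\<bar> \<le> R2 \<and> y n (j 0) \<le> - R \<and> R \<le> y n (j N)
      \<and> (\<forall>i<N. \<bar>y n (j (Suc i)) - y n (j i) - lam\<bar> \<le> \<eta> \<and> \<bar>W n (Suc (j i)) - M * ((y n (j i) + y n (j (Suc i))) / 2)\<bar> \<le> \<eta>)"
    using dpos C(2) T(2)[rule_format, of R2] oscillation[OF zero_less_one, of R2] d_small[OF zero_less_one] d_small[OF \<eta>M]
      main_inequality[OF \<eta>'(1), of R2 "C + 1"]
  proof eventually_elim
    case (elim n)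
    have "\<bar>- R1\<bar> \<le> R1" "\<bar>R1\<bar> \<le> R1" using R1 R T by auto
    then obtain A B where A: "- R1 \<le> y n A" "y n A \<le> - R1 + 2" "\<bar>W n A\<bar> \<le> C"
      and B: "R1 \<le> y n B" "y n B \<le> R1 + 2" "\<bar>W n B\<bar> \<le> C" using elim(2) by meson
    have dn: "\<delta> n \<ge> 0" using elim by simp
    have AB: "A < B"
    proof (rule ccontr)
      assume "\<not> A < B"
      then have "y n B \<le> y n A" using dn by (intro gpos_mono) auto
      then show False using A B R1 R T by linarith
    qed
    have w: "win n R2 A B" using A B AB R1 R T by (auto simp: win_def R2_def)
    have yw: "\<bar>y n i\<bar> \<le> R2" if "A \<le> i" "i \<le> B" for i using win_mono[of n A R2 B i] dn w that by (auto simp: win_def)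
    have gap: "y n b - y n a < T" if "A \<le> a" "a < b" "b \<le> B" "\<forall>i\<in>{a..<b}. \<not> big n i" for a b
    proof (rule ccontr)
      assume "\<not> ?thesis"
      then have "(real b - real a) * \<delta> n \<ge> T" unfolding gpos_diff by simp
      moreover have "win n R2 a b" using win_sub[OF dn w, of a b] that by blast
      ultimately show False using elim(3) that(4) by blast
    qed
    define J where "J = {i\<in>{A..<B}. big n i}"
    have finJ: "finite J" by (simp add: J_def)
    obtain h where h: "bij_betw h {..<card J} J" "strict_mono_on {..<card J} h"
      using ex_bij_betw_strict_mono_card[OF finJ] by metis
    have Jne: "J \<noteq> {}"
    proof
      assume "J = {}"
      then have "\<forall>i\<in>{A..<B}. \<not> big n i" by (auto simp: J_def)
      then have "y n B - y n A < T" using gap AB by auto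
      then show False using A B R1 R T by linarith
    qed
    define N where "N = card J - 1"
    have cardJ: "card J = Suc N" using Jne finJ by (simp add: N_def card_gt_0_iff)
    have sm: "strict_mono_on {..N} h" using h(2) unfolding cardJ lessThan_Suc_atMost .
    have hJ: "h ` {..N} = J" using h(1) unfolding cardJ lessThan_Suc_atMost by (simp add: bij_betw_def)
    have js: "h i < h i'" if "i < i'" "i' \<le> N" for i i' using strict_mono_onD[OF sm, of i i'] that by auto
    have jm: "h i \<le> h i'" if "i \<le> i'" "i' \<le> N" for i i' using js[of i i'] that by (cases "i = i'") auto
    have hin: "A \<le> h i" "h i < B" "big n (h i)" if "i \<le> N" for i using hJ that by (auto simp: J_def)
    have nobig: "\<not> big n q" if "A \<le> q" "q < B" "\<And>i. i \<le> N \<Longrightarrow> q \<noteq> h i" for q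
      using that hJ by (auto simp: J_def)
    have setJ: "{i\<in>{h 0..h N}. big n i} = h ` {..N}"
    proof
      show "{i\<in>{h 0..h N}. big n i} \<subseteq> h ` {..N}" unfolding hJ using hin[of 0] hin[of N] by (auto simp: J_def)
      show "h ` {..N} \<subseteq> {i\<in>{h 0..h N}. big n i}" using hin jm by auto
    qed
    have nb0: "\<not> big n q" if "A \<le> q" "q < h 0" for q using that hin[of 0] jm[of 0] by (intro nobig) (auto dest: leD)
    have nbN: "\<not> big n q" if "Suc (h N) \<le> q" "q < B" for q
    proof (rule nobig)
      fix i assume "i \<le> N"
      then have "h i \<le> h N" using jm[of i N] by simp
      then show "q \<noteq> h i" using that by linarith
    qed (use that hin(1)[of N] in auto)
    have nbi: "\<not> big n q" if "Suc (h i) \<le> q" "q < h (Suc i)" "i < N" for q i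
    proof (rule nobig)
      fix i' assume i': "i' \<le> N"
      show "q \<noteq> h i'"
      proof
        assume "q = h i'"
        then have "h i < h i'" "h i' < h (Suc i)" using that by auto
        then have "i < i'" "i' < Suc i" using jm[of i' i] jm[of "Suc i" i'] that i' by (meson leD leI less_imp_le)+
        then show False by simp
      qed
    qed (use that hin[of i] hin[of "Suc i"] in auto)
    have ySuc: "y n (Suc i) = y n i + \<delta> n" for i by (simp add: gpos_def algebra_simps)
    have first: "y n (h 0) \<le> y n A + T"
    proof (cases "A = h 0")
      case False
      then have "y n (h 0) - y n A < T" using hin(1)[of 0] hin(2)[of 0] nb0 by (intro gap) auto
      then show ?thesis by linarith
    qed (use T in auto)
    have last: "y n B - T - \<delta> n \<le> y n (h N)"
    proof (cases "Suc (h N) = B")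
      case True
      then show ?thesis using ySuc[of "h N"] T by auto
    next
      case False
      then have "y n B - y n (Suc (h N)) < T" using hin(1)[of N] hin(2)[of N] nbN by (intro gap) auto
      then show ?thesis unfolding ySuc by linarith
    qed
    define l where "l i = (real (h (Suc i)) - real (h i)) * \<delta> n" for i
    have l_y: "l i = y n (h (Suc i)) - y n (h i)" for i by (simp add: l_def gpos_diff)
    have l0: "l i \<ge> 0" if "i < N" for i using jm[of i "Suc i"] that dn by (simp add: l_def)
    have lT: "l i \<le> T + 1" if i: "i < N" for i
    proof (cases "Suc (h i) = h (Suc i)")
      case True
      then show ?thesis using ySuc[of "h i"] elim(5) T unfolding l_y by auto
    next
      case False
      have "Suc (h i) < h (Suc i)" using js[of i "Suc i"] i False by auto
      then have "y n (h (Suc i)) - y n (Suc (h i)) < T"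
        using hin(1)[of i] hin(2)[of "Suc i"] nbi[of i] i by (intro gap) auto
      then show ?thesis using ySuc[of "h i"] elim(5) unfolding l_y by auto
    qed
    have suml: "(\<Sum>i<N. l i) = y n (h N) - y n (h 0)"
      unfolding l_y by (rule sum_lessThan_telescope)
    have "(\<Sum>i<N. l i) \<le> (\<Sum>i<N. T + 1)" using lT by (intro sum_mono) auto
    then have "2 * R1 - 2 * T - 3 \<le> real N * (T + 1)" using suml first last A B elim(5) by simp
    moreover have "(real N0 + 2) * (T + 1) \<le> 2 * R1 - 2 * T - 3" using R T unfolding R1_def distrib_right distrib_left by simp
    ultimately have "(real N0 + 2) * (T + 1) \<le> real N * (T + 1)" by linarith
    then have N: "real N0 + 2 \<le> real N" using T by (simp add: mult_le_cancel_right)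
    \<comment> \<open>The truncated offset from the plateau estimate plays the role of the offset in
      the rigidity lemma; undoing the truncation later costs one \<eta>'.\<close>
    define \<rho> where "\<rho> i = max 0 (\<bar>W n (Suc (h i)) - M * mid n (Suc (h i)) (Suc (h (Suc i)))\<bar> - \<eta>')" for i
    define q where "q = (real (h N) - real (h 0)) * \<delta> n / real N"
    \<comment> \<open>The window was chosen with bounded values at \<open>A\<close> and
      \<open>B\<close>, but the comparison needs them at the first and after the last jump. No jump
      lies in between, so the values change by at most 1.\<close>
    have WA: "\<bar>W n (h 0)\<bar> \<le> C + 1"
    proof -
      have "\<bar>W n (h 0) - W n A\<bar> \<le> 1" using elim(4)[rule_format, of A "h 0"] hin[of 0] nb0 yw by auto
      then show ?thesis using A by linarith
    qed
    have WB: "\<bar>W n (Suc (h N))\<bar> \<le> C + 1"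
    proof -
      have "\<bar>W n B - W n (Suc (h N))\<bar> \<le> 1" using elim(4)[rule_format, of "Suc (h N)" B] hin[of N] nbN yw by auto
      then show ?thesis using B by linarith
    qed
    have res: "\<forall>i<N. \<bar>l i - lam\<bar> \<le> \<eta> / 2 \<and> \<bar>\<rho> i\<bar> \<le> \<eta> / 2"
    proof (rule ne(2)[THEN spec, THEN spec, THEN spec, THEN spec, THEN mp, THEN mp, THEN mp, THEN mp, of N l q \<rho>], goal_cases)
      case 1
      show ?case using N by linarith
    next
      case 2
      show ?case using l0 by blast
    next
      case 3
      have "(real (h N) - real (h 0)) * \<delta> n = real N * q" using N by (simp add: q_def)
      then show ?case unfolding suml gpos_diff .
    next
      case 4
      show ?case
      proof
      fix m assume "m \<in> {N - 1, N, Suc N}"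
      then have m: "1 \<le> m" "m \<le> Suc N" using N by auto
      have "real N * \<alpha> + (\<Sum>i<N. c * (l i)^3 + \<beta> * l i * (\<rho> i)^2)
         \<le> real m * \<alpha> + c * ((real (h N) - real (h 0)) * \<delta> n)^3 / (real m)^2 + \<eta>'"
        unfolding l_def \<rho>_def
        using yw[of "h 0"] yw[of "Suc (h N)"] hin[of 0] hin[of N]
        by (intro elim(7)[rule_format, of N h m] conjI sm setJ WA WB m) auto
      moreover have "(real (h N) - real (h 0)) * \<delta> n = real N * q" using N by (simp add: q_def)
      ultimately show "real N * (2 * c * lam^3) + (\<Sum>i<N. c * (l i)^3 + \<beta> * l i * (\<rho> i)^2)
        \<le> real m * (2 * c * lam^3) + c * (real N * q)^3 / (real m)^2 + \<epsilon>0" using \<eta>' lam(2) by simp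
      qed
    qed
    have fin: "\<bar>y n (h (Suc i)) - y n (h i) - lam\<bar> \<le> \<eta> \<and> \<bar>W n (Suc (h i)) - M * ((y n (h i) + y n (h (Suc i))) / 2)\<bar> \<le> \<eta>" if i: "i < N" for i
    proof -
      \<comment> \<open>The plateau consists of the cells from \<open>Suc (h i)\<close> to
        \<open>h (Suc i)\<close>, so its mean position exceeds the midpoint of the two jump
        positions by half a mesh.\<close>
      have md: "mid n (Suc (h i)) (Suc (h (Suc i))) = (y n (h i) + y n (h (Suc i))) / 2 + \<delta> n / 2"
        by (simp add: gmid_def gpos_def field_simps)
      have a: "\<bar>l i - lam\<bar> \<le> \<eta> / 2" "\<bar>\<rho> i\<bar> \<le> \<eta> / 2" using res i by auto
      have "\<bar>W n (Suc (h i)) - M * mid n (Suc (h i)) (Suc (h (Suc i)))\<bar> \<le> \<eta> / 2 + \<eta> / 4"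
        using a(2) \<eta>' unfolding \<rho>_def by linarith
      moreover have "\<bar>M * (\<delta> n / 2)\<bar> \<le> \<eta> / 4"
      proof -
        have "\<bar>M * (\<delta> n / 2)\<bar> \<le> (\<bar>M\<bar> + 1) * (\<delta> n / 2)" using dn by (simp add: abs_mult mult_right_mono)
        also have "\<dots> \<le> (\<bar>M\<bar> + 1) * (\<eta> / (2 * (\<bar>M\<bar> + 1)) / 2)" using elim(6) by (intro mult_left_mono divide_right_mono) auto
        also have "\<dots> = \<eta> / 4" by (simp add: field_simps add_nonneg_eq_0_iff)
        finally show ?thesis .
      qed
      ultimately have "\<bar>W n (Suc (h i)) - M * ((y n (h i) + y n (h (Suc i))) / 2)\<bar> \<le> \<eta>"
        unfolding md distrib_left by linarith
      then show ?thesis using a(1) \<eta> unfolding l_y by linarith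
    qed
    have "y n (h 0) \<le> - R" "R \<le> y n (h N)" using first last A B R1 elim(5) by linarith+
    moreover have "\<bar>y n (h 0)\<bar> \<le> R2" "\<bar>y n (Suc (h N))\<bar> \<le> R2" using hin[of 0] hin[of N] by (auto intro: yw)
    ultimately show ?case using sm setJ fin by blast
  qed
  then show thesis by (rule that)
qed

end

section \<open>Closeness to a staircase\<close>

definition obl :: "real \<Rightarrow> real \<Rightarrow> real \<Rightarrow> real \<Rightarrow> real" where
  "obl H V \<tau> x = staircase_HV H V (x - H * \<tau>) + V * \<tau>"

text \<open>Closeness is measured between graphs, since the jumps of \<open>W\<close> and of \<open>g\<close> match only up to a small displacement.\<close>

definition shadows :: "(nat \<Rightarrow> real) \<Rightarrow> (nat \<Rightarrow> real) \<Rightarrow> (real \<Rightarrow> real) \<Rightarrow> real \<Rightarrow> real \<Rightarrow> bool" where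
  "shadows Y W g R \<eta> \<longleftrightarrow>
     (\<forall>i. \<bar>Y i\<bar> \<le> R \<longrightarrow> (\<exists>z. \<bar>z - Y i\<bar> \<le> \<eta> \<and> \<bar>W i - g z\<bar> \<le> \<eta>)) \<and>
     (\<forall>a b. a \<le> b \<longrightarrow> \<bar>Y a\<bar> \<le> R \<longrightarrow> \<bar>Y b\<bar> \<le> R \<longrightarrow> (\<Sum>i\<in>{a..<b}. \<bar>W (Suc i) - W i\<bar>) \<le> \<bar>W b - W a\<bar> + \<eta>)"

text \<open>For increments of the common sign \<open>s\<close> the variation telescopes. Any other
  increment satisfies \<open>\<bar>d\<bar> \<le> s * d + 2 * \<bar>d\<bar>\<close>, which explains
  the factor 2.\<close>

lemma almost_monotone_variation:
  fixes w :: "nat \<Rightarrow> real"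
  assumes "a \<le> b" and s: "\<bar>s\<bar> = 1"
    and P: "\<And>i. a \<le> i \<Longrightarrow> i < b \<Longrightarrow> P i \<Longrightarrow> s * (w (Suc i) - w i) \<ge> 0"
    and e: "(\<Sum>i\<in>{i\<in>{a..<b}. \<not> P i}. \<bar>w (Suc i) - w i\<bar>) \<le> e"
  shows "(\<Sum>i\<in>{a..<b}. \<bar>w (Suc i) - w i\<bar>) \<le> \<bar>w b - w a\<bar> + 2 * e"
proof -
  have "(\<Sum>i\<in>{a..<b}. \<bar>w (Suc i) - w i\<bar>)
    \<le> (\<Sum>i\<in>{a..<b}. s * (w (Suc i) - w i) + 2 * (if \<not> P i then \<bar>w (Suc i) - w i\<bar> else 0))"
  proof (rule sum_mono)
    fix i assume i: "i \<in> {a..<b}"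
    have "\<bar>s * (w (Suc i) - w i)\<bar> = \<bar>w (Suc i) - w i\<bar>" using s by (simp add: abs_mult)
    then show "\<bar>w (Suc i) - w i\<bar> \<le> s * (w (Suc i) - w i) + 2 * (if \<not> P i then \<bar>w (Suc i) - w i\<bar> else 0)"
      using P[of i] i by (cases "P i") auto
  qed
  also have "\<dots> = s * (w b - w a) + 2 * (\<Sum>i\<in>{i\<in>{a..<b}. \<not> P i}. \<bar>w (Suc i) - w i\<bar>)"
    unfolding sum.inter_filter[OF finite_atLeastLessThan] using sum_Suc_diff'[OF assms(1), of w]
    by (simp add: sum.distrib sum_distrib_left[symmetric])
  also have "s * (w b - w a) \<le> \<bar>w b - w a\<bar>" using s by (metis abs_ge_self abs_mult mult_1)
  finally show ?thesis using e by linarith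
qed

lemma staircase_HV_plateau:
  assumes "H > 0" "\<bar>x - 2 * H * real_of_int r\<bar> \<le> H" "x < 2 * H * real_of_int r + H"
  shows "staircase_HV H V x = V * (2 * real_of_int r)"
proof -
  have "\<lfloor>(x / H + 1) / 2\<rfloor> = r"
  proof (rule floor_unique)
    have "2 * H * real_of_int r - H \<le> x" using assms by linarith
    then show "real_of_int r \<le> (x / H + 1) / 2" using assms(1) by (simp add: field_simps)
    show "(x / H + 1) / 2 < real_of_int r + 1" using assms(1,3) by (simp add: field_simps)
  qed
  then show ?thesis by (simp add: staircase_HV_def staircase_def)
qed

section \<open>One staircase parameter for all plateaus, and the case of zero slope\<close>

context blow begin

text \<open>Spacing errors accumulate linearly with the number of plateaus passed. Only boundedly
  many plateaus meet \<open>[-R0, R0]\<close>, so one parameter, read off from the plateau at the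
  origin, serves for all of them.\<close>

lemma key_nonzero:
  assumes M: "M \<noteq> 0" and H: "H > 0" and \<alpha>: "\<alpha> = 2 * c * (2 * H)^3" and \<eta>: "\<eta> > 0"
  shows "\<forall>\<^sub>F n in sequentially. \<exists>\<tau>\<in>{-1..1}. shadows (y n) (W n) (obl H (M * H) \<tau>) R \<eta>"
proof -
  define R0 where "R0 = max R 1"
  have R0: "R0 \<ge> 1" "R \<le> R0" by (auto simp: R0_def)
  \<comment> \<open>Bounds the difference of index between the plateau at the origin and any plateau
    meeting \<open>[-R0, R0]\<close>, and so the factor by which the error \<open>e\<close>
    accumulates.\<close>
  define Q where "Q = R0 / H + 7"
  have Q: "Q \<ge> 7" using R0 H by (simp add: Q_def)
  define K where "K = (Q + 1) * (\<bar>M\<bar> + 1) + \<bar>M\<bar> + 5"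
  have "min \<eta> (min H (\<bar>M\<bar> * H)) > 0" using \<eta> H M by simp
  then obtain e where e: "e > 0" "e \<le> 1" "e \<le> min \<eta> (min H (\<bar>M\<bar> * H))" "K * e \<le> min \<eta> (min H (\<bar>M\<bar> * H))"
    by (rule small_eps)
  \<comment> \<open>The first two bounds control the horizontal and vertical distance to the
    staircase; the third ensures that every large jump has the sign of \<open>M\<close>.\<close>
  have Ke: "(Q + 1) * e + 2 * e \<le> \<eta>" "2 * e + \<bar>M\<bar> * ((Q + 1) * e) \<le> \<eta>" "3 * e + \<bar>M\<bar> * e \<le> \<bar>M\<bar> * H" "e \<le> H" "2 * e \<le> \<eta>"
  proof -
    have p: "(Q + 1) * e \<ge> 0" "\<bar>M\<bar> * ((Q + 1) * e) \<ge> 0" "\<bar>M\<bar> * e \<ge> 0" using Q e by auto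
    have "K * e = \<bar>M\<bar> * ((Q + 1) * e) + (Q + 1) * e + \<bar>M\<bar> * e + 5 * e" by (simp add: K_def algebra_simps)
    then show "(Q + 1) * e + 2 * e \<le> \<eta>" "2 * e + \<bar>M\<bar> * ((Q + 1) * e) \<le> \<eta>" "3 * e + \<bar>M\<bar> * e \<le> \<bar>M\<bar> * H" "e \<le> H" "2 * e \<le> \<eta>"
      using e p by linarith+
  qed
  have H2: "2 * H > 0" and R1: "R0 + 1 > 0" using H R0 by auto
  obtain R2 where R2: "\<forall>\<^sub>F n in sequentially. \<exists>N j. strict_mono_on {..N} j \<and> {i\<in>{j 0..j N}. big n i} = j ` {..N}
      \<and> \<bar>y n (j 0)\<bar> \<le> R2 \<and> \<bar>y n (Suc (j N))\<bar> \<le> R2 \<and> y n (j 0) \<le> - (R0 + 1) \<and> R0 + 1 \<le> y n (j N)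
      \<and> (\<forall>i<N. \<bar>y n (j (Suc i)) - y n (j i) - 2 * H\<bar> \<le> e \<and> \<bar>W n (Suc (j i)) - M * ((y n (j i) + y n (j (Suc i))) / 2)\<bar> \<le> e)"
    by (rule plateau_structure[OF M H2 \<alpha> R1 e(1)])
  show ?thesis
    using dpos R2 oscillation[OF e(1), of R2] small_variation[OF e(1), of R2] d_small[OF half_gt_zero[OF e(1)]] cell_at[of 0]
  proof eventually_elim
    case (elim n)
    obtain N j where sm: "strict_mono_on {..N} j" and J: "{i\<in>{j 0..j N}. big n i} = j ` {..N}"
      and jR: "\<bar>y n (j 0)\<bar> \<le> R2" "\<bar>y n (Suc (j N))\<bar> \<le> R2" and j0: "y n (j 0) \<le> - (R0 + 1)" and jN: "R0 + 1 \<le> y n (j N)"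
      and sp: "\<And>i. i < N \<Longrightarrow> \<bar>y n (j (Suc i)) - y n (j i) - 2 * H\<bar> \<le> e"
      and va: "\<And>i. i < N \<Longrightarrow> \<bar>W n (Suc (j i)) - M * ((y n (j i) + y n (j (Suc i))) / 2)\<bar> \<le> e"
      using elim(2) by blast
    have dn: "\<delta> n \<ge> 0" using elim by simp
    have js: "j i < j i'" if "i < i'" "i' \<le> N" for i i' using strict_mono_onD[OF sm, of i i'] that by auto
    have jm: "j i \<le> j i'" if "i \<le> i'" "i' \<le> N" for i i' using js[of i i'] that by (cases "i = i'") auto
    have y_less: "y n a < y n b \<Longrightarrow> a < b" for a b using gpos_mono[OF dn, of b a "real (k n)"] by (meson not_le)
    have drift: "\<bar>y n (j r') - y n (j r) - 2 * H * (real r' - real r)\<bar> \<le> (real r' - real r) * e" if "r \<le> r'" "r' \<le> N" for r r'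
      using that
    proof (induction r' rule: dec_induct)
      case (step r')
      have "\<bar>y n (j (Suc r')) - y n (j r') - 2 * H\<bar> \<le> e" using sp step by simp
      moreover have "\<bar>y n (j r') - y n (j r) - 2 * H * (real r' - real r)\<bar> \<le> (real r' - real r) * e" using step by simp
      ultimately show ?case by (simp add: algebra_simps)
    qed auto
    have drift': "\<bar>y n (j r') - y n (j r) - 2 * H * (real r' - real r)\<bar> \<le> \<bar>real r' - real r\<bar> * e" if "r' \<le> N" "r \<le> N" for r r'
    proof (cases "r \<le> r'")
      case True
      then show ?thesis using drift[of r r'] that by simp
    next
      case False
      then have "\<bar>y n (j r) - y n (j r') - 2 * H * (real r - real r')\<bar> \<le> (real r - real r') * e" using drift[of r' r] that by simp
      moreover have "\<bar>real r' - real r\<bar> = real r - real r'" using False by simp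
      moreover have "y n (j r') - y n (j r) - 2 * H * (real r' - real r) = - (y n (j r) - y n (j r') - 2 * H * (real r - real r'))"
        by (simp add: algebra_simps)
      ultimately show ?thesis by (simp only: abs_minus_cancel)
    qed
    have idx: "\<exists>r<N. Suc (j r) \<le> i \<and> i < Suc (j (Suc r))" if "\<bar>y n i\<bar> \<le> R0" for i
    proof -
      have "j 0 < i" "i < j N" using that j0 jN R0 by (intro y_less; linarith)+
      then show ?thesis using block_index_exists[of "\<lambda>r. Suc (j r)" i N] by fastforce
    qed
    have yin: "\<bar>y n i\<bar> \<le> R2" if "j 0 \<le> i" "i \<le> Suc (j N)" for i using win_mono[OF dn jR] that by blast
    have plat: "\<bar>W n i - W n (Suc (j r))\<bar> \<le> e" if r: "r < N" "Suc (j r) \<le> i" "i < Suc (j (Suc r))" for i r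
    proof (rule elim(3)[rule_format], intro conjI ballI)
      have "j 0 \<le> j r" "j (Suc r) \<le> j N" using r by (auto intro: jm)
      then show "\<bar>y n (Suc (j r))\<bar> \<le> R2" "\<bar>y n i\<bar> \<le> R2" using r by (auto intro!: yin)
      fix q assume q: "q \<in> {Suc (j r)..<i}"
      show "\<not> big n q"
      proof
        assume "big n q"
        moreover have "q \<in> {j 0..j N}" using q r \<open>j 0 \<le> j r\<close> \<open>j (Suc r) \<le> j N\<close> by auto
        ultimately have "q \<in> j ` {..N}" using J by blast
        then obtain i' where i': "i' \<le> N" "q = j i'" by auto
        then have "j r < j i'" "j i' < j (Suc r)" using q r by auto
        then have "r < i'" "i' < Suc r" using jm[of i' r] jm[of "Suc r" i'] r i' by (meson leD leI less_imp_le)+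
        then show False by simp
      qed
    qed (use r in auto)
    obtain i0 where i0: "y n i0 \<le> 0" "0 < y n i0 + \<delta> n" using elim(6)[rule_format, of 0] by auto
    have "\<bar>y n i0\<bar> \<le> R0" using i0 R0 elim(5) e by linarith
    then obtain s where s: "s < N" "Suc (j s) \<le> i0" "i0 < Suc (j (Suc s))" using idx by blast
    have ys: "y n (j s) \<le> 0" "y n (j (Suc s)) \<ge> - (e / 2)"
    proof -
      show "y n (j s) \<le> 0" using gpos_mono[OF dn, of "j s" i0 "real (k n)"] s i0 by linarith
      show "y n (j (Suc s)) \<ge> - (e / 2)" using gpos_mono[OF dn, of i0 "j (Suc s)" "real (k n)"] s i0 elim(5) by linarith
    qed
    define \<mu> where "\<mu> r = (y n (j r) + y n (j (Suc r))) / 2" for r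
    have \<mu>s: "\<bar>\<mu> s\<bar> \<le> H + e"
    proof (rule abs_leI)
      have "y n (j (Suc s)) - y n (j s) \<le> 2 * H + e" using sp[OF s(1)] by linarith
      then have "y n (j s) + y n (j (Suc s)) \<le> 2 * (H + e)" using ys(1) e(1) by argo
      then show "\<mu> s \<le> H + e" by (simp add: \<mu>_def)
      have "- (y n (j s) + y n (j (Suc s))) \<le> 2 * (H + e)" using ys(2) \<open>y n (j (Suc s)) - y n (j s) \<le> 2 * H + e\<close> e(1) by argo
      then show "- \<mu> s \<le> H + e" by (simp add: \<mu>_def field_simps)
    qed
    \<comment> \<open>The midpoint of the plateau at the origin in units of \<open>H\<close>. It may
      leave \<open>[-1, 1]\<close> by a small amount because the spacing is only approximate, hence
      the clipping.\<close>
    define \<tau> where "\<tau> = max (-1) (min 1 (\<mu> s / H))"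
    have \<tau>: "\<tau> \<in> {-1..1}" by (auto simp: \<tau>_def)
    have H\<tau>: "\<bar>\<mu> s - H * \<tau>\<bar> \<le> e"
    proof -
      have "H * \<tau> = max (- H) (min H (\<mu> s))"
        using H unfolding \<tau>_def by (simp add: max_mult_distrib_left min_mult_distrib_left)
      then show ?thesis using \<mu>s e by linarith
    qed
    have \<mu>r: "\<bar>\<mu> r - (H * \<tau> + 2 * H * (real r - real s))\<bar> \<le> (Q + 1) * e"
      if r: "r < N" and i: "Suc (j r) \<le> i" "i < Suc (j (Suc r))" "\<bar>y n i\<bar> \<le> R0" for r i
    proof -
      define d where "d = real r - real s"
      have d: "\<bar>y n (j r) - y n (j s) - 2 * H * d\<bar> \<le> \<bar>d\<bar> * e" "\<bar>y n (j (Suc r)) - y n (j (Suc s)) - 2 * H * d\<bar> \<le> \<bar>d\<bar> * e"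
        using drift'[of r s] drift'[of "Suc r" "Suc s"] r s by (auto simp: d_def)
      have "y n (j r) \<le> y n i" "y n i \<le> y n (j (Suc r))" using i dn by (auto intro!: gpos_mono)
      then have "\<bar>y n (j r)\<bar> \<le> R0 + 2 * H + e" using sp[OF r] i(3) by linarith
      moreover have "\<bar>y n (j s)\<bar> \<le> 2 * H + 2 * e" using ys sp[OF s(1)] e by linarith
      ultimately have "\<bar>2 * H * d\<bar> \<le> R0 + 4 * H + 3 * e + \<bar>d\<bar> * e" using d by linarith
      moreover have "\<bar>2 * H * d\<bar> = 2 * (\<bar>d\<bar> * H)" using H by (simp add: abs_mult)
      moreover have "\<bar>d\<bar> * e \<le> \<bar>d\<bar> * H" using Ke by (intro mult_left_mono) auto
      ultimately have "\<bar>d\<bar> * H \<le> R0 + 7 * H" using Ke by linarith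
      also have "\<dots> = Q * H" using H by (simp add: Q_def distrib_right)
      finally have "\<bar>d\<bar> \<le> Q" using H by simp
      then have "\<bar>d\<bar> * e \<le> Q * e" using e by (intro mult_right_mono) auto
      then have d': "\<bar>y n (j r) - y n (j s) - 2 * H * d\<bar> \<le> Q * e" "\<bar>y n (j (Suc r)) - y n (j (Suc s)) - 2 * H * d\<bar> \<le> Q * e"
        using d by linarith+
      have "\<mu> r - \<mu> s - 2 * H * d = ((y n (j r) - y n (j s) - 2 * H * d) + (y n (j (Suc r)) - y n (j (Suc s)) - 2 * H * d)) / 2"
        by (simp add: \<mu>_def field_simps)
      also have "\<bar>\<dots>\<bar> \<le> Q * e" using abs_triangle_ineq[of "y n (j r) - y n (j s) - 2 * H * d" "y n (j (Suc r)) - y n (j (Suc s)) - 2 * H * d"] d'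
        by simp
      finally have "\<bar>\<mu> r - \<mu> s - 2 * H * d\<bar> \<le> Q * e" .
      then show ?thesis using H\<tau> unfolding d_def distrib_right by linarith
    qed
    have close: "\<exists>z. \<bar>z - y n i\<bar> \<le> \<eta> \<and> \<bar>W n i - obl H (M * H) \<tau> z\<bar> \<le> \<eta>" if i: "\<bar>y n i\<bar> \<le> R0" for i
    proof -
      obtain r where r: "r < N" "Suc (j r) \<le> i" "i < Suc (j (Suc r))" using idx[OF i] by blast
      define Z where "Z = H * \<tau> + 2 * H * (real r - real s)"
      have \<mu>Z: "\<bar>\<mu> r - Z\<bar> \<le> (Q + 1) * e" unfolding Z_def by (rule \<mu>r[OF r i])
      have "y n (j r) \<le> y n i" "y n i \<le> y n (j (Suc r))" using r dn by (auto intro!: gpos_mono)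
      then have yZ: "\<bar>y n i - Z\<bar> \<le> H + (Q + 1) * e + e"
      proof -
        have "2 * \<mu> r = y n (j r) + y n (j (Suc r))" by (simp add: \<mu>_def)
        then show ?thesis using \<open>y n (j r) \<le> y n i\<close> \<open>y n i \<le> y n (j (Suc r))\<close> sp[OF r(1)] \<mu>Z e(1) by linarith
      qed
      \<comment> \<open>The position is moved into the plateau \<open>[Z - H, Z + H)\<close> of the
        staircase; the \<open>- e\<close> keeps clear of its excluded right end.\<close>
      define z where "z = max (Z - H) (min (y n i) (Z + H - e))"
      have z: "\<bar>z - Z\<bar> \<le> H" "z < Z + H" "\<bar>z - y n i\<bar> \<le> (Q + 1) * e + 2 * e"
        using yZ e(1) Ke(4) H Q unfolding z_def by (auto simp: max_def min_def abs_if)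
      have "staircase_HV H (M * H) (z - H * \<tau>) = M * H * (2 * real_of_int (int r - int s))"
        by (rule staircase_HV_plateau[OF H]) (use z in \<open>auto simp: Z_def algebra_simps\<close>)
      then have "obl H (M * H) \<tau> z = M * Z" by (simp add: obl_def Z_def algebra_simps)
      moreover have "\<bar>M * (\<mu> r - Z)\<bar> \<le> \<bar>M\<bar> * ((Q + 1) * e)" unfolding abs_mult using \<mu>Z by (intro mult_left_mono) auto
      moreover have "\<bar>W n i - W n (Suc (j r))\<bar> \<le> e" by (rule plat[OF r])
      moreover have "\<bar>W n (Suc (j r)) - M * \<mu> r\<bar> \<le> e" using va[OF r(1)] by (simp add: \<mu>_def)
      ultimately have "\<bar>W n i - obl H (M * H) \<tau> z\<bar> \<le> \<eta>" using Ke unfolding right_diff_distrib by linarith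
      then show ?thesis using z Ke by (intro exI[of _ z]) linarith
    qed
    have mono: "(\<Sum>i\<in>{a..<b}. \<bar>W n (Suc i) - W n i\<bar>) \<le> \<bar>W n b - W n a\<bar> + \<eta>"
      if ab: "a \<le> b" "\<bar>y n a\<bar> \<le> R0" "\<bar>y n b\<bar> \<le> R0" for a b
    proof -
      have "j 0 < a" "b < j N" using ab j0 jN R0 by (intro y_less; linarith)+
      have "(\<Sum>i\<in>{a..<b}. \<bar>W n (Suc i) - W n i\<bar>) \<le> \<bar>W n b - W n a\<bar> + 2 * e"
      proof (rule almost_monotone_variation[where s = "sgn M" and P = "big n"])
        show "\<bar>sgn M\<bar> = 1" using M by (simp add: abs_sgn_eq)
        show "(\<Sum>i\<in>{i\<in>{a..<b}. \<not> big n i}. \<bar>W n (Suc i) - W n i\<bar>) \<le> e"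
        proof (cases "a = b")
          case False
          have "a \<le> Suc (j N)" "j 0 \<le> b" using \<open>j 0 < a\<close> \<open>b < j N\<close> ab(1) by auto
          then have "win n R2 a b" using False ab \<open>j 0 < a\<close> \<open>b < j N\<close> yin[of a] yin[of b] by (auto simp: win_def)
          then show ?thesis using elim(4) by blast
        qed (use e in auto)
        fix i assume i: "a \<le> i" "i < b" "big n i"
        then have "i \<in> j ` {..N}" using J \<open>j 0 < a\<close> \<open>b < j N\<close> by auto
        then obtain r where r: "r \<le> N" "i = j r" by auto
        \<comment> \<open>The jump lies strictly between the first and the last one, so the plateaus
          on both of its sides are among those whose heights are known.\<close>
        have "r \<noteq> 0" "r \<noteq> N" using r i \<open>j 0 < a\<close> \<open>b < j N\<close> by (auto intro: ccontr)
        then obtain q where q: "r = Suc q" "Suc q < N" using r by (metis Suc_le_D le_neq_implies_less not0_implies_Suc)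
        have "j q < j (Suc q)" using js q by simp
        then have 1: "\<bar>W n i - W n (Suc (j q))\<bar> \<le> e" using q r by (intro plat) auto
        have 2: "\<bar>W n (Suc (j q)) - M * \<mu> q\<bar> \<le> e" "\<bar>W n (Suc (j (Suc q))) - M * \<mu> (Suc q)\<bar> \<le> e"
          using va[of q] va[of "Suc q"] q by (auto simp: \<mu>_def)
        have 3: "\<mu> (Suc q) - \<mu> q \<ge> 2 * H - e"
        proof -
          have "2 * \<mu> q = y n (j q) + y n (j (Suc q))" "2 * \<mu> (Suc q) = y n (j (Suc q)) + y n (j (Suc (Suc q)))" by (simp_all add: \<mu>_def)
          moreover have "\<bar>y n (j (Suc q)) - y n (j q) - 2 * H\<bar> \<le> e" "\<bar>y n (j (Suc (Suc q))) - y n (j (Suc q)) - 2 * H\<bar> \<le> e"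
            using sp q by auto
          ultimately show ?thesis by linarith
        qed
        have "\<bar>M\<bar> * (2 * H - e) \<le> \<bar>M\<bar> * (\<mu> (Suc q) - \<mu> q)" using 3 by (intro mult_left_mono) auto
        moreover have "\<bar>M\<bar> * H \<ge> 0" using H by simp
        \<comment> \<open>The two midpoints differ by almost \<open>2 * H\<close>, which makes the
          ideal jump at least \<open>3 * e\<close> in modulus. This matches the three errors
          \<open>e\<close> in the actual one, so the sign survives.\<close>
        ultimately have 4: "3 * e \<le> \<bar>M\<bar> * (\<mu> (Suc q) - \<mu> q)" using Ke(3) unfolding right_diff_distrib by linarith
        have 5: "\<bar>(W n (Suc i) - W n i) - M * (\<mu> (Suc q) - \<mu> q)\<bar> \<le> 3 * e"
          using 1 2 unfolding r(2) q(1) right_diff_distrib by linarith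
        show "0 \<le> sgn M * (W n (Suc i) - W n i)"
        proof (cases "M > 0")
          case True
          then show ?thesis using 4 5 by (simp add: abs_if split: if_splits)
        next
          case False
          then have "M < 0" using M by simp
          then show ?thesis using 4 5 by (simp add: abs_if split: if_splits)
        qed
      qed (use ab in auto)
      then show ?thesis using Ke by linarith
    qed
    have "shadows (y n) (W n) (obl H (M * H) \<tau>) R \<eta>"
      unfolding shadows_def using close mono R0(2) by (meson order_trans)
    then show ?case using \<tau> by blast
  qed
qed

text \<open>With \<open>c = 0\<close>, replacing \<open>W\<close> by zero shows that two jumps leave
  almost no energy for the fidelity. Then \<open>W\<close> is tiny at cells \<open>A'\<close> and
  \<open>B'\<close> on either side, and extending the value at \<open>A'\<close> up to
  \<open>B'\<close> needs a single jump and little fidelity, contradicting the presence of two. The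
  order matters: the second competitor is cheap only because of the first.\<close>

lemma at_most_one_jump:
  assumes M: "M = 0" and R: "R > 0"
  shows "\<forall>\<^sub>F n in sequentially. \<forall>a b. win n R a b \<longrightarrow> card {i\<in>{a..<b}. big n i} \<le> 1"
proof -
  define R2 where "R2 = R + 5"
  obtain C where C: "C \<ge> 0" "\<forall>\<^sub>F n in sequentially. \<forall>t. \<bar>t\<bar> \<le> R + 4 \<longrightarrow> (\<exists>i. t \<le> y n i \<and> y n i \<le> t + 2 \<and> \<bar>W n i\<bar> \<le> C)"
    by (rule bounded_cell_near)
  \<comment> \<open>A discrepancy of size \<open>r\<close> over a window of length
    \<open>2 * R2\<close> then costs at most \<open>\<alpha> / 6\<close>.\<close>
  define r where "r = min 1 (\<alpha> / (12 * \<beta> * R2))"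
  have r: "r > 0" "r \<le> 1" "\<beta> * (2 * R2) * r^2 \<le> \<alpha> / 6"
  proof -
    show r0: "r > 0" "r \<le> 1" using alpha beta R by (auto simp: r_def R2_def)
    have "\<beta> * (2 * R2) * r^2 \<le> \<beta> * (2 * R2) * r"
      using r0 beta R by (intro mult_left_mono) (auto simp: power2_eq_square R2_def)
    also have "\<dots> \<le> \<beta> * (2 * R2) * (\<alpha> / (12 * \<beta> * R2))" using beta R by (intro mult_left_mono) (auto simp: r_def R2_def)
    also have "\<dots> = \<alpha> / 6"
    proof -
      have "R2 > 0" using R by (simp add: R2_def)
      then show ?thesis using beta by simp
    qed
    finally show "\<beta> * (2 * R2) * r^2 \<le> \<alpha> / 6" .
  qed
  \<comment> \<open>The first bound makes \<open>2 * \<alpha> - 2 * \<epsilon> \<le> \<alpha> +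
    \<epsilon> + \<alpha> / 6\<close> false; the last turns a fidelity of at most
    \<open>3 * \<epsilon>\<close> into \<open>\<bar>W n i - G n i\<bar> \<le> r / 4\<close> at a
    suitable cell.\<close>
  define \<epsilon> where "\<epsilon> = min (\<alpha> / 12) (min (r / 4) (\<beta> * (r / 4)^2 / 6))"
  have e: "\<epsilon> > 0" "\<epsilon> \<le> \<alpha> / 12" "\<epsilon> \<le> r / 4" "6 * \<epsilon> \<le> \<beta> * (r / 4)^2" using alpha r beta by (auto simp: \<epsilon>_def)
  have h: "(1/2::real) > 0" by simp
  show ?thesis
    using dpos phi_nonneg C(2) d_small[OF h] phi_low[OF e(1)] phi_up[OF e(1), of 2] partition_bound[OF e(1), of R2 C 1]
      Gapp[OF e(1), of R2] bounded_cell[OF h, of R2] cell_at[of "R + 4"] minim win_lt[of R2]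
  proof eventually_elim
    case (elim n)
    have dn: "\<delta> n \<ge> 0" using elim(1) by simp
    have y_less: "y n a < y n b \<Longrightarrow> a < b" for a b using gpos_mono[OF dn, of b a "real (k n)"] by (meson not_le)
    have ySuc: "y n (Suc i) = y n i + \<delta> n" for i by (simp add: gpos_def algebra_simps)
    have count: "real (card {i\<in>{a..<b}. big n i}) * (\<alpha> - \<epsilon>) \<le> (\<Sum>i\<in>{a..<b}. \<phi> n (W n (Suc i) - W n i))" for a b
    proof -
      have "real (card {i\<in>{a..<b}. big n i}) * (\<alpha> - \<epsilon>) = (\<Sum>i\<in>{i\<in>{a..<b}. big n i}. \<alpha> - \<epsilon>)" by simp
      also have "\<dots> \<le> (\<Sum>i\<in>{i\<in>{a..<b}. big n i}. \<phi> n (W n (Suc i) - W n i))"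
        by (intro sum_mono) (use elim(5) in \<open>auto simp: big_def\<close>)
      also have "\<dots> \<le> (\<Sum>i\<in>{a..<b}. \<phi> n (W n (Suc i) - W n i))" using elim(2) by (intro sum_mono2) auto
      finally show ?thesis .
    qed
    \<comment> \<open>Two strips of length at least 1 on either side of \<open>[-R, R]\<close>, from
      \<open>A\<close> to \<open>a1\<close> and from \<open>b1\<close> to \<open>B\<close>, in which
      cells with small fidelity will be found.\<close>
    have "\<bar>- (R + 4)\<bar> \<le> R + 4" "\<bar>R + 2\<bar> \<le> R + 4" "\<bar>- R\<bar> \<le> R + 4" "\<bar>R + 1/2\<bar> \<le> R + 4" using R by auto
    then obtain A B a1 b1 where A: "- (R + 4) \<le> y n A" "y n A \<le> - (R + 4) + 2" "\<bar>W n A\<bar> \<le> C"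
      and B: "R + 2 \<le> y n B" "y n B \<le> R + 2 + 2" "\<bar>W n B\<bar> \<le> C"
      and a1: "y n a1 \<le> - R" "- R < y n a1 + \<delta> n" and b1: "y n b1 \<le> R + 1/2" "R + 1/2 < y n b1 + \<delta> n"
      using elim(3,10) by meson
    have ord: "A < a1" "a1 < b1" "b1 < B" using A B a1 b1 R elim(4) by (intro y_less; linarith)+
    have w1: "win n R2 A a1" "win n R2 b1 B" "win n R2 A B"
      using A B a1 b1 R elim(4) ord unfolding win_def R2_def by linarith+
    show ?case
    proof (intro allI impI, rule ccontr)
      fix a b assume w: "win n R a b" and "\<not> card {i\<in>{a..<b}. big n i} \<le> 1"
      then have two: "card {i\<in>{a..<b}. big n i} \<ge> 2" by simp
      define F where "F = \<beta> * \<delta> n * (\<Sum>i\<in>{Suc A..<B}. (W n i - G n i)^2)"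
      have more: "2 * (\<alpha> - \<epsilon>) \<le> (\<Sum>i\<in>{p..<q}. \<phi> n (W n (Suc i) - W n i))" if "p \<le> a" "b \<le> q" for p q
      proof -
        have "card {i\<in>{a..<b}. big n i} \<le> card {i\<in>{p..<q}. big n i}" using that by (intro card_mono) auto
        then have "2 \<le> real (card {i\<in>{p..<q}. big n i})" using two by linarith
        then have "2 * (\<alpha> - \<epsilon>) \<le> real (card {i\<in>{p..<q}. big n i}) * (\<alpha> - \<epsilon>)" using e alpha by (intro mult_right_mono) auto
        then show ?thesis using count[of p q] by linarith
      qed
      have sub: "\<beta> * \<delta> n * (\<Sum>i\<in>{Suc p..<q}. (W n i - G n i)^2) \<le> F" if "A \<le> p" "q \<le> B" for p q
        unfolding F_def using that beta dn by (intro mult_left_mono sum_mono2) auto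
      have yin: "\<bar>y n i\<bar> \<le> R2" if "A \<le> i" "i \<le> B" for i using win_mono[OF dn, of A R2 B i] w1(3) that by (auto simp: win_def)
      have vbd: "\<bar>W n i\<bar> \<le> r / 2" if "A \<le> i" "i \<le> B" "\<beta> * (1/2) * (W n i - G n i)^2 \<le> F" "F \<le> 3 * \<epsilon>" for i
      proof -
        have "\<beta> * (W n i - G n i)^2 \<le> \<beta> * (r / 4)^2" using that e by linarith
        then have "(W n i - G n i)^2 \<le> (r / 4)^2" using beta by simp
        then have "\<bar>W n i - G n i\<bar> \<le> r / 4" using r by (simp add: abs_le_square_iff[symmetric])
        moreover have "\<bar>G n i\<bar> \<le> \<epsilon>" using elim(8) yin[OF that(1,2)] M by auto
        ultimately show ?thesis using e by linarith
      qed
      obtain A' where A': "A < A'" "A' < a1" "\<beta> * (1/2) * (W n A' - G n A')^2 \<le> F"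
      proof -
        have "2 * (1/2) \<le> (real a1 - real A) * \<delta> n" unfolding gpos_diff[of "real (k n)", symmetric] using A a1 elim(4) by linarith
        then obtain i where "A < i" "i < a1" "\<beta> * (1/2) * (W n i - G n i)^2 \<le> \<beta> * \<delta> n * (\<Sum>i\<in>{Suc A..<a1}. (W n i - G n i)^2)"
          using elim(9) w1(1) by blast
        then show thesis using that[of i] sub[of A a1] ord by linarith
      qed
      obtain B' where B': "b1 < B'" "B' < B" "\<beta> * (1/2) * (W n B' - G n B')^2 \<le> F"
      proof -
        have "2 * (1/2) \<le> (real B - real b1) * \<delta> n" unfolding gpos_diff[of "real (k n)", symmetric] using B b1 elim(4) by linarith
        then obtain i where "b1 < i" "i < B" "\<beta> * (1/2) * (W n i - G n i)^2 \<le> \<beta> * \<delta> n * (\<Sum>i\<in>{Suc b1..<B}. (W n i - G n i)^2)"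
          using elim(9) w1(2) by blast
        then show thesis using that[of i] sub[of b1 B] ord by linarith
      qed
      have "y n (Suc A') \<le> y n a1" "y n (Suc b1) \<le> y n B'" using A' B' dn by (auto intro!: gpos_mono)
      then have "A' < a" "b < B'" using w a1 b1 elim(1,4) unfolding win_def ySuc by (auto intro!: y_less)
      have AB': "A' < B'" using A' B' ord by simp
      have F: "F \<le> 3 * \<epsilon>"
      proof -
        have "enW n A B \<le> (real 1 + 1) * \<alpha> + c * ((real B - real A - 1) * \<delta> n)^3 / (real 1)^2 + \<epsilon>"
          using elim(7)[rule_format, of A B 1] w1(3) A(3) B(3) by auto
        moreover have "c = 0" unfolding c_def using M by simp
        moreover have "2 * (\<alpha> - \<epsilon>) + F \<le> enW n A B" unfolding en_def F_def using more[of A B] A' B' \<open>A' < a\<close> \<open>b < B'\<close> by simp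
        ultimately show ?thesis by simp
      qed
      have v: "\<bar>W n A'\<bar> \<le> r / 2" "\<bar>W n B'\<bar> \<le> r / 2"
        using A' B' F ord by (intro vbd; simp; fail)+
      define Z where "Z i = (if A' < i \<and> i < B' then W n A' else W n i)" for i
      have "B' < n" using elim(12) yin[of B'] B' ord by auto
      then have "enW n A' B' \<le> en \<beta> (\<delta> n) (\<phi> n) (G n) Z A' B'"
        using elim(11) AB' unfolding locmin_def by (auto simp: Z_def)
      also have "\<dots> \<le> (\<alpha> + \<epsilon>) + \<alpha> / 6"
        unfolding en_def
      proof (intro add_mono)
        have "(\<Sum>i\<in>{A'..<B'}. \<phi> n (Z (Suc i) - Z i)) = (\<Sum>i\<in>{B' - 1}. \<phi> n (Z (Suc i) - Z i))"
        proof (rule sum.mono_neutral_right)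
          show "\<forall>i\<in>{A'..<B'} - {B' - 1}. \<phi> n (Z (Suc i) - Z i) = 0"
          proof
            fix i assume "i \<in> {A'..<B'} - {B' - 1}"
            then have "Z (Suc i) = W n A'" "Z i = W n A'" by (auto simp: Z_def)
            then show "\<phi> n (Z (Suc i) - Z i) = 0" using phi0 by simp
          qed
        qed (use AB' in auto)
        also have "\<dots> = \<phi> n (W n B' - W n A')"
        proof -
          \<comment> \<open>If \<open>A'\<close> and \<open>B'\<close> are adjacent, no cell lies
            between them, but the value at \<open>B' - 1\<close> is still
            \<open>W n A'\<close>.\<close>
          have "B' - 1 = A' \<or> A' < B' - 1" using AB' by linarith
          then have "Z (Suc (B' - 1)) = W n B'" "Z (B' - 1) = W n A'" using AB' by (auto simp: Z_def)
          then show ?thesis by simp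
        qed
        also have "\<dots> \<le> \<alpha> + \<epsilon>" using elim(6) v r by auto
        finally show "(\<Sum>i\<in>{A'..<B'}. \<phi> n (Z (Suc i) - Z i)) \<le> \<alpha> + \<epsilon>" .
        have "(\<Sum>i\<in>{Suc A'..<B'}. (Z i - G n i)^2) \<le> (\<Sum>i\<in>{Suc A'..<B'}. r^2)"
        proof (rule sum_mono)
          fix i assume i: "i \<in> {Suc A'..<B'}"
          have "\<bar>G n i\<bar> \<le> \<epsilon>" using elim(8) yin[of i] M i A' B' by auto
          then have "\<bar>Z i - G n i\<bar> \<le> r" using v e r i by (auto simp: Z_def)
          then show "(Z i - G n i)^2 \<le> r^2" by (metis abs_ge_zero power2_abs power_mono)
        qed
        then have "\<beta> * \<delta> n * (\<Sum>i\<in>{Suc A'..<B'}. (Z i - G n i)^2) \<le> \<beta> * \<delta> n * (\<Sum>i\<in>{Suc A'..<B'}. r^2)"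
          using beta dn by (intro mult_left_mono) auto
        also have "\<dots> = \<beta> * ((real B' - real A' - 1) * \<delta> n) * r^2" using AB' by (simp add: of_nat_diff)
        also have "\<dots> \<le> \<beta> * (2 * R2) * r^2"
        proof -
          have "win n R2 A' B'" using win_sub[OF dn w1(3)] A' B' AB' by auto
          then have "(real B' - real A' - 1) * \<delta> n \<le> 2 * R2" using win_len dn unfolding left_diff_distrib by fastforce
          then show ?thesis using beta by (intro mult_right_mono mult_left_mono) auto
        qed
        also have "\<dots> \<le> \<alpha> / 6" by (rule r(3))
        finally show "\<beta> * \<delta> n * (\<Sum>i\<in>{Suc A'..<B'}. (Z i - G n i)^2) \<le> \<alpha> / 6" .
      qed
      finally have "enW n A' B' \<le> \<alpha> + \<epsilon> + \<alpha> / 6" .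
      moreover have "2 * (\<alpha> - \<epsilon>) \<le> enW n A' B'"
        using more[of A' B'] \<open>A' < a\<close> \<open>b < B'\<close> en_parts(1)[OF elim(1,2), of A' B'] by linarith
      ultimately have "2 * \<alpha> - 2 * \<epsilon> \<le> \<alpha> + \<epsilon> + \<alpha> / 6" by (simp add: right_diff_distrib)
      then show False using e(2) alpha by argo
    qed
  qed
qed

text \<open>A jump-free stretch of length \<open>2 * D\<close> contains a cell where
  \<open>W\<close> is small, and then \<open>W\<close> is small on the whole stretch. With at most
  one jump in a window reaching \<open>2 * D\<close> beyond \<open>[-R0, R0]\<close>, every cell of
  interest has such a stretch on its left or on its right.\<close>

lemma key_zero:
  assumes M: "M = 0" and \<eta>: "\<eta> > 0"
  shows "\<forall>\<^sub>F n in sequentially. shadows (y n) (W n) (\<lambda>_. 0) R \<eta>"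
proof -
  define R0 where "R0 = max R 1"
  have R0: "R0 \<ge> 1" "R \<le> R0" by (auto simp: R0_def)
  define CE where "CE = 2 * C1 + 1"
  have CE: "CE \<ge> 1" using C1 by (simp add: CE_def)
  \<comment> \<open>The length at which a discrepancy \<open>\<eta> / 4\<close> would use up the
    whole energy \<open>CE\<close>. There is no circularity with the radius \<open>R1\<close>,
    because for \<open>M = 0\<close> the bound \<open>CE\<close> does not depend on the
    radius.\<close>
  define D where "D = 16 * CE / (\<beta> * \<eta>^2)"
  have D: "D > 0" "\<beta> * D * (\<eta> / 4)^2 = CE" using CE beta \<eta> by (auto simp: D_def power2_eq_square)
  define R1 where "R1 = R0 + 2 * D + 1"
  have R1: "R1 > 0" using R0 D by (simp add: R1_def)
  obtain \<epsilon> where e: "\<epsilon> > 0" "\<epsilon> \<le> 1" "\<epsilon> \<le> \<eta> / 4" "(\<beta> * (2 * R1)) * \<epsilon> \<le> 1"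
  proof -
    have "min 1 (\<eta> / 4) > 0" using \<eta> by simp
    then obtain \<epsilon> where "\<epsilon> > 0" "\<epsilon> \<le> 1" "\<epsilon> \<le> min 1 (\<eta> / 4)" "(\<beta> * (2 * R1)) * \<epsilon> \<le> min 1 (\<eta> / 4)" by (rule small_eps)
    then show thesis using that by simp
  qed
  have "\<epsilon>^2 \<le> \<epsilon>" using e by (simp add: power2_eq_square mult_le_cancel_left1)
  then have "\<beta> * (2 * R1) * \<epsilon>^2 \<le> \<beta> * (2 * R1) * \<epsilon>" using beta R1 by (intro mult_left_mono) auto
  then have CEb: "2 * C1 + \<beta> * (2 * R1) * (\<bar>M\<bar> * R1 + \<epsilon>)^2 \<le> CE" using e M unfolding CE_def by (simp only: abs_zero mult_zero_left add_0 add_le_cancel_left)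
  have h: "(1/2::real) > 0" by simp
  have \<eta>4: "\<eta> / 4 > 0" using \<eta> by simp
  show ?thesis
    using dpos phi_nonneg energy_bound[OF e(1), of R1] Gapp[OF e(1), of R1] bounded_cell[OF D(1), of R1] cell_at[of R1] d_small[OF h]
      at_most_one_jump[OF M R1] oscillation[OF \<eta>4, of R1] small_variation[OF \<eta>4, of R1]
  proof eventually_elim
    case (elim n)
    have dn: "\<delta> n \<ge> 0" using elim(1) by simp
    have y_less: "y n a < y n b \<Longrightarrow> a < b" for a b using gpos_mono[OF dn, of b a "real (k n)"] by (meson not_le)
    have "\<bar>- R1 + 1/2\<bar> \<le> R1" "\<bar>R1\<bar> \<le> R1" using R0 D unfolding R1_def by linarith+
    then obtain p q where p: "y n p \<le> - R1 + 1/2" "- R1 + 1/2 < y n p + \<delta> n" and q: "y n q \<le> R1" "R1 < y n q + \<delta> n"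
      using elim(6) by meson
    have yin: "\<bar>y n i\<bar> \<le> R1" if "p \<le> i" "i \<le> q" for i
      using win_mono[OF dn, of p R1 q i] that p q R0 D elim(7) unfolding R1_def by linarith
    have pl: "\<bar>W n i\<bar> \<le> \<eta> / 2 + \<eta> / 4"
      if ab: "p \<le> a" "a < b" "b \<le> q" "a \<le> i" "i \<le> b" "y n b - y n a \<ge> 2 * D" "\<forall>i\<in>{a..<b}. \<not> big n i" for a b i
    proof -
      have w: "win n R1 a b" using ab by (auto simp: win_def intro!: yin)
      then obtain i' where i': "a < i'" "i' < b" "\<beta> * D * (W n i' - G n i')^2 \<le> \<beta> * \<delta> n * (\<Sum>i\<in>{Suc a..<b}. (W n i - G n i)^2)"
        using elim(5) ab(6) unfolding gpos_diff by blast
      have "enW n a b \<le> CE" using elim(3) w CEb by force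
      then have "\<beta> * D * (W n i' - G n i')^2 \<le> \<beta> * D * (\<eta> / 4)^2" using i'(3) en_parts(2)[OF elim(1,2), of a b] D by linarith
      moreover have "\<beta> * D > 0" using beta D by simp
      ultimately have "(W n i' - G n i')^2 \<le> (\<eta> / 4)^2" by (rule mult_left_le_imp_le)
      then have 1: "\<bar>W n i' - G n i'\<bar> \<le> \<eta> / 4" using \<eta> by (simp add: abs_le_square_iff[symmetric])
      have 2: "\<bar>G n i'\<bar> \<le> \<eta> / 4" using elim(4) yin[of i'] i' ab M e by fastforce
      have 3: "\<bar>W n i - W n i'\<bar> \<le> \<eta> / 4"
      proof (cases "i' \<le> i")
        case True
        then show ?thesis using elim(9)[rule_format, of i' i] yin[of i] yin[of i'] i' ab by auto
      next
        case False
        then have "\<bar>W n i' - W n i\<bar> \<le> \<eta> / 4" using elim(9)[rule_format, of i i'] yin[of i] yin[of i'] i' ab by auto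
        then show ?thesis by linarith
      qed
      show ?thesis using 1 2 3 by linarith
    qed
    have small: "\<bar>W n i\<bar> \<le> \<eta> / 2 + \<eta> / 4" if i: "\<bar>y n i\<bar> \<le> R0" for i
    proof -
      have pi: "y n i - y n p \<ge> 2 * D" "y n q - y n i \<ge> 2 * D" using i p q elim(7) unfolding R1_def by linarith+
      then have o: "p < i" "i < q" using D by (intro y_less; linarith)+
      have "(\<forall>j\<in>{p..<i}. \<not> big n j) \<or> (\<forall>j\<in>{i..<q}. \<not> big n j)"
      proof (rule ccontr)
        assume "\<not> ?thesis"
        then obtain j j' where j: "j \<in> {p..<i}" "big n j" "j' \<in> {i..<q}" "big n j'" by blast
        then have "card {j, j'} \<le> card {j\<in>{p..<q}. big n j}" by (intro card_mono) auto
        moreover have "j \<noteq> j'" using j by auto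
        moreover have "card {j\<in>{p..<q}. big n j} \<le> 1" using elim(8) o yin[of p] yin[of q] by (auto simp: win_def)
        ultimately show False by simp
      qed
      then show ?thesis using pl[of p i i] pl[of i q i] pi o by force
    qed
    have mono: "(\<Sum>i\<in>{a..<b}. \<bar>W n (Suc i) - W n i\<bar>) \<le> \<bar>W n b - W n a\<bar> + \<eta>"
      if ab: "a \<le> b" "\<bar>y n a\<bar> \<le> R0" "\<bar>y n b\<bar> \<le> R0" for a b
    proof (cases "a = b")
      case False
      then have w: "win n R1 a b" using ab D by (auto simp: win_def R1_def)
      \<comment> \<open>A single large jump has a sign of its own, so the variation estimate applies
        without any information on the sign of the slope.\<close>
      have "\<exists>s. \<bar>s::real\<bar> = 1 \<and> (\<forall>i\<in>{a..<b}. big n i \<longrightarrow> s * (W n (Suc i) - W n i) \<ge> 0)"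
      proof (cases "\<exists>i\<in>{a..<b}. big n i")
        case True
        then obtain i where i: "i \<in> {a..<b}" "big n i" by blast
        have "card {i\<in>{a..<b}. big n i} \<le> 1" using elim(8) w by blast
        then have u: "j = i" if "j \<in> {a..<b}" "big n j" for j
          using i that card_le_Suc0_iff_eq[of "{i\<in>{a..<b}. big n i}"] by auto
        show ?thesis
          by (rule exI[of _ "if W n (Suc i) - W n i \<ge> 0 then 1 else -1"]) (use u in auto)
      qed (auto intro: exI[of _ 1])
      then obtain s where s: "\<bar>s::real\<bar> = 1" "\<forall>i\<in>{a..<b}. big n i \<longrightarrow> s * (W n (Suc i) - W n i) \<ge> 0" by blast
      have "(\<Sum>i\<in>{i\<in>{a..<b}. \<not> big n i}. \<bar>W n (Suc i) - W n i\<bar>) \<le> \<eta> / 4" using elim(10) w by blast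
      then have "(\<Sum>i\<in>{a..<b}. \<bar>W n (Suc i) - W n i\<bar>) \<le> \<bar>W n b - W n a\<bar> + 2 * (\<eta> / 4)"
        using s ab(1) by (intro almost_monotone_variation[where s = s and P = "big n"]) auto
      then show ?thesis using \<eta> by linarith
    qed (use \<eta> in auto)
    show ?case unfolding shadows_def
    proof (intro conjI allI impI)
      fix i assume "\<bar>y n i\<bar> \<le> R"
      then have "\<bar>W n i\<bar> \<le> \<eta> / 2 + \<eta> / 4" using small R0 by force
      then show "\<exists>z. \<bar>z - y n i\<bar> \<le> \<eta> \<and> \<bar>W n i - 0\<bar> \<le> \<eta>" using \<eta> by (intro exI[of _ "y n i"]) auto
    next
      fix a b assume "a \<le> b" "\<bar>y n a\<bar> \<le> R" "\<bar>y n b\<bar> \<le> R"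
      then show "(\<Sum>i\<in>{a..<b}. \<bar>W n (Suc i) - W n i\<bar>) \<le> \<bar>W n b - W n a\<bar> + \<eta>" using mono R0 by force
    qed
  qed
qed

end

section \<open>Reduction of the functional to a discrete problem\<close>

definition cell_avg :: "(real \<Rightarrow> real) \<Rightarrow> nat \<Rightarrow> nat \<Rightarrow> real" where
  "cell_avg f n i = real n * integral {real i / real n..(real i + 1) / real n} f"

definition disc_energy :: "real \<Rightarrow> (nat \<Rightarrow> real) \<Rightarrow> nat \<Rightarrow> (nat \<Rightarrow> real) \<Rightarrow> real" where
  "disc_energy \<beta> F n U = (\<Sum>i<n - 1. ln (1 + (real n * (U (Suc i) - U i))^2)) + \<beta> * (\<Sum>i<n. (U i - F i)^2)"

lemma has_integral_chain:
  fixes h :: "real \<Rightarrow> real" and z :: "nat \<Rightarrow> real"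
  assumes "m \<le> n" and z: "\<And>i. m \<le> i \<Longrightarrow> i < n \<Longrightarrow> z i \<le> z (Suc i)"
    and h: "\<And>i. m \<le> i \<Longrightarrow> i < n \<Longrightarrow> (h has_integral J i) {z i..z (Suc i)}"
  shows "(h has_integral sum J {m..<n}) {z m..z n}"
  using assms
proof (induction n rule: dec_induct)
  case (step n)
  have "z m \<le> z n"
    using step.hyps step.prems(1) by (induction n rule: dec_induct) (auto intro: order.trans)
  then have "(h has_integral sum J {m..<n} + J n) {z m..z (Suc n)}"
    using step by (intro has_integral_combine[where c = "z n"]) auto
  then show ?case using step by simp
qed (simp add: has_integral_refl)

lemma has_integral_grid:
  fixes h :: "real \<Rightarrow> real"
  assumes h: "\<And>i. i < m \<Longrightarrow> (h has_integral J i) {real i / real n..(real i + 1) / real n}"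
  shows "(h has_integral (\<Sum>i<m. J i)) {0..real m / real n}"
  using has_integral_chain[of 0 m "\<lambda>i. real i / real n" h J] h
  by (simp add: add.commute divide_right_mono lessThan_atLeast0)

text \<open>Cells are half-open: at its right endpoint a piecewise constant function already takes
  the next value.\<close>

lemma has_integral_except_right:
  fixes g h :: "real \<Rightarrow> real"
  assumes "(g has_integral J) {a..b}" "\<And>x. a \<le> x \<Longrightarrow> x < b \<Longrightarrow> h x = g x"
  shows "(h has_integral J) {a..b}"
  by (rule has_integral_spike_finite[of "{b}" _ _ g]) (use assms in auto)

lemma cell_subset: "i < n \<Longrightarrow> {real i / real n..(real i + 1) / real n} \<subseteq> {0..1}"
proof -
  assume i: "i < n"
  then have "(real i + 1) / real n \<le> 1" by (simp add: divide_le_eq)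
  then show ?thesis by auto
qed

text \<open>On a cell, the integral of \<open>(U - f)^2\<close> is the squared distance of
  \<open>U\<close> from the average of \<open>f\<close> plus the variance of \<open>f\<close>. The
  variance part does not depend on \<open>v\<close>, so minimality passes to
  \<open>disc_energy\<close> with the averages as data.\<close>

lemma PM_energy_PC:
  assumes n: "n \<ge> 1" and f: "continuous_on {0..1} f" and v: "PC n v"
  shows "PM_energy \<beta> f n v = (1 / real n) * disc_energy \<beta> (cell_avg f n) n (\<lambda>i. v (real i / real n))
     + \<beta> * (\<Sum>i<n. integral {real i / real n..(real i + 1) / real n} (\<lambda>x. (f x)^2) - (cell_avg f n i)^2 / real n)"
proof -
  define U where "U i = v (real i / real n)" for i
  have vc: "v x = U i" if "i < n" "real i / real n \<le> x" "x < (real i + 1) / real n" for i x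
    using v that unfolding PC_def U_def by blast
  have len: "(real i + 1) / real n - real i / real n = 1 / real n" for i by (simp add: add_divide_distrib)
  have "((\<lambda>x. ln (1 + ((v (x + 1 / real n) - v x) / (1 / real n))^2)) has_integral (\<Sum>i<n - 1. ln (1 + (real n * (U (Suc i) - U i))^2) / real n)) {0..real (n - 1) / real n}"
  proof (rule has_integral_grid)
    fix i assume i: "i < n - 1"
    have "((\<lambda>x. ln (1 + (real n * (U (Suc i) - U i))^2)) has_integral (1 / real n) * ln (1 + (real n * (U (Suc i) - U i))^2)) {real i / real n..(real i + 1) / real n}"
      using has_integral_const_real[of "ln (1 + (real n * (U (Suc i) - U i))^2)" "real i / real n" "(real i + 1) / real n"]
      by (simp add: len divide_right_mono)
    then have "((\<lambda>x. ln (1 + ((v (x + 1 / real n) - v x) / (1 / real n))^2)) has_integral (1 / real n) * ln (1 + (real n * (U (Suc i) - U i))^2)) {real i / real n..(real i + 1) / real n}"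
    proof (rule has_integral_except_right)
      fix x assume x: "real i / real n \<le> x" "x < (real i + 1) / real n"
      have "v x = U i" using vc[of i x] x i by simp
      moreover have "v (x + 1 / real n) = U (Suc i)"
        using x i by (intro vc) (auto simp: add_divide_distrib)
      ultimately show "ln (1 + ((v (x + 1 / real n) - v x) / (1 / real n))^2) = ln (1 + (real n * (U (Suc i) - U i))^2)"
        by (simp add: mult.commute)
    qed
    then show "((\<lambda>x. ln (1 + ((v (x + 1 / real n) - v x) / (1 / real n))^2)) has_integral ln (1 + (real n * (U (Suc i) - U i))^2) / real n) {real i / real n..(real i + 1) / real n}"
      by simp
  qed
  moreover have "real (n - 1) / real n = 1 - 1 / real n" using n by (simp add: of_nat_diff diff_divide_distrib)
  ultimately have 1: "integral {0..1 - 1 / real n} (\<lambda>x. ln (1 + ((v (x + 1 / real n) - v x) / (1 / real n))^2))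
     = (\<Sum>i<n - 1. ln (1 + (real n * (U (Suc i) - U i))^2) / real n)" by (simp add: integral_unique)
  define I2 where "I2 i = integral {real i / real n..(real i + 1) / real n} (\<lambda>x. (f x)^2)" for i
  have "((\<lambda>x. (v x - f x)^2) has_integral (\<Sum>i<n. (U i - cell_avg f n i)^2 / real n + (I2 i - (cell_avg f n i)^2 / real n))) {0..real n / real n}"
  proof (rule has_integral_grid)
    fix i assume i: "i < n"
    let ?S = "{real i / real n..(real i + 1) / real n}"
    have fc: "continuous_on ?S f" using continuous_on_subset[OF f cell_subset[OF i]] .
    have a: "(f has_integral cell_avg f n i / real n) ?S"
      using integrable_continuous_interval[OF fc] n by (simp add: cell_avg_def has_integral_integral)
    have b: "((\<lambda>x. (f x)^2) has_integral I2 i) ?S"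
      unfolding I2_def by (intro integrable_integral integrable_continuous_interval continuous_intros fc)
    have c: "((\<lambda>x. (U i)^2) has_integral (1 / real n) * (U i)^2) ?S"
      using has_integral_const_real[of "(U i)^2" "real i / real n" "(real i + 1) / real n"]
      by (simp add: len divide_right_mono)
    have "((\<lambda>x. (U i)^2 - (2 * U i) * f x + (f x)^2) has_integral ((1 / real n) * (U i)^2 - (2 * U i) * (cell_avg f n i / real n) + I2 i)) ?S"
      by (intro has_integral_add has_integral_diff has_integral_mult_right a b c)
    then have "((\<lambda>x. (v x - f x)^2) has_integral ((1 / real n) * (U i)^2 - (2 * U i) * (cell_avg f n i / real n) + I2 i)) ?S"
    proof (rule has_integral_except_right)
      fix x assume "real i / real n \<le> x" "x < (real i + 1) / real n"
      then have "v x = U i" using vc i by simp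
      then show "(v x - f x)^2 = (U i)^2 - (2 * U i) * f x + (f x)^2" by (simp add: power2_diff)
    qed
    moreover have "(1 / real n) * (U i)^2 - (2 * U i) * (cell_avg f n i / real n) + I2 i = (U i - cell_avg f n i)^2 / real n + (I2 i - (cell_avg f n i)^2 / real n)"
      by (simp add: power2_diff add_divide_distrib diff_divide_distrib)
    ultimately show "((\<lambda>x. (v x - f x)^2) has_integral ((U i - cell_avg f n i)^2 / real n + (I2 i - (cell_avg f n i)^2 / real n))) ?S" by (simp only:)
  qed
  then have 2: "integral {0..1} (\<lambda>x. (v x - f x)^2) = (\<Sum>i<n. (U i - cell_avg f n i)^2 / real n + (I2 i - (cell_avg f n i)^2 / real n))"
    using n by (simp add: integral_unique)
  have 3: "(\<Sum>i<n. (U i - cell_avg f n i)^2 / real n + (I2 i - (cell_avg f n i)^2 / real n))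
      = (\<Sum>i<n. (U i - cell_avg f n i)^2) / real n + (\<Sum>i<n. I2 i - (cell_avg f n i)^2 / real n)"
    by (simp only: sum.distrib sum_divide_distrib)
  have 4: "(\<Sum>i<n - 1. ln (1 + (real n * (U (Suc i) - U i))^2) / real n) = (\<Sum>i<n - 1. ln (1 + (real n * (U (Suc i) - U i))^2)) / real n"
    by (simp only: sum_divide_distrib)
  show ?thesis unfolding PM_energy_def 1 2 3 4 disc_energy_def U_def[symmetric] I2_def[symmetric]
    by (simp only: distrib_left add_divide_distrib mult_1 times_divide_eq_left times_divide_eq_right add.assoc)
qed

lemma PC_interpolation:
  assumes n: "n \<ge> 1"
  obtains v where "PC n v" "\<And>i. i < n \<Longrightarrow> v (real i / real n) = Z i"
proof
  \<comment> \<open>The cap \<open>n - 1\<close> gives the point 1 the value of the last cell, as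
    \<open>PC\<close> requires.\<close>
  define v where "v x = Z (min (nat \<lfloor>real n * x\<rfloor>) (n - 1))" for x :: real
  have fl: "v x = Z i" if "i < n" "real i / real n \<le> x" "x < (real i + 1) / real n" for i x
  proof -
    have "real i \<le> real n * x" "real n * x < real i + 1" using that n by (simp_all add: field_simps)
    then have "nat \<lfloor>real n * x\<rfloor> = i" by linarith
    moreover have "i \<le> n - 1" using that by linarith
    ultimately show ?thesis by (simp add: v_def min_def)
  qed
  show vi: "v (real i / real n) = Z i" if "i < n" for i
    using that n by (intro fl) (auto simp: divide_strict_right_mono)
  have "v 1 = Z (n - 1)" by (simp add: v_def min_absorb2)
  moreover have "1 - 1 / real n = real (n - 1) / real n" using n by (simp add: of_nat_diff diff_divide_distrib)
  ultimately have "v 1 = v (1 - 1 / real n)" using vi[of "n - 1"] n by simp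
  then show "PC n v" unfolding PC_def using fl vi by auto
qed

lemma disc_energy_cong:
  assumes "\<And>i. i < n \<Longrightarrow> U i = U' i"
  shows "disc_energy \<beta> F n U = disc_energy \<beta> F n U'"
  unfolding disc_energy_def using assms by simp

lemma minimizer_disc_energy:
  assumes n: "n \<ge> 1" and f: "continuous_on {0..1} f" and u: "PM_minimizer \<beta> f n u"
  shows "disc_energy \<beta> (cell_avg f n) n (\<lambda>i. u (real i / real n)) \<le> disc_energy \<beta> (cell_avg f n) n Z"
proof -
  obtain v where v: "PC n v" "\<And>i. i < n \<Longrightarrow> v (real i / real n) = Z i" using PC_interpolation[OF n] by metis
  have "PM_energy \<beta> f n u \<le> PM_energy \<beta> f n v" "PC n u" using u v unfolding PM_minimizer_def by auto
  then have "(1 / real n) * disc_energy \<beta> (cell_avg f n) n (\<lambda>i. u (real i / real n)) \<le> (1 / real n) * disc_energy \<beta> (cell_avg f n) n (\<lambda>i. v (real i / real n))"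
    using PM_energy_PC[OF n f v(1)] PM_energy_PC[OF n f \<open>PC n u\<close>] by simp
  then have "disc_energy \<beta> (cell_avg f n) n (\<lambda>i. u (real i / real n)) \<le> disc_energy \<beta> (cell_avg f n) n (\<lambda>i. v (real i / real n))"
    using n by (simp add: divide_le_cancel)
  also have "\<dots> = disc_energy \<beta> (cell_avg f n) n Z" using v by (intro disc_energy_cong) auto
  finally show ?thesis .
qed

lemma sum_diff_local:
  fixes f g :: "nat \<Rightarrow> real"
  assumes "finite A" "S \<subseteq> A" "\<And>i. i \<in> A - S \<Longrightarrow> f i = g i"
  shows "sum f A - sum g A = sum f S - sum g S"
  unfolding sum_subtractf[symmetric] using assms by (intro sum.mono_neutral_right) auto

text \<open>The relation \<open>w^3 * real n = ln (real n)\<close> amounts to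
  \<open>w^2 = ln (real n) * \<delta>\<close>: after rescaling, jumps and fidelity share the factor
  \<open>ln (real n)\<close>. This balance is what fixes \<open>omega\<close>. The shift
  \<open>e\<close> changes only the reference height.\<close>

lemma locmin_rescaled:
  assumes min: "\<And>Z. disc_energy \<beta> F n U \<le> disc_energy \<beta> F n Z" and n: "n \<ge> 2"
    and w: "w > 0" "w^3 * real n = ln (real n)"
  shows "locmin \<beta> (1 / (real n * w)) (\<lambda>d. ln (1 + (d / (1 / (real n * w)))^2) / ln (real n))
     (\<lambda>i. (F i - e) / w) (\<lambda>i. (U i - e) / w) n"
proof -
  define \<delta> where "\<delta> = 1 / (real n * w)"
  define \<phi> where "\<phi> d = ln (1 + (d / \<delta>)^2) / ln (real n)" for d
  define G where "G i = (F i - e) / w" for i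
  define W where "W i = (U i - e) / w" for i
  have lnn: "ln (real n) > 0" using n by simp
  have sc: "disc_energy \<beta> F n (\<lambda>i. e + w * Z i) = ln (real n) * ((\<Sum>i<n - 1. \<phi> (Z (Suc i) - Z i)) + \<beta> * \<delta> * (\<Sum>i<n. (Z i - G i)^2))" for Z
  proof -
    have 1: "ln (1 + (real n * ((e + w * Z (Suc i)) - (e + w * Z i)))^2) = ln (real n) * \<phi> (Z (Suc i) - Z i)" for i
      using lnn by (simp add: \<phi>_def \<delta>_def algebra_simps)
    have 2: "(e + w * Z i - F i)^2 = ln (real n) * \<delta> * (Z i - G i)^2" for i
    proof -
      have "e + w * Z i - F i = w * (Z i - G i)" using w by (simp add: G_def field_simps)
      moreover have "w^2 = ln (real n) * \<delta>" using w n by (simp add: \<delta>_def w(2)[symmetric] power2_eq_square power3_eq_cube)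
      ultimately show ?thesis by (simp add: power_mult_distrib)
    qed
    show ?thesis unfolding disc_energy_def 1 2 by (simp add: sum_distrib_left[symmetric] algebra_simps)
  qed
  have "locmin \<beta> \<delta> \<phi> G W n"
    unfolding locmin_def
  proof (intro allI impI)
    fix a b Z assume ab: "a < b" "b < n" and Z: "\<forall>i. i \<le> a \<or> b \<le> i \<longrightarrow> Z i = W i"
    have "(\<lambda>i. e + w * W i) = U" using w by (auto simp: W_def)
    then have "ln (real n) * ((\<Sum>i<n - 1. \<phi> (W (Suc i) - W i)) + \<beta> * \<delta> * (\<Sum>i<n. (W i - G i)^2))
      \<le> ln (real n) * ((\<Sum>i<n - 1. \<phi> (Z (Suc i) - Z i)) + \<beta> * \<delta> * (\<Sum>i<n. (Z i - G i)^2))"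
      using min[of "\<lambda>i. e + w * Z i"] sc[of W] sc[of Z] by simp
    then have "(\<Sum>i<n - 1. \<phi> (W (Suc i) - W i)) + \<beta> * \<delta> * (\<Sum>i<n. (W i - G i)^2)
      \<le> (\<Sum>i<n - 1. \<phi> (Z (Suc i) - Z i)) + \<beta> * \<delta> * (\<Sum>i<n. (Z i - G i)^2)" using lnn by simp
    moreover have "(\<Sum>i<n - 1. \<phi> (W (Suc i) - W i)) - (\<Sum>i<n - 1. \<phi> (Z (Suc i) - Z i))
       = (\<Sum>i\<in>{a..<b}. \<phi> (W (Suc i) - W i)) - (\<Sum>i\<in>{a..<b}. \<phi> (Z (Suc i) - Z i))"
      using ab Z by (intro sum_diff_local) auto
    moreover have "(\<Sum>i<n. (W i - G i)^2) - (\<Sum>i<n. (Z i - G i)^2) = (\<Sum>i\<in>{Suc a..<b}. (W i - G i)^2) - (\<Sum>i\<in>{Suc a..<b}. (Z i - G i)^2)"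
      using ab Z by (intro sum_diff_local) auto
    then have "\<beta> * \<delta> * (\<Sum>i<n. (W i - G i)^2) - \<beta> * \<delta> * (\<Sum>i<n. (Z i - G i)^2)
       = \<beta> * \<delta> * (\<Sum>i\<in>{Suc a..<b}. (W i - G i)^2) - \<beta> * \<delta> * (\<Sum>i\<in>{Suc a..<b}. (Z i - G i)^2)"
      by (simp only: right_diff_distrib[symmetric])
    ultimately show "en \<beta> \<delta> \<phi> G W a b \<le> en \<beta> \<delta> \<phi> G Z a b" unfolding en_def by linarith
  qed
  then show ?thesis unfolding \<delta>_def \<phi>_def G_def W_def .
qed

section \<open>Asymptotics of the rescaled jump cost\<close>

definition mesh :: "nat \<Rightarrow> real" where "mesh n = 1 / (real n * omega n)"

definition jump_cost :: "nat \<Rightarrow> real \<Rightarrow> real" where "jump_cost n d = ln (1 + (d / mesh n)^2) / ln (real n)"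

text \<open>The exact power is irrelevant: it suffices that the threshold is \<open>o(1 / ln n)\<close> but decays slower than any power of \<open>n\<close>.\<close>

definition jump_threshold :: "nat \<Rightarrow> real" where "jump_threshold n = 1 / (ln (real n))^2"

lemma omega_pos: "n \<ge> 2 \<Longrightarrow> omega n > 0"
  by (auto simp: omega_def)

lemma omega_cube: "n \<ge> 2 \<Longrightarrow> (omega n)^3 * real n = ln (real n)"
proof -
  assume n: "n \<ge> 2"
  then have "(omega n)^3 = ln (real n) / real n"
    unfolding omega_def by (subst powr_realpow[symmetric]) (auto simp: powr_powr)
  then show ?thesis using n by simp
qed

lemma omega_tendsto_0: "omega \<longlonglongrightarrow> 0"
  unfolding omega_def by real_asymp

lemma mesh_tendsto_0: "mesh \<longlonglongrightarrow> 0"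
  unfolding mesh_def omega_def by real_asymp

lemma mesh_pos: "n \<ge> 2 \<Longrightarrow> mesh n > 0"
  using omega_pos by (simp add: mesh_def)

lemma jump_cost_nonneg: "n \<ge> 2 \<Longrightarrow> jump_cost n d \<ge> 0"
  by (simp add: jump_cost_def)

lemma jump_cost_mono:
  assumes "n \<ge> 2" "\<bar>d\<bar> \<le> \<bar>d'\<bar>" shows "jump_cost n d \<le> jump_cost n d'"
proof -
  have "(d / mesh n)^2 \<le> (d' / mesh n)^2" unfolding power_divide
    using assms by (intro divide_right_mono) (auto simp: abs_le_square_iff)
  moreover have "1 + (d / mesh n)^2 > 0" by (simp add: add_pos_nonneg)
  ultimately show ?thesis unfolding jump_cost_def using assms(1)
    by (intro divide_right_mono) (subst ln_le_cancel_iff, auto intro: add_pos_nonneg)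
qed

lemma jump_cost_up:
  assumes "\<epsilon> > 0"
  shows "\<forall>\<^sub>F n in sequentially. \<forall>d. \<bar>d\<bar> \<le> C \<longrightarrow> jump_cost n d \<le> 4 / 3 + \<epsilon>"
proof -
  define C' where "C' = max 1 C"
  have C': "C' > 0" "C \<le> C'" by (auto simp: C'_def)
  have "(\<lambda>n. jump_cost n C') \<longlonglongrightarrow> 4 / 3"
    unfolding jump_cost_def mesh_def omega_def using C' by real_asymp
  then have "\<forall>\<^sub>F n in sequentially. jump_cost n C' < 4 / 3 + \<epsilon>" using assms by (intro order_tendstoD) auto
  with eventually_ge_at_top[of 2] show ?thesis
  proof eventually_elim
    case (elim n)
    then show ?case using jump_cost_mono[of n _ C'] C' by (smt (verit))
  qed
qed

lemma jump_cost_low: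
  assumes "\<epsilon> > 0"
  shows "\<forall>\<^sub>F n in sequentially. \<forall>d. \<bar>d\<bar> \<ge> jump_threshold n \<longrightarrow> jump_cost n d \<ge> 4 / 3 - \<epsilon>"
proof -
  have "(\<lambda>n. jump_cost n (jump_threshold n)) \<longlonglongrightarrow> 4 / 3"
    unfolding jump_cost_def mesh_def omega_def jump_threshold_def by real_asymp
  then have "\<forall>\<^sub>F n in sequentially. jump_cost n (jump_threshold n) > 4 / 3 - \<epsilon>" using assms by (intro order_tendstoD) auto
  with eventually_ge_at_top[of 2] show ?thesis
  proof eventually_elim
    case (elim n)
    have "jump_threshold n \<ge> 0" by (simp add: jump_threshold_def)
    then show ?case using elim jump_cost_mono[of n "jump_threshold n"] by (smt (verit))
  qed
qed

text \<open>Either \<open>\<bar>d\<bar> \<le> \<epsilon> * mesh n\<close>, or the cost is at least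
  \<open>ln (1 + \<epsilon>^2) / ln (real n)\<close>, which is of larger order than the threshold
  and hence dominates \<open>\<bar>d\<bar>\<close>.\<close>

lemma jump_cost_small:
  assumes e: "\<epsilon> > 0"
  shows "\<forall>\<^sub>F n in sequentially. \<forall>d. \<bar>d\<bar> < jump_threshold n \<longrightarrow> \<bar>d\<bar> \<le> \<epsilon> * mesh n + \<epsilon> * jump_cost n d"
proof -
  have "ln (1 + \<epsilon>^2) > 0" using e by (intro ln_gt_zero) simp
  then have pos: "\<epsilon> * ln (1 + \<epsilon>^2) > 0" using e by simp
  have "(\<lambda>n. jump_threshold n * ln (real n)) \<longlonglongrightarrow> 0" unfolding jump_threshold_def by real_asymp
  then have "\<forall>\<^sub>F n in sequentially. jump_threshold n * ln (real n) < \<epsilon> * ln (1 + \<epsilon>^2)" using pos by (intro order_tendstoD) auto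
  with eventually_ge_at_top[of 2] show ?thesis
  proof eventually_elim
    case (elim n)
    have lnn: "ln (real n) > 0" using elim by simp
    show ?case
    proof (intro allI impI)
      fix d assume d: "\<bar>d\<bar> < jump_threshold n"
      show "\<bar>d\<bar> \<le> \<epsilon> * mesh n + \<epsilon> * jump_cost n d"
      proof (cases "\<bar>d\<bar> \<le> \<epsilon> * mesh n")
        case True
        moreover have "\<epsilon> * jump_cost n d \<ge> 0" using e jump_cost_nonneg[of n d] elim by simp
        ultimately show ?thesis by linarith
      next
        case False
        have "ln (1 + \<epsilon>^2) / ln (real n) = jump_cost n (\<epsilon> * mesh n)" using mesh_pos[of n] elim by (simp add: jump_cost_def)
        also have "\<dots> \<le> jump_cost n d" using False elim mesh_pos[of n] e by (intro jump_cost_mono) (auto simp: abs_mult)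
        finally have "\<epsilon> * (ln (1 + \<epsilon>^2) / ln (real n)) \<le> \<epsilon> * jump_cost n d" using e by (intro mult_left_mono) auto
        moreover have "jump_threshold n \<le> \<epsilon> * (ln (1 + \<epsilon>^2) / ln (real n))" using elim lnn by (simp add: field_simps)
        moreover have "\<epsilon> * mesh n \<ge> 0" using e mesh_pos[of n] elim by simp
        ultimately show ?thesis using d by linarith
      qed
    qed
  qed
qed

lemma cell_avg_close:
  assumes n: "n \<ge> 1" and f: "continuous_on {real i / real n..(real i + 1) / real n} f"
    and e: "\<And>t. real i / real n \<le> t \<Longrightarrow> t \<le> (real i + 1) / real n \<Longrightarrow> \<bar>f t - a\<bar> \<le> e"
  shows "\<bar>cell_avg f n i - a\<bar> \<le> e"
proof -
  let ?l = "real i / real n" and ?r = "(real i + 1) / real n"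
  have lr: "?l \<le> ?r" "?r - ?l = 1 / real n" by (auto simp: add_divide_distrib)
  have e0: "e \<ge> 0" using e[of ?l] lr by linarith
  have "(f has_integral cell_avg f n i / real n) {?l..?r}"
    using integrable_continuous_interval[OF f] n by (simp add: cell_avg_def has_integral_integral)
  moreover have "((\<lambda>t. a) has_integral (?r - ?l) *\<^sub>R a) {?l..?r}"
    using has_integral_const_real[of a ?l ?r] lr by simp
  ultimately have "((\<lambda>t. f t - a) has_integral (cell_avg f n i / real n - (?r - ?l) *\<^sub>R a)) {?l..?r}"
    by (rule has_integral_diff)
  then have "norm (cell_avg f n i / real n - (?r - ?l) *\<^sub>R a) \<le> e * measure lborel {?l..?r}"
    using e0 e by (intro has_integral_bound_real[of _ "{}"]) auto
  then have "\<bar>(cell_avg f n i - a) / real n\<bar> \<le> e / real n"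
    using lr by (simp add: diff_divide_distrib)
  then show ?thesis using n by (simp add: abs_divide divide_le_cancel)
qed

section \<open>The rescaled minimizers as an instance of the abstract blow-up\<close>

locale staircase_setup =
  fixes \<beta> :: real and f f' :: "real \<Rightarrow> real" and u :: "nat \<Rightarrow> real \<Rightarrow> real"
    and k :: "nat \<Rightarrow> nat" and x :: "nat \<Rightarrow> real" and xinf H V :: real
  assumes beta_pos: "\<beta> > 0"
    and f_deriv: "\<forall>t\<in>{0..1}. (f has_real_derivative f' t) (at t within {0..1})"
    and f'_cont: "continuous_on {0..1} f'"
    and u_min: "\<forall>n\<ge>2. PM_minimizer \<beta> f n (u n)"
    and k_range: "\<forall>n\<ge>2. k n < n"
    and x_def: "\<forall>n\<ge>2. x n = real (k n) / real n"
    and x_lim: "x \<longlonglongrightarrow> xinf"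
    and x_inf: "0 < xinf" "xinf < 1"
    and H_def: "H = (1 / (\<beta> * \<bar>f' xinf\<bar>^2)) powr (1/3)"
    and V_def: "V = f' xinf * H"
begin

abbreviation M :: real where "M \<equiv> f' xinf"

definition W :: "nat \<Rightarrow> nat \<Rightarrow> real" where "W n i = (u n (real i / real n) - f (x n)) / omega n"

definition G :: "nat \<Rightarrow> nat \<Rightarrow> real" where "G n i = (cell_avg f n i - f (x n)) / omega n"

abbreviation y :: "nat \<Rightarrow> nat \<Rightarrow> real" where "y n i \<equiv> gpos (real (k n)) (mesh n) i"

lemma f_cont: "continuous_on {0..1} f"
  using f_deriv by (intro DERIV_continuous_on[of _ f f']) auto

text \<open>Strict differentiability at \<open>xinf\<close>. Both points vary, because the centres
  \<open>x n\<close> only converge to \<open>xinf\<close> while increments are taken around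
  \<open>x n\<close>.\<close>

lemma f_linear:
  assumes "\<epsilon> > 0"
  obtains \<rho> where "\<rho> > 0" "{xinf - \<rho>..xinf + \<rho>} \<subseteq> {0..1}"
    "\<forall>s t. \<bar>s - xinf\<bar> \<le> \<rho> \<longrightarrow> \<bar>t - xinf\<bar> \<le> \<rho> \<longrightarrow> \<bar>f t - f s - M * (t - s)\<bar> \<le> \<epsilon> * \<bar>t - s\<bar>"
proof -
  obtain r where r: "r > 0" "\<And>t. t \<in> {0..1} \<Longrightarrow> dist t xinf < r \<Longrightarrow> dist (f' t) M < \<epsilon>"
    using f'_cont assms x_inf unfolding continuous_on_iff by (metis atLeastAtMost_iff less_imp_le)
  define \<rho> where "\<rho> = min (r / 2) (min xinf (1 - xinf))"
  have \<rho>: "\<rho> > 0" "\<rho> < r" using r x_inf by (auto simp: \<rho>_def)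
  have sub: "{xinf - \<rho>..xinf + \<rho>} \<subseteq> {0..1}" by (auto simp: \<rho>_def)
  show thesis
  proof (rule that[OF \<rho>(1) sub], intro allI impI)
    fix s t assume st: "\<bar>s - xinf\<bar> \<le> \<rho>" "\<bar>t - xinf\<bar> \<le> \<rho>"
    define S where "S = {xinf - \<rho>..xinf + \<rho>}"
    have "norm ((f t - M * t) - (f s - M * s)) \<le> \<epsilon> * norm (t - s)"
    proof (rule field_differentiable_bound[of S _ "\<lambda>z. f' z - M"])
      fix z assume z: "z \<in> S"
      have "(f has_real_derivative f' z) (at z within S)"
      proof (rule DERIV_subset)
        show "(f has_real_derivative f' z) (at z within {0..1})" using f_deriv z sub by (auto simp: S_def)
      qed (use sub in \<open>simp add: S_def\<close>)
      then show "((\<lambda>t. f t - M * t) has_field_derivative f' z - M) (at z within S)"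
        by (auto intro!: derivative_eq_intros)
      have "z \<in> {0..1}" "dist z xinf < r" using z sub \<rho> by (auto simp: S_def dist_real_def abs_less_iff)
      then show "norm (f' z - M) \<le> \<epsilon>" using r(2)[of z] by (simp add: dist_real_def)
    qed (use st in \<open>auto simp: S_def\<close>)
    then show "\<bar>f t - f s - M * (t - s)\<bar> \<le> \<epsilon> * \<bar>t - s\<bar>" by (simp add: algebra_simps)
  qed
qed

lemma y_eq: "n \<ge> 2 \<Longrightarrow> y n i = (real i / real n - x n) / omega n"
  using x_def by (simp add: gpos_def mesh_def diff_divide_distrib left_diff_distrib)

lemma room: "\<forall>\<^sub>F n in sequentially. real (k n) * mesh n \<ge> R \<and> (real n - real (k n)) * mesh n \<ge> R"
proof -
  define a where "a = min xinf (1 - xinf) / 2"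
  have a: "a > 0" using x_inf by (simp add: a_def)
  have "\<forall>\<^sub>F n in sequentially. x n > a" using x_lim x_inf by (intro order_tendstoD) (auto simp: a_def min_def)
  moreover have "\<forall>\<^sub>F n in sequentially. x n < 1 - a" using x_lim x_inf by (intro order_tendstoD) (auto simp: a_def min_def field_simps)
  moreover have "\<forall>\<^sub>F n in sequentially. omega n < a / (\<bar>R\<bar> + 1)" using omega_tendsto_0 a by (intro order_tendstoD) auto
  ultimately show ?thesis using eventually_ge_at_top[of 2]
  proof eventually_elim
    case (elim n)
    have w: "omega n > 0" using omega_pos elim by simp
    have "omega n * (\<bar>R\<bar> + 1) < a" using elim(3) by (simp add: less_divide_eq)
    then have Ra: "R * omega n \<le> a" using w by (smt (verit) mult_right_mono mult.commute)
    have "real (k n) * mesh n = x n / omega n" "(real n - real (k n)) * mesh n = (1 - x n) / omega n"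
      using x_def elim w by (auto simp: mesh_def field_simps)
    then show ?case using Ra elim w by (simp add: le_divide_eq)
  qed
qed

lemma G_approx:
  assumes e: "\<epsilon> > 0"
  shows "\<forall>\<^sub>F n in sequentially. \<forall>i. \<bar>y n i\<bar> \<le> R \<longrightarrow> \<bar>G n i - M * y n i\<bar> \<le> \<epsilon>"
proof -
  \<comment> \<open>One unit more than \<open>R\<close>, as the cell at position
    \<open>y n i\<close> extends one mesh to its right.\<close>
  define R' where "R' = \<bar>R\<bar> + 1"
  have R': "R' > 0" by (simp add: R'_def)
  define e1 where "e1 = \<epsilon> / (2 * R')"
  have e1: "e1 > 0" using e R' by (simp add: e1_def)
  obtain \<rho> where \<rho>: "\<rho> > 0" "{xinf - \<rho>..xinf + \<rho>} \<subseteq> {0..1}"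
    and lin: "\<forall>s t. \<bar>s - xinf\<bar> \<le> \<rho> \<longrightarrow> \<bar>t - xinf\<bar> \<le> \<rho> \<longrightarrow> \<bar>f t - f s - M * (t - s)\<bar> \<le> e1 * \<bar>t - s\<bar>"
    by (rule f_linear[OF e1])
  have "\<forall>\<^sub>F n in sequentially. dist (x n) xinf < \<rho> / 2" using x_lim \<rho> by (intro tendstoD) auto
  moreover have "\<forall>\<^sub>F n in sequentially. omega n < \<rho> / (2 * R')" using omega_tendsto_0 \<rho> R' by (intro order_tendstoD) auto
  moreover have "\<forall>\<^sub>F n in sequentially. mesh n < min 1 (\<epsilon> / (2 * (\<bar>M\<bar> + 1)))" using mesh_tendsto_0 e by (intro order_tendstoD) auto
  ultimately show ?thesis using eventually_ge_at_top[of 2]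
  proof eventually_elim
    case (elim n)
    have w: "omega n > 0" using omega_pos elim by simp
    have md: "mesh n > 0" "mesh n < 1" "\<bar>M\<bar> * mesh n \<le> \<epsilon> / 2"
    proof -
      show "mesh n > 0" "mesh n < 1" using mesh_pos elim by auto
      have "(\<bar>M\<bar> + 1) * mesh n \<le> (\<bar>M\<bar> + 1) * (\<epsilon> / (2 * (\<bar>M\<bar> + 1)))" using elim(3) by (intro mult_left_mono) auto
      also have "\<dots> = \<epsilon> / 2" by (simp add: field_simps add_nonneg_eq_0_iff)
      finally show "\<bar>M\<bar> * mesh n \<le> \<epsilon> / 2" using \<open>mesh n > 0\<close> by (simp add: distrib_right)
    qed
    have wm: "omega n * mesh n = 1 / real n" using w elim by (simp add: mesh_def)
    show ?case
    proof (intro allI impI)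
      fix i assume i: "\<bar>y n i\<bar> \<le> R"
      have xi: "real i / real n = x n + omega n * y n i" using y_eq[of n i] elim w by simp
      have tt: "\<bar>t - xinf\<bar> \<le> \<rho>" "\<bar>f t - (f (x n) + omega n * (M * y n i))\<bar> \<le> omega n * \<epsilon>"
        if t: "real i / real n \<le> t" "t \<le> (real i + 1) / real n" for t
      proof -
        define s where "s = (t - x n) / omega n"
        have ts: "t = x n + omega n * s" using w by (simp add: s_def)
        have "omega n * y n i \<le> omega n * s" using t(1) xi ts by simp
        then have s1: "y n i \<le> s" using w by simp
        have "omega n * s \<le> omega n * (y n i + mesh n)" using t(2) xi ts wm by (simp add: add_divide_distrib distrib_left)
        then have s2: "s \<le> y n i + mesh n" using w by simp
        have sR: "\<bar>s\<bar> \<le> R'" using s1 s2 i md by (simp add: R'_def)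
        have "omega n * \<bar>s\<bar> \<le> \<rho> / (2 * R') * R'" using sR elim(2) w R' \<rho> by (intro mult_mono) auto
        then have os: "\<bar>omega n * s\<bar> \<le> \<rho> / 2" using w R' by (simp add: abs_mult)
        then show t\<rho>: "\<bar>t - xinf\<bar> \<le> \<rho>" using elim(1) unfolding ts dist_real_def by linarith
        have "\<bar>x n - xinf\<bar> \<le> \<rho>" using elim(1) \<rho>(1) unfolding dist_real_def by linarith
        then have "\<bar>f t - f (x n) - M * (t - x n)\<bar> \<le> e1 * \<bar>t - x n\<bar>" using lin t\<rho> by blast
        also have "\<dots> = omega n * (e1 * \<bar>s\<bar>)" using w by (simp add: ts abs_mult)
        also have "\<dots> \<le> omega n * (e1 * R')" using w e1 sR by (intro mult_left_mono) auto
        also have "e1 * R' = \<epsilon> / 2" using R' by (simp add: e1_def)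
        finally have 1: "\<bar>f t - f (x n) - M * (t - x n)\<bar> \<le> omega n * (\<epsilon> / 2)" .
        have "\<bar>M * (s - y n i)\<bar> \<le> \<bar>M\<bar> * mesh n" unfolding abs_mult using s1 s2 by (intro mult_left_mono) auto
        then have "\<bar>M * (s - y n i)\<bar> \<le> \<epsilon> / 2" using md by linarith
        then have "\<bar>omega n * (M * (s - y n i))\<bar> \<le> omega n * (\<epsilon> / 2)" using w by (simp add: abs_mult)
        moreover have "f t - (f (x n) + omega n * (M * y n i)) = (f t - f (x n) - M * (t - x n)) + omega n * (M * (s - y n i))"
          by (simp add: ts algebra_simps)
        ultimately show "\<bar>f t - (f (x n) + omega n * (M * y n i))\<bar> \<le> omega n * \<epsilon>" using 1 by linarith
      qed
      have "\<bar>cell_avg f n i - (f (x n) + omega n * (M * y n i))\<bar> \<le> omega n * \<epsilon>"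
      proof (rule cell_avg_close)
        have "{real i / real n..(real i + 1) / real n} \<subseteq> {xinf - \<rho>..xinf + \<rho>}"
        proof
          fix t assume "t \<in> {real i / real n..(real i + 1) / real n}"
          then have "\<bar>t - xinf\<bar> \<le> \<rho>" using tt(1) by simp
          then show "t \<in> {xinf - \<rho>..xinf + \<rho>}" by (simp add: abs_le_iff)
        qed
        then show "continuous_on {real i / real n..(real i + 1) / real n} f"
          using \<rho>(2) by (intro continuous_on_subset[OF f_cont]) auto
      qed (use tt elim in auto)
      moreover have "G n i - M * y n i = (cell_avg f n i - (f (x n) + omega n * (M * y n i))) / omega n"
        using w by (simp add: G_def field_simps)
      ultimately show "\<bar>G n i - M * y n i\<bar> \<le> \<epsilon>" using w by (simp add: abs_divide divide_le_eq mult.commute)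
    qed
  qed
qed

text \<open>Comparison with the zero function bounds the minimizer polynomially in \<open>n\<close>.
  Any increment is then at most \<open>K * n^2\<close> in units of the mesh, and the logarithm of
  its square over \<open>ln n\<close> tends to 4; the constant 5 leaves some room.\<close>

lemma crude_bound:
  "\<forall>\<^sub>F n in sequentially. \<forall>p q. (\<bar>p\<bar> \<le> C \<or> (\<exists>i<n. p = W n i)) \<longrightarrow> (\<bar>q\<bar> \<le> C \<or> (\<exists>i<n. q = W n i)) \<longrightarrow> jump_cost n (p - q) \<le> 5"
proof -
  obtain B where B: "B > 0" "\<And>t. t \<in> {0..1} \<Longrightarrow> \<bar>f t\<bar> \<le> B"
    using compact_imp_bounded[OF compact_continuous_image[OF f_cont compact_Icc]]
    unfolding bounded_pos by auto
  define K where "K = 2 * (3 * B + \<bar>C\<bar>)"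
  have K: "K > 0" using B by (simp add: K_def)
  have "(\<lambda>n. ln (1 + (K * real n^2)^2) / ln (real n)) \<longlonglongrightarrow> 4" using K by real_asymp
  then have "\<forall>\<^sub>F n in sequentially. ln (1 + (K * real n^2)^2) / ln (real n) < 5" by (intro order_tendstoD) auto
  moreover have "\<forall>\<^sub>F n in sequentially. omega n < 1" using omega_tendsto_0 by (intro order_tendstoD) auto
  ultimately show ?thesis using eventually_ge_at_top[of 2]
  proof eventually_elim
    case (elim n)
    have w: "omega n > 0" using omega_pos elim by simp
    have m: "mesh n > 0" using mesh_pos elim by simp
    have n1: "real n \<ge> 1" using elim by simp
    have xn: "x n \<in> {0..1}" using x_def k_range elim by (auto simp: divide_le_eq less_imp_le)
    have F: "\<bar>cell_avg f n i\<bar> \<le> B" if "i < n" for i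
    proof -
      have "\<bar>cell_avg f n i - 0\<bar> \<le> B"
      proof (rule cell_avg_close)
        show "continuous_on {real i / real n..(real i + 1) / real n} f" by (rule continuous_on_subset[OF f_cont cell_subset[OF that]])
        fix t assume "real i / real n \<le> t" "t \<le> (real i + 1) / real n"
        then have "t \<in> {0..1}" using cell_subset[OF that] by (meson atLeastAtMost_iff subsetD)
        then show "\<bar>f t - 0\<bar> \<le> B" using B(2) by simp
      qed (use elim in simp)
      then show ?thesis by simp
    qed
    have U: "\<bar>u n (real i / real n)\<bar> \<le> 2 * B * real n" if i: "i < n" for i
    proof -
      define U where "U i = u n (real i / real n)" for i
      have "disc_energy \<beta> (cell_avg f n) n U \<le> disc_energy \<beta> (cell_avg f n) n (\<lambda>_. 0)"
        unfolding U_def using elim u_min f_cont by (intro minimizer_disc_energy) auto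
      moreover have "disc_energy \<beta> (cell_avg f n) n (\<lambda>_. 0) \<le> \<beta> * (real n * B^2)"
      proof -
        have "(\<Sum>i<n. (0 - cell_avg f n i)^2) \<le> (\<Sum>i<n. B^2)"
        proof (rule sum_mono)
          fix i assume "i \<in> {..<n}"
          then have "\<bar>cell_avg f n i\<bar> \<le> B" using F by simp
          then show "(0 - cell_avg f n i)^2 \<le> B^2" using B by (simp add: abs_le_square_iff[symmetric])
        qed
        then show ?thesis unfolding disc_energy_def using beta_pos by simp
      qed
      moreover have "\<beta> * (U i - cell_avg f n i)^2 \<le> disc_energy \<beta> (cell_avg f n) n U"
      proof -
        have "(U i - cell_avg f n i)^2 \<le> (\<Sum>i<n. (U i - cell_avg f n i)^2)" using i by (intro member_le_sum) auto
        then have "\<beta> * (U i - cell_avg f n i)^2 \<le> \<beta> * (\<Sum>i<n. (U i - cell_avg f n i)^2)" using beta_pos by simp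
        moreover have "(\<Sum>i<n - 1. ln (1 + (real n * (U (Suc i) - U i))^2)) \<ge> 0" by (intro sum_nonneg) simp
        ultimately show ?thesis unfolding disc_energy_def by linarith
      qed
      ultimately have "\<beta> * (U i - cell_avg f n i)^2 \<le> \<beta> * (real n * B^2)" by linarith
      then have "(U i - cell_avg f n i)^2 \<le> real n * B^2" using beta_pos by simp
      also have "\<dots> \<le> (real n * B)^2"
      proof -
        have "real n * B^2 * 1 \<le> real n * B^2 * real n" using n1 by (intro mult_left_mono) auto
        then show ?thesis by (simp add: power2_eq_square mult_ac)
      qed
      finally have "\<bar>U i - cell_avg f n i\<bar> \<le> real n * B" using B n1 by (simp add: abs_le_square_iff[symmetric])
      moreover have "B \<le> real n * B" using n1 B by simp
      ultimately show ?thesis using F[OF i] unfolding U_def by (simp add: mult.commute mult.left_commute)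
    qed
    have bd: "\<bar>omega n * p\<bar> \<le> (3 * B + \<bar>C\<bar>) * real n" if p: "\<bar>p\<bar> \<le> C \<or> (\<exists>i<n. p = W n i)" for p
    proof -
      have "1 * B \<le> real n * B" "1 * \<bar>C\<bar> \<le> real n * \<bar>C\<bar>" using n1 B by (intro mult_right_mono; simp)+
      then have nB: "B \<le> B * real n" "\<bar>C\<bar> \<le> \<bar>C\<bar> * real n" by (simp_all add: mult.commute)
      have ex: "(3 * B + \<bar>C\<bar>) * real n = 3 * (B * real n) + \<bar>C\<bar> * real n" by (simp add: algebra_simps)
      from p show ?thesis
      proof
        assume "\<bar>p\<bar> \<le> C"
        then have "omega n * \<bar>p\<bar> \<le> 1 * \<bar>C\<bar>" using elim w by (intro mult_mono) auto
        then have "\<bar>omega n * p\<bar> \<le> \<bar>C\<bar>" using w by (simp add: abs_mult)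
        then show ?thesis using nB B ex by linarith
      next
        assume "\<exists>i<n. p = W n i"
        then obtain i where i: "i < n" "p = W n i" by blast
        then have "omega n * p = u n (real i / real n) - f (x n)" using w by (simp add: W_def)
        moreover have "\<bar>u n (real i / real n)\<bar> \<le> 2 * (B * real n)" using U[OF i(1)] by (simp add: mult.assoc)
        ultimately show ?thesis using B(2)[OF xn] nB ex by linarith
      qed
    qed
    show ?case
    proof (intro allI impI)
      fix p q assume pq: "\<bar>p\<bar> \<le> C \<or> (\<exists>i<n. p = W n i)" "\<bar>q\<bar> \<le> C \<or> (\<exists>i<n. q = W n i)"
      have "\<bar>omega n * p - omega n * q\<bar> \<le> K * real n" using bd[OF pq(1)] bd[OF pq(2)] unfolding K_def by linarith
      then have "real n * \<bar>omega n * p - omega n * q\<bar> \<le> real n * (K * real n)" by (intro mult_left_mono) auto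
      moreover have "(p - q) / mesh n = real n * (omega n * p - omega n * q)" by (simp add: mesh_def algebra_simps)
      ultimately have "\<bar>(p - q) / mesh n\<bar> \<le> K * real n^2" by (simp add: abs_mult power2_eq_square mult.commute mult.left_commute)
      then have "((p - q) / mesh n)^2 \<le> (K * real n^2)^2" by (metis abs_ge_zero power2_abs power_mono)
      moreover have "1 + ((p - q) / mesh n)^2 > 0" by (simp add: add_pos_nonneg)
      ultimately have "ln (1 + ((p - q) / mesh n)^2) \<le> ln (1 + (K * real n^2)^2)"
        by (subst ln_le_cancel_iff) (auto intro: add_pos_nonneg)
      then have "jump_cost n (p - q) \<le> ln (1 + (K * real n^2)^2) / ln (real n)"
        unfolding jump_cost_def using elim by (intro divide_right_mono) auto
      then show "jump_cost n (p - q) \<le> 5" using elim by linarith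
    qed
  qed
qed

lemma blow_up: "blow \<beta> M (4 / 3) 5 mesh jump_threshold jump_cost W G k"
proof
  show "\<forall>\<^sub>F n in sequentially. locmin \<beta> (mesh n) (jump_cost n) (G n) (W n) n"
    using eventually_ge_at_top[of 2]
  proof eventually_elim
    case (elim n)
    have "locmin \<beta> (1 / (real n * omega n)) (\<lambda>d. ln (1 + (d / (1 / (real n * omega n)))^2) / ln (real n))
       (\<lambda>i. (cell_avg f n i - f (x n)) / omega n) (\<lambda>i. (u n (real i / real n) - f (x n)) / omega n) n"
      using elim u_min f_cont omega_pos omega_cube by (intro locmin_rescaled minimizer_disc_energy) auto
    moreover have "jump_cost n = (\<lambda>d. ln (1 + (d / (1 / (real n * omega n)))^2) / ln (real n))"
      by (simp add: fun_eq_iff jump_cost_def mesh_def)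
    ultimately show ?case by (simp add: mesh_def G_def[abs_def] W_def[abs_def])
  qed
  show "\<forall>\<^sub>F n in sequentially. mesh n > 0" using eventually_ge_at_top[of 2] by eventually_elim (rule mesh_pos)
  show "\<forall>\<^sub>F n in sequentially. \<forall>d. 0 \<le> jump_cost n d" using eventually_ge_at_top[of 2] by eventually_elim (simp add: jump_cost_nonneg)
qed (use beta_pos mesh_tendsto_0 room G_approx jump_cost_up jump_cost_low jump_cost_small crude_bound in \<open>auto simp: jump_cost_def[of _ 0]\<close>)

text \<open>Division by zero gives 0 here, and \<open>0 powr (1/3) = 0\<close>. For vanishing slope
  the formulas thus produce the zero staircase, in accordance with the convention in the
  theorem.\<close>

lemma H_zero: "M = 0 \<Longrightarrow> H = 0 \<and> V = 0"
  by (simp add: H_def V_def)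

text \<open>The second claim says that \<open>2 * H\<close> satisfies
  \<open>\<alpha> = 2 * c * lam^3\<close> for \<open>\<alpha> = 4/3\<close>, so that it is the
  optimal plateau length.\<close>

lemma H_pos:
  assumes "M \<noteq> 0" shows "H > 0" "4 / 3 = 2 * (\<beta> * M^2 / 12) * (2 * H)^3"
proof -
  have p: "1 / (\<beta> * \<bar>M\<bar>^2) > 0" using assms beta_pos by simp
  then show "H > 0" unfolding H_def by (subst powr_gt_zero) auto
  have "H^3 = 1 / (\<beta> * \<bar>M\<bar>^2)"
  proof -
    have "((1 / (\<beta> * \<bar>M\<bar>^2)) powr (1/3))^3 = ((1 / (\<beta> * \<bar>M\<bar>^2)) powr (1/3)) powr real 3"
      using assms beta_pos by (intro powr_realpow[symmetric]) simp
    also have "\<dots> = (1 / (\<beta> * \<bar>M\<bar>^2)) powr 1" by (simp only: powr_powr) simp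
    also have "\<dots> = 1 / (\<beta> * \<bar>M\<bar>^2)" using p by simp
    finally show ?thesis unfolding H_def .
  qed
  then show "4 / 3 = 2 * (\<beta> * M^2 / 12) * (2 * H)^3" using assms beta_pos by (simp add: power_mult_distrib zero_less_mult_iff)
qed

lemma H_nonneg: "H \<ge> 0" by (simp add: H_def)

lemma shadowing:
  assumes "\<eta> > 0"
  shows "\<forall>\<^sub>F n in sequentially. \<exists>\<tau>\<in>{-1..1}. shadows (y n) (W n) (obl H V \<tau>) R \<eta>"
proof (cases "M = 0")
  case True
  have "obl H V 0 = (\<lambda>_. 0)" using H_zero[OF True] by (simp add: obl_def staircase_HV_def fun_eq_iff)
  then show ?thesis using blow.key_zero[OF blow_up True assms, of R]
    by (auto elim!: eventually_mono intro!: bexI[of _ 0])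
next
  case False
  have "\<forall>\<^sub>F n in sequentially. \<exists>\<tau>\<in>{-1..1}. shadows (y n) (W n) (obl H (M * H) \<tau>) R \<eta>"
    by (rule blow.key_nonzero[OF blow_up False H_pos(1)[OF False] _ assms])
       (use H_pos(2)[OF False] in \<open>simp add: blow.c_def[OF blow_up]\<close>)
  then show ?thesis by (simp add: V_def)
qed

end

section \<open>Strict convergence of step functions\<close>

lemma sum_by_parts:
  fixes A \<Phi> :: "nat \<Rightarrow> real"
  assumes "m \<le> n"
  shows "(\<Sum>i\<in>{m..<Suc n}. A i * (\<Phi> (Suc i) - \<Phi> i)) = A n * \<Phi> (Suc n) - A m * \<Phi> m - (\<Sum>i\<in>{m..<n}. (A (Suc i) - A i) * \<Phi> (Suc i))"
  using assms by (induction n rule: dec_induct) (auto simp: algebra_simps)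

text \<open>Cell values as a function of the rescaled variable. The offset \<open>p\<close> counts
  cells and is real, because shifted centres need not be grid points.\<close>

definition grid_fun :: "(nat \<Rightarrow> real) \<Rightarrow> real \<Rightarrow> real \<Rightarrow> real \<Rightarrow> real" where
  "grid_fun A p \<delta> t = A (nat \<lfloor>p + t / \<delta>\<rfloor>)"

text \<open>The increments between the cell containing \<open>a\<close> and the cell containing
  \<open>b\<close>: the total variation on the interval up to a jump located exactly at an
  endpoint.\<close>

definition grid_var :: "(nat \<Rightarrow> real) \<Rightarrow> real \<Rightarrow> real \<Rightarrow> real \<Rightarrow> real \<Rightarrow> real" where
  "grid_var A p \<delta> a b = (\<Sum>i\<in>{nat \<lfloor>p + a / \<delta>\<rfloor>..<nat \<lfloor>p + b / \<delta>\<rfloor>}. \<bar>A (Suc i) - A i\<bar>)"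

section \<open>Step functions against compactly supported test functions\<close>

lemma test_fns_deriv_outside:
  assumes "(\<phi>, \<phi>') \<in> test_fns a b" "t \<le> a \<or> b \<le> t"
  shows "\<phi>' t = 0" "\<phi> t = 0"
proof -
  obtain c d where cd: "a < c" "d < b" "\<forall>t. t < c \<or> d < t \<longrightarrow> \<phi> t = 0" and der: "(\<phi> has_real_derivative \<phi>' t) (at t)"
    using assms(1) unfolding test_fns_def by blast
  have "t \<in> {..<c} \<union> {d<..}" "open ({..<c} \<union> {d<..})" using assms(2) cd by auto
  then have "(\<phi> has_real_derivative 0) (at t)"
    using has_field_derivative_transform_within_open[of "\<lambda>_. 0" 0 t "{..<c} \<union> {d<..}" \<phi>] cd by auto
  then show "\<phi>' t = 0" using der by (rule DERIV_unique[symmetric])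
  show "\<phi> t = 0" using cd assms(2) by auto
qed

text \<open>Summation by parts: the derivative integrates to differences of \<phi> at the grid
  points, and the boundary terms vanish as the outermost grid points lie outside the open interval.
  The condition on \<open>p\<close> keeps the cell index at \<open>a\<close> from being
  truncated.\<close>

lemma grid_fun_test_integral:
  assumes \<phi>: "(\<phi>, \<phi>') \<in> test_fns a b" and ab: "a < b" and \<delta>: "\<delta> > 0" and p: "p + a / \<delta> \<ge> 0"
  obtains I where "((\<lambda>t. grid_fun A p \<delta> t * \<phi>' t) has_integral I) {a..b}" "\<bar>I\<bar> \<le> grid_var A p \<delta> a b"
proof -
  define z where "z i = (real i - p) * \<delta>" for i
  define ia where "ia = nat \<lfloor>p + a / \<delta>\<rfloor>"
  define ib where "ib = nat \<lfloor>p + b / \<delta>\<rfloor>"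
  have "p + a / \<delta> \<le> p + b / \<delta>" using ab \<delta> by (simp add: divide_right_mono)
  then have iab: "ia \<le> ib" unfolding ia_def ib_def by (intro nat_mono floor_mono)
  have der: "\<And>t. (\<phi> has_real_derivative \<phi>' t) (at t)" and \<phi>1: "\<And>t. \<bar>\<phi> t\<bar> \<le> 1" using \<phi> by (auto simp: test_fns_def)
  have zS: "z i \<le> z (Suc i)" for i using \<delta> by (simp add: z_def mult_right_mono)
  have za: "z ia \<le> a"
  proof -
    have "real ia \<le> p + a / \<delta>" using p unfolding ia_def by linarith
    then show ?thesis using \<delta> by (simp add: z_def field_simps)
  qed
  have zb: "b \<le> z (Suc ib)"
  proof -
    have "p + b / \<delta> \<le> real (Suc ib)" unfolding ib_def by linarith
    then show ?thesis using \<delta> by (simp add: z_def field_simps)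
  qed
  define h where "h t = grid_fun A p \<delta> t * \<phi>' t" for t
  have "(h has_integral (\<Sum>i\<in>{ia..<Suc ib}. A i * (\<phi> (z (Suc i)) - \<phi> (z i)))) {z ia..z (Suc ib)}"
  proof (rule has_integral_chain)
    fix i assume "ia \<le> i"
    have "((\<lambda>t. A i * \<phi>' t) has_integral A i * (\<phi> (z (Suc i)) - \<phi> (z i))) {z i..z (Suc i)}"
      using der zS by (intro has_integral_mult_right fundamental_theorem_of_calculus)
        (auto simp: has_real_derivative_iff_has_vector_derivative[symmetric] intro: DERIV_subset)
    then show "(h has_integral A i * (\<phi> (z (Suc i)) - \<phi> (z i))) {z i..z (Suc i)}"
    proof (rule has_integral_except_right)
      fix t assume t: "z i \<le> t" "t < z (Suc i)"
      have "real i \<le> p + t / \<delta>" "p + t / \<delta> < real i + 1" using t \<delta> by (auto simp: z_def field_simps)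
      then have "nat \<lfloor>p + t / \<delta>\<rfloor> = i" by linarith
      then show "h t = A i * \<phi>' t" by (simp add: h_def grid_fun_def)
    qed
  qed (use iab zS in auto)
  \<comment> \<open>The interval can be enlarged to whole cells without changing the integral,
    because \<phi>' vanishes outside.\<close>
  moreover have "(h has_integral I) {a..b} \<longleftrightarrow> (h has_integral I) {z ia..z (Suc ib)}" for I
  proof -
    have "((\<lambda>t. if t \<in> {a..b} then h t else 0) has_integral I) {z ia..z (Suc ib)} \<longleftrightarrow> (h has_integral I) {a..b}"
      using za zb by (intro has_integral_restrict) auto
    moreover have "(\<lambda>t. if t \<in> {a..b} then h t else 0) = h"
      using test_fns_deriv_outside(1)[OF \<phi>] by (auto simp: h_def fun_eq_iff)
    ultimately show ?thesis by simp
  qed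
  ultimately have "(h has_integral (\<Sum>i\<in>{ia..<Suc ib}. A i * (\<phi> (z (Suc i)) - \<phi> (z i)))) {a..b}" by blast
  moreover have "(\<Sum>i\<in>{ia..<Suc ib}. A i * (\<phi> (z (Suc i)) - \<phi> (z i))) = - (\<Sum>i\<in>{ia..<ib}. (A (Suc i) - A i) * \<phi> (z (Suc i)))"
    using sum_by_parts[OF iab, of A "\<lambda>i. \<phi> (z i)"] test_fns_deriv_outside(2)[OF \<phi>] za zb by simp
  moreover have "\<bar>- (\<Sum>i\<in>{ia..<ib}. (A (Suc i) - A i) * \<phi> (z (Suc i)))\<bar> \<le> grid_var A p \<delta> a b"
  proof -
    have "\<bar>(\<Sum>i\<in>{ia..<ib}. (A (Suc i) - A i) * \<phi> (z (Suc i)))\<bar> \<le> (\<Sum>i\<in>{ia..<ib}. \<bar>(A (Suc i) - A i) * \<phi> (z (Suc i))\<bar>)" by (rule sum_abs)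
    also have "\<dots> \<le> (\<Sum>i\<in>{ia..<ib}. \<bar>A (Suc i) - A i\<bar>)"
      unfolding abs_mult using \<phi>1 by (intro sum_mono mult_left_le) auto
    finally show ?thesis by (simp add: grid_var_def ia_def ib_def)
  qed
  ultimately show thesis using that unfolding h_def by metis
qed

text \<open>Integral of the tent function of mass 1 on \<open>[0, 1]\<close>: a piecewise quadratic
  step of class \<open>C^1\<close>, which is all the regularity that \<open>test_fns\<close> asks
  for.\<close>

definition smooth_step :: "real \<Rightarrow> real" where
  "smooth_step t = 2 * (max 0 t)^2 - 4 * (max 0 (t - 1/2))^2 + 2 * (max 0 (t - 1))^2"

definition smooth_step' :: "real \<Rightarrow> real" where
  "smooth_step' t = 4 * max 0 t - 8 * max 0 (t - 1/2) + 4 * max 0 (t - 1)"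

lemma has_derivative_max_0_square: "((\<lambda>t::real. (max 0 t)^2) has_real_derivative 2 * max 0 t) (at t)"
proof -
  consider "t < 0" | "t > 0" | "t = 0" by linarith
  then show ?thesis
  proof cases
    case 1
    have "((\<lambda>t::real. 0) has_real_derivative 2 * max 0 t) (at t)" using 1 by simp
    then show ?thesis by (rule has_field_derivative_transform_within_open[of _ _ _ "{..<0}"]) (use 1 in auto)
  next
    case 2
    have "((\<lambda>t::real. t^2) has_real_derivative 2 * max 0 t) (at t)" using 2 by (auto intro!: derivative_eq_intros)
    then show ?thesis by (rule has_field_derivative_transform_within_open[of _ _ _ "{0<..}"]) (use 2 in auto)
  next
    case 3
    have "((\<lambda>h::real. (max 0 h)^2 / h) \<longlongrightarrow> 0) (at 0)"
    proof (rule tendsto_rabs_zero_cancel, rule tendsto_sandwich[of "\<lambda>_. 0" _ _ "\<lambda>h. \<bar>h\<bar>"])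
      have "\<bar>(max 0 h)^2 / h\<bar> \<le> \<bar>h\<bar>" for h :: real by (cases "h > 0") (auto simp: power2_eq_square max_def)
      then show "\<forall>\<^sub>F h::real in at 0. \<bar>(max 0 h)^2 / h\<bar> \<le> \<bar>h\<bar>" by (intro always_eventually allI)
      show "((\<lambda>h::real. \<bar>h\<bar>) \<longlongrightarrow> 0) (at 0)" by (rule tendsto_rabs_zero) (rule tendsto_ident_at)
    qed auto
    then show ?thesis using 3 by (simp add: DERIV_def)
  qed
qed

lemma smooth_step_deriv: "(smooth_step has_real_derivative smooth_step' t) (at t)"
proof -
  have sh: "((\<lambda>t. (max 0 (t - c))^2) has_real_derivative 2 * max 0 (t - c)) (at t)" for c :: real
  proof -
    have "((\<lambda>t. t - c) has_real_derivative 1) (at t)" by (auto intro!: derivative_eq_intros)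
    from DERIV_chain2[OF has_derivative_max_0_square this] show ?thesis by simp
  qed
  have "((\<lambda>t. 2 * (max 0 t)^2 - 4 * (max 0 (t - 1/2))^2 + 2 * (max 0 (t - 1))^2) has_real_derivative
      2 * (2 * max 0 t) - 4 * (2 * max 0 (t - 1/2)) + 2 * (2 * max 0 (t - 1))) (at t)"
    by (intro DERIV_add DERIV_diff DERIV_cmult has_derivative_max_0_square sh)
  then show ?thesis by (simp add: smooth_step_def[abs_def] smooth_step'_def)
qed

lemma smooth_step_values:
  "t \<le> 0 \<Longrightarrow> smooth_step t = 0" "t \<ge> 1 \<Longrightarrow> smooth_step t = 1" "0 \<le> smooth_step t" "smooth_step t \<le> 1"
proof -
  have hi: "smooth_step t = 1" if "t \<ge> 1" for t using that by (simp add: smooth_step_def max_def power2_eq_square algebra_simps)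
  have lo: "smooth_step t = 0" if "t \<le> 0" for t using that by (simp add: smooth_step_def max_def)
  show "t \<le> 0 \<Longrightarrow> smooth_step t = 0" "t \<ge> 1 \<Longrightarrow> smooth_step t = 1" using hi lo by auto
  have "0 \<le> smooth_step t \<and> smooth_step t \<le> 1"
  proof -
    consider "t \<le> 0" | "0 \<le> t" "t \<le> 1/2" | "1/2 \<le> t" "t \<le> 1" | "1 \<le> t" by linarith
    then show ?thesis
    proof cases
      case 2
      then have "smooth_step t = 2 * t^2" by (simp add: smooth_step_def max_def)
      moreover have "t^2 \<le> (1/2)^2" using 2 by (intro power_mono) auto
      ultimately show ?thesis by (simp add: power2_eq_square)
    next
      case 3
      then have "smooth_step t = 1 - 2 * (1 - t)^2" by (simp add: smooth_step_def max_def power2_eq_square algebra_simps)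
      moreover have "(1 - t)^2 \<le> (1/2)^2" using 3 by (intro power_mono) auto
      ultimately show ?thesis by (simp add: power2_eq_square)
    qed (use hi lo in auto)
  qed
  then show "0 \<le> smooth_step t" "smooth_step t \<le> 1" by auto
qed

lemma smooth_step'_outside: "t \<le> 0 \<or> 1 \<le> t \<Longrightarrow> smooth_step' t = 0"
  by (auto simp: smooth_step'_def max_def)

text \<open>The derivative of the test function lives where \<open>w\<close> is constant near the
  two ends, so the integral sees only \<open>w a\<close> and \<open>w b\<close>. With
  \<open>s\<close> the sign of the difference, a single test function yields
  \<open>\<bar>w b - w a\<bar>\<close>.\<close>

lemma test_integral_of_endpoint_difference:
  fixes w :: "real \<Rightarrow> real"
  assumes e: "e > 0" "a + 4 * e \<le> b" and s: "\<bar>s\<bar> \<le> 1"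
    and wa: "\<And>t. a \<le> t \<Longrightarrow> t \<le> a + 2 * e \<Longrightarrow> w t = w a" and wb: "\<And>t. b - 2 * e \<le> t \<Longrightarrow> t \<le> b \<Longrightarrow> w t = w b"
  obtains \<phi> \<phi>' where "(\<phi>, \<phi>') \<in> test_fns a b" "((\<lambda>t. w t * \<phi>' t) has_integral s * (w b - w a)) {a..b}"
proof -
  define up where "up q t = smooth_step ((t - q) / e)" for q t
  define up' where "up' q t = smooth_step' ((t - q) / e) / e" for q t
  have der: "(up q has_real_derivative up' q t) (at t)" for q t
  proof -
    have "((\<lambda>t. (t - q) / e) has_real_derivative 1 / e) (at t)" using e by (auto intro!: derivative_eq_intros)
    from DERIV_chain2[OF smooth_step_deriv this] show ?thesis by (simp add: up_def[abs_def] up'_def)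
  qed
  have int: "(up' q has_integral 1) {a..b}" if "a \<le> q" "q + e \<le> b" for q
  proof -
    have "(up' q has_integral up q b - up q a) {a..b}"
      using der that e by (intro fundamental_theorem_of_calculus)
        (auto simp: has_real_derivative_iff_has_vector_derivative[symmetric] intro: DERIV_subset)
    moreover have "up q b = 1" "up q a = 0"
      unfolding up_def using that e by (auto intro!: smooth_step_values simp: divide_le_0_iff)
    ultimately show ?thesis by simp
  qed
  have cont: "continuous_on UNIV (up' q)" for q
    unfolding up'_def smooth_step'_def using e by (intro continuous_intros) auto
  \<comment> \<open>A bump that rises on \<open>[a + e, a + 2 * e]\<close> and falls on
    \<open>[b - 2 * e, b - e]\<close>, times \<open>- s\<close>.\<close>
  define \<phi> where "\<phi> t = - s * (up (a + e) t - up (b - 2 * e) t)" for t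
  define \<phi>' where "\<phi>' t = - s * (up' (a + e) t - up' (b - 2 * e) t)" for t
  have "(\<phi>, \<phi>') \<in> test_fns a b"
    unfolding test_fns_def mem_Collect_eq prod.case
  proof (intro conjI allI)
    show "(\<phi> has_real_derivative \<phi>' t) (at t)" for t
      unfolding \<phi>_def[abs_def] \<phi>'_def by (intro DERIV_cmult DERIV_diff der)
    show "continuous_on UNIV \<phi>'" unfolding \<phi>'_def[abs_def] by (intro continuous_intros cont)
    have "\<phi> t = 0" if "t < a + e \<or> b - e < t" for t
    proof (cases "t < a + e")
      case True
      then have "up (a + e) t = 0" "up (b - 2 * e) t = 0" unfolding up_def using e by (auto intro!: smooth_step_values simp: divide_le_0_iff)
      then show ?thesis by (simp add: \<phi>_def)
    next
      case False
      then have "up (a + e) t = 1" "up (b - 2 * e) t = 1" unfolding up_def using e that by (auto intro!: smooth_step_values)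
      then show ?thesis by (simp add: \<phi>_def)
    qed
    then show "\<exists>c d. a < c \<and> c \<le> d \<and> d < b \<and> (\<forall>t. t < c \<or> d < t \<longrightarrow> \<phi> t = 0)"
      using e by (intro exI[of _ "a + e"] conjI exI[of _ "b - e"]) auto
    show "\<bar>\<phi> t\<bar> \<le> 1" for t
    proof -
      have "\<bar>up (a + e) t - up (b - 2 * e) t\<bar> \<le> 1"
        unfolding up_def using smooth_step_values(3,4)[of "(t - (a + e)) / e"] smooth_step_values(3,4)[of "(t - (b - 2 * e)) / e"] by linarith
      then show ?thesis using s by (simp add: \<phi>_def abs_mult mult_le_one)
    qed
  qed
  moreover have "((\<lambda>t. w t * \<phi>' t) has_integral s * (w b - w a)) {a..b}"
  proof -
    have "((\<lambda>t. (- s * w a) * up' (a + e) t + (s * w b) * up' (b - 2 * e) t) has_integral (- s * w a) * 1 + (s * w b) * 1) {a..b}"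
      using e by (intro has_integral_add has_integral_mult_right int) auto
    moreover have "(- s * w a) * up' (a + e) t + (s * w b) * up' (b - 2 * e) t = w t * \<phi>' t" if t: "t \<in> {a..b}" for t
    proof -
      have "w t * up' (a + e) t = w a * up' (a + e) t"
      proof (cases "t \<le> a + 2 * e")
        case False
        then have "e \<le> t - (a + e)" by linarith
        then have "(t - (a + e)) / e \<le> 0 \<or> 1 \<le> (t - (a + e)) / e" using e(1) by (intro disjI2) (subst le_divide_eq_1_pos)
        from smooth_step'_outside[OF this] show ?thesis unfolding up'_def by (simp only: div_0 mult_zero_right)
      next
        case True
        then have "w t = w a" using t by (intro wa) auto
        then show ?thesis by simp
      qed
      moreover have "w t * up' (b - 2 * e) t = w b * up' (b - 2 * e) t"
      proof (cases "b - 2 * e \<le> t")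
        case False
        then have "t - (b - 2 * e) \<le> 0" by linarith
        then have "(t - (b - 2 * e)) / e \<le> 0 \<or> 1 \<le> (t - (b - 2 * e)) / e" using e(1) by (intro disjI1) (rule divide_nonpos_pos)
        from smooth_step'_outside[OF this] show ?thesis unfolding up'_def by (simp only: div_0 mult_zero_right)
      next
        case True
        then have "w t = w b" using t by (intro wb) auto
        then show ?thesis by simp
      qed
      moreover have "w t * \<phi>' t = - s * (w t * up' (a + e) t) + s * (w t * up' (b - 2 * e) t)"
        unfolding \<phi>'_def by (simp add: algebra_simps)
      ultimately show ?thesis by (metis mult.assoc)
    qed
    ultimately have "((\<lambda>t. w t * \<phi>' t) has_integral (- s * w a) * 1 + (s * w b) * 1) {a..b}"
      by (rule has_integral_eq[rotated])
    then show ?thesis by (simp add: right_diff_distrib)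
  qed
  ultimately show thesis by (rule that)
qed

text \<open>Stronger than continuity: at such a point a small displacement of the argument does not
  change the value at all, so closeness of graphs gives closeness of values.\<close>

definition loc_const_at :: "(real \<Rightarrow> real) \<Rightarrow> real \<Rightarrow> bool" where
  "loc_const_at w t \<longleftrightarrow> (\<exists>e>0. \<forall>z. \<bar>z - t\<bar> < e \<longrightarrow> w z = w t)"

lemma ereal_tendsto_squeeze:
  fixes X :: "nat \<Rightarrow> ereal"
  assumes "\<And>\<eta>. \<eta> > 0 \<Longrightarrow> \<forall>\<^sub>F n in sequentially. ereal (c - \<eta>) \<le> X n \<and> X n \<le> ereal (c + \<eta>)"
  shows "X \<longlonglongrightarrow> ereal c"
proof (rule order_tendstoI)
  fix l assume "l < ereal c"
  then obtain r where r: "l < ereal r" "r < c" using ereal_dense2 by (metis less_ereal.simps(1))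
  have "\<forall>\<^sub>F n in sequentially. ereal (c - (c - r)) \<le> X n \<and> X n \<le> ereal (c + (c - r))" using r by (intro assms) simp
  then show "\<forall>\<^sub>F n in sequentially. l < X n" by eventually_elim (use r in auto)
next
  fix l assume "ereal c < l"
  then obtain r where r: "ereal r < l" "c < r" using ereal_dense2 by (metis less_ereal.simps(1))
  have "\<forall>\<^sub>F n in sequentially. ereal (c - (r - c)) \<le> X n \<and> X n \<le> ereal (c + (r - c))" using r by (intro assms) simp
  then show "\<forall>\<^sub>F n in sequentially. X n < l" by eventually_elim (use r in auto)
qed

text \<open>Graph closeness gives pointwise convergence wherever \<open>w\<close> is locally
  constant, hence almost everywhere; dominated convergence then gives convergence in
  \<open>L^1\<close> and of every test integral. For the variation, \<open>var\<close> bounds it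
  above by the difference of the end values, and one test function for \<open>w\<close> gives the
  matching lower bound.\<close>

lemma loc_strict_convI:
  fixes g :: "nat \<Rightarrow> real \<Rightarrow> real" and A :: "nat \<Rightarrow> nat \<Rightarrow> real"
  assumes lo: "filterlim lo at_bot sequentially" and hi: "filterlim hi at_top sequentially"
    and \<delta>: "\<forall>\<^sub>F h in sequentially. \<delta> h > 0"
    and room: "\<And>R. \<forall>\<^sub>F h in sequentially. p h * \<delta> h \<ge> R"
    and g: "\<And>R. \<forall>\<^sub>F h in sequentially. \<forall>t. \<bar>t\<bar> \<le> R \<longrightarrow> g h t = grid_fun (A h) (p h) (\<delta> h) t"
    and close: "\<And>R \<eta>. \<eta> > 0 \<Longrightarrow> \<forall>\<^sub>F h in sequentially. \<forall>t. \<bar>t\<bar> \<le> R \<longrightarrow> (\<exists>z. \<bar>z - t\<bar> \<le> \<eta> \<and> \<bar>g h t - w z\<bar> \<le> \<eta>)"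
    and var: "\<And>R \<eta>. \<eta> > 0 \<Longrightarrow> \<forall>\<^sub>F h in sequentially. \<forall>a b. - R \<le> a \<longrightarrow> a < b \<longrightarrow> b \<le> R \<longrightarrow>
        grid_var (A h) (p h) (\<delta> h) a b \<le> \<bar>g h b - g h a\<bar> + \<eta>"
    and w_meas: "w \<in> borel_measurable borel" and w_bdd: "\<And>R. \<exists>B. \<forall>t. \<bar>t\<bar> \<le> R \<longrightarrow> \<bar>w t\<bar> \<le> B"
    and w_const: "\<And>t. \<not> jump_point w t \<Longrightarrow> loc_const_at w t"
    and w_fin: "\<And>R. finite {t. \<bar>t\<bar> \<le> R \<and> \<not> loc_const_at w t}"
  shows "loc_strict_conv lo hi g w"
  unfolding loc_strict_conv_def
proof (intro conjI lo hi allI impI; elim conjE)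
  fix a b assume ab: "a < b" and nj: "\<not> jump_point w a" "\<not> jump_point w b"
  define R where "R = max \<bar>a\<bar> \<bar>b\<bar>"
  have R: "- R \<le> a" "b \<le> R" "\<And>t. t \<in> {a..b} \<Longrightarrow> \<bar>t\<bar> \<le> R" by (auto simp: R_def)
  obtain B where B: "\<And>t. \<bar>t\<bar> \<le> R + 1 \<Longrightarrow> \<bar>w t\<bar> \<le> B" using w_bdd by metis
  define G where "G h = grid_fun (A h) (p h) (\<delta> h)" for h
  have gG: "\<forall>\<^sub>F h in sequentially. \<forall>t\<in>{a..b}. g h t = G h t"
    using g[of R] by eventually_elim (use R in \<open>auto simp: G_def\<close>)
  have bound: "\<forall>\<^sub>F h in sequentially. \<forall>t\<in>{a..b}. \<bar>G h t\<bar> \<le> B + 1"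
    using gG close[of 1 R, OF zero_less_one]
  proof eventually_elim
    case (elim h)
    show ?case
    proof
      fix t assume t: "t \<in> {a..b}"
      then obtain z where z: "\<bar>z - t\<bar> \<le> 1" "\<bar>g h t - w z\<bar> \<le> 1" using elim(2) R(3) by blast
      have "\<bar>w z\<bar> \<le> B" using z R(3)[OF t] by (intro B) linarith
      then show "\<bar>G h t\<bar> \<le> B + 1" using z elim(1) t by force
    qed
  qed
  have conv: "(\<lambda>h. G h t) \<longlonglongrightarrow> w t" if t: "t \<in> {a..b}" "loc_const_at w t" for t
  proof (rule tendstoI)
    fix \<eta> :: real assume \<eta>: "\<eta> > 0"
    obtain e where e: "e > 0" "\<And>z. \<bar>z - t\<bar> < e \<Longrightarrow> w z = w t" using t(2) unfolding loc_const_at_def by blast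
    define \<eta>' where "\<eta>' = min e \<eta> / 2"
    have \<eta>': "\<eta>' > 0" "\<eta>' < e" "\<eta>' < \<eta>" using e \<eta> by (auto simp: \<eta>'_def min_def)
    show "\<forall>\<^sub>F h in sequentially. dist (G h t) (w t) < \<eta>"
      using gG close[OF \<eta>'(1), of R]
    proof eventually_elim
      case (elim h)
      obtain z where z: "\<bar>z - t\<bar> \<le> \<eta>'" "\<bar>g h t - w z\<bar> \<le> \<eta>'" using elim(2) R(3)[OF t(1)] by blast
      moreover have "w z = w t" using z \<eta>' by (intro e) linarith
      ultimately show ?case using elim(1) t(1) \<eta>' by (auto simp: dist_real_def)
    qed
  qed
  define J where "J = {t. \<bar>t\<bar> \<le> R \<and> \<not> loc_const_at w t}"
  have J: "finite J" "\<And>t. t \<in> {a..b} \<Longrightarrow> t \<notin> J \<Longrightarrow> loc_const_at w t" using w_fin R by (auto simp: J_def)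
  have Gmeas: "G h \<in> borel_measurable borel" for h
  proof -
    have "(\<lambda>t. nat \<lfloor>p h + t / \<delta> h\<rfloor>) \<in> measurable borel (count_space UNIV)" by measurable
    then show ?thesis unfolding G_def grid_fun_def[abs_def] by (rule measurable_compose) simp
  qed
  show "(\<lambda>h. \<integral>\<^sup>+ t\<in>{a<..<b}. ennreal \<bar>g h t - w t\<bar> \<partial>lborel) \<longlonglongrightarrow> 0"
  proof -
    \<comment> \<open>The bounds hold only from some index on, whereas domination is required for
      every index; hence the shift by \<open>h0\<close>.\<close>
    obtain h0 where h0: "\<And>h t. h \<ge> h0 \<Longrightarrow> t \<in> {a..b} \<Longrightarrow> \<bar>G h t\<bar> \<le> B + 1 \<and> g h t = G h t"
      using eventually_conj[OF bound gG] unfolding eventually_sequentially by blast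
    define v where "v h t = ennreal \<bar>G (h + h0) t - w t\<bar> * indicator {a<..<b} t" for h t
    have "(\<lambda>h. \<integral>\<^sup>+ t. v h t \<partial>lborel) \<longlonglongrightarrow> (\<integral>\<^sup>+ t. 0 \<partial>(lborel :: real measure))"
    proof (rule nn_integral_dominated_convergence[where w = "\<lambda>t. ennreal (2 * B + 1) * indicator {a<..<b} t"])
      show "v h \<in> borel_measurable lborel" for h unfolding v_def using Gmeas w_meas by measurable
      show "AE t in lborel. v h t \<le> ennreal (2 * B + 1) * indicator {a<..<b} t" for h
      proof (rule AE_I2)
        fix t
        show "v h t \<le> ennreal (2 * B + 1) * indicator {a<..<b} t"
        proof (cases "t \<in> {a<..<b}")
          case True
          then have "\<bar>G (h + h0) t\<bar> \<le> B + 1" "\<bar>w t\<bar> \<le> B" using h0[of "h + h0" t] R(3)[of t] by (auto intro!: B)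
          then show ?thesis unfolding v_def by (intro mult_right_mono ennreal_leI) auto
        qed (auto simp: v_def)
      qed
      show "(\<integral>\<^sup>+ t. ennreal (2 * B + 1) * indicator {a<..<b} t \<partial>lborel) < \<infinity>"
        using ab by (simp add: nn_integral_cmult ennreal_mult_less_top)
      have "AE t in lborel. t \<notin> J" using J(1) by (intro AE_not_in finite_imp_null_set_lborel)
      then show "AE t in lborel. (\<lambda>h. v h t) \<longlonglongrightarrow> 0"
      proof eventually_elim
        case (elim t)
        show ?case
        proof (cases "t \<in> {a<..<b}")
          case True
          then have "(\<lambda>h. G (h + h0) t) \<longlonglongrightarrow> w t" using J(2)[of t] elim by (intro LIMSEQ_ignore_initial_segment conv) auto
          then have "(\<lambda>h. \<bar>G (h + h0) t - w t\<bar>) \<longlonglongrightarrow> \<bar>w t - w t\<bar>" by (intro tendsto_intros)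
          then have "(\<lambda>h. ennreal \<bar>G (h + h0) t - w t\<bar>) \<longlonglongrightarrow> ennreal 0" by (intro tendsto_ennrealI) simp
          then show ?thesis using True by (simp add: v_def)
        qed (simp add: v_def)
      qed
    qed auto
    moreover have "(\<integral>\<^sup>+ t. v h t \<partial>lborel) = (\<integral>\<^sup>+ t\<in>{a<..<b}. ennreal \<bar>g (h + h0) t - w t\<bar> \<partial>lborel)" for h
    proof (rule nn_integral_cong)
      fix t show "v h t = ennreal \<bar>g (h + h0) t - w t\<bar> * indicator {a<..<b} t"
        using h0[of "h + h0" t] by (auto simp: v_def indicator_def)
    qed
    ultimately have "(\<lambda>h. \<integral>\<^sup>+ t\<in>{a<..<b}. ennreal \<bar>g (h + h0) t - w t\<bar> \<partial>lborel) \<longlonglongrightarrow> 0" by simp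
    then show ?thesis by (rule LIMSEQ_offset)
  qed
  have test: "(\<lambda>h. integral {a..b} (\<lambda>t. g h t * \<phi>' t)) \<longlonglongrightarrow> integral {a..b} (\<lambda>t. w t * \<phi>' t)"
      "\<forall>\<^sub>F h in sequentially. integral {a..b} (\<lambda>t. g h t * \<phi>' t) \<le> grid_var (A h) (p h) (\<delta> h) a b"
    if \<phi>: "(\<phi>, \<phi>') \<in> test_fns a b" for \<phi> \<phi>'
  proof -
    have gI: "\<forall>\<^sub>F h in sequentially. (\<lambda>t. G h t * \<phi>' t) integrable_on {a..b} \<and> integral {a..b} (\<lambda>t. g h t * \<phi>' t) = integral {a..b} (\<lambda>t. G h t * \<phi>' t)
        \<and> integral {a..b} (\<lambda>t. g h t * \<phi>' t) \<le> grid_var (A h) (p h) (\<delta> h) a b"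
      using \<delta> room[of "- a"] gG
    proof eventually_elim
      case (elim h)
      have "p h + a / \<delta> h \<ge> 0" using elim by (simp add: field_simps)
      then obtain I where I: "((\<lambda>t. G h t * \<phi>' t) has_integral I) {a..b}" "\<bar>I\<bar> \<le> grid_var (A h) (p h) (\<delta> h) a b"
        using grid_fun_test_integral[OF \<phi> ab elim(1), of "p h" "A h"] unfolding G_def by metis
      have "integral {a..b} (\<lambda>t. g h t * \<phi>' t) = integral {a..b} (\<lambda>t. G h t * \<phi>' t)" using elim by (intro integral_cong) simp
      then show ?case using I by (auto simp: integral_unique has_integral_integrable)
    qed
    then show "\<forall>\<^sub>F h in sequentially. integral {a..b} (\<lambda>t. g h t * \<phi>' t) \<le> grid_var (A h) (p h) (\<delta> h) a b" by (auto elim: eventually_mono)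
    have "continuous_on {a..b} \<phi>'" using \<phi> unfolding test_fns_def by (auto intro: continuous_on_subset)
    then have "bounded (\<phi>' ` {a..b})" by (intro compact_imp_bounded compact_continuous_image) auto
    then obtain D where D: "\<forall>t\<in>{a..b}. \<bar>\<phi>' t\<bar> \<le> D" unfolding bounded_iff by auto
    obtain h0 where h0: "\<And>h. h \<ge> h0 \<Longrightarrow> (\<forall>t\<in>{a..b}. \<bar>G h t\<bar> \<le> B + 1) \<and> (\<lambda>t. G h t * \<phi>' t) integrable_on {a..b} \<and> integral {a..b} (\<lambda>t. g h t * \<phi>' t) = integral {a..b} (\<lambda>t. G h t * \<phi>' t)"
      using eventually_conj[OF bound gI] unfolding eventually_sequentially by blast
    \<comment> \<open>Dominated convergence is applied in a form that requires convergence at every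
      point. On the finite exceptional set the functions are therefore replaced by the limit, which
      leaves the integrals unchanged.\<close>
    define F where "F h t = (if t \<in> J then w t else G (h + h0) t) * \<phi>' t" for h t
    have spike: "integral {a..b} (F h) = integral {a..b} (\<lambda>t. G (h + h0) t * \<phi>' t)" "F h integrable_on {a..b}" for h
    proof -
      show "integral {a..b} (F h) = integral {a..b} (\<lambda>t. G (h + h0) t * \<phi>' t)"
        by (rule integral_spike[OF negligible_finite[OF J(1)]]) (simp add: F_def)
      show "F h integrable_on {a..b}"
        by (rule integrable_spike_finite[OF J(1), of _ _ "\<lambda>t. G (h + h0) t * \<phi>' t"]) (use h0[of "h + h0"] in \<open>auto simp: F_def\<close>)
    qed
    have "(\<lambda>h. integral {a..b} (F h)) \<longlonglongrightarrow> integral {a..b} (\<lambda>t. w t * \<phi>' t)"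
    proof (rule dominated_convergence(2)[where h = "\<lambda>_. (B + 1) * D"])
      show "norm (F h t) \<le> (B + 1) * D" if "t \<in> {a..b}" for h t
      proof -
        have "\<bar>w t\<bar> \<le> B" using R(3)[OF that] by (intro B) simp
        moreover have "\<bar>G (h + h0) t\<bar> \<le> B + 1" using h0[of "h + h0"] that by simp
        ultimately have "\<bar>if t \<in> J then w t else G (h + h0) t\<bar> \<le> B + 1" by simp
        moreover have "\<bar>\<phi>' t\<bar> \<le> D" using D that by blast
        moreover have "0 \<le> B + 1" using calculation(1) by (meson abs_ge_zero order.trans)
        ultimately show ?thesis unfolding F_def real_norm_def abs_mult by (intro mult_mono) simp_all
      qed
      show "(\<lambda>h. F h t) \<longlonglongrightarrow> w t * \<phi>' t" if "t \<in> {a..b}" for t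
      proof (cases "t \<in> J")
        case False
        then have "(\<lambda>h. G (h + h0) t) \<longlonglongrightarrow> w t" using J(2)[OF that] by (intro LIMSEQ_ignore_initial_segment conv that)
        then show ?thesis using False by (auto simp: F_def intro!: tendsto_mult)
      qed (simp add: F_def)
    qed (use spike in auto)
    then have "(\<lambda>h. integral {a..b} (\<lambda>t. g (h + h0) t * \<phi>' t)) \<longlonglongrightarrow> integral {a..b} (\<lambda>t. w t * \<phi>' t)"
      unfolding spike(1) using h0 by simp
    then show "(\<lambda>h. integral {a..b} (\<lambda>t. g h t * \<phi>' t)) \<longlonglongrightarrow> integral {a..b} (\<lambda>t. w t * \<phi>' t)" by (rule LIMSEQ_offset)
  qed
  define c where "c = \<bar>w b - w a\<bar>"
  have lc: "loc_const_at w a" "loc_const_at w b" using nj w_const by auto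
  have varc: "\<forall>\<^sub>F h in sequentially. grid_var (A h) (p h) (\<delta> h) a b \<le> c + \<eta>" if \<eta>: "\<eta> > 0" for \<eta>
  proof -
    have "(\<lambda>h. \<bar>G h b - G h a\<bar>) \<longlonglongrightarrow> c" unfolding c_def using ab by (intro tendsto_intros conv lc) auto
    then have "\<forall>\<^sub>F h in sequentially. \<bar>G h b - G h a\<bar> < c + \<eta> / 2" using \<eta> by (intro order_tendstoD) auto
    with gG var[OF half_gt_zero[OF \<eta>], of R] show ?thesis
    proof eventually_elim
      case (elim h)
      have "grid_var (A h) (p h) (\<delta> h) a b \<le> \<bar>g h b - g h a\<bar> + \<eta> / 2" by (rule elim(2)[rule_format, OF R(1) ab R(2)])
      moreover have "g h b = G h b" "g h a = G h a" using elim ab by auto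
      ultimately show ?case using elim(3) by linarith
    qed
  qed
  obtain \<phi>0 \<phi>0' where \<phi>0: "(\<phi>0, \<phi>0') \<in> test_fns a b" "((\<lambda>t. w t * \<phi>0' t) has_integral c) {a..b}"
  proof -
    obtain e1 where e1: "e1 > 0" "\<And>z. \<bar>z - a\<bar> < e1 \<Longrightarrow> w z = w a" using lc(1) unfolding loc_const_at_def by blast
    obtain e2 where e2: "e2 > 0" "\<And>z. \<bar>z - b\<bar> < e2 \<Longrightarrow> w z = w b" using lc(2) unfolding loc_const_at_def by blast
    define e where "e = min (min e1 e2) (b - a) / 4"
    have "e > 0" "a + 4 * e \<le> b" "2 * e < e1" "2 * e < e2" using e1 e2 ab by (auto simp: e_def min_def)
    note e = this
    have s: "\<bar>sgn (w b - w a)\<bar> \<le> 1" by (simp add: abs_sgn_eq)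
    have wa: "w t = w a" if "a \<le> t" "t \<le> a + 2 * e" for t using that e by (intro e1(2)) linarith
    have wb: "w t = w b" if "b - 2 * e \<le> t" "t \<le> b" for t using that e by (intro e2(2)) linarith
    obtain \<phi> \<phi>' where \<phi>: "(\<phi>, \<phi>') \<in> test_fns a b" "((\<lambda>t. w t * \<phi>' t) has_integral sgn (w b - w a) * (w b - w a)) {a..b}"
      by (rule test_integral_of_endpoint_difference[OF e(1,2) s wa wb])
    have "sgn (w b - w a) * (w b - w a) = c" unfolding c_def by (simp add: abs_sgn mult.commute)
    then show thesis using that[OF \<phi>(1)] \<phi>(2) by simp
  qed
  \<comment> \<open>The variation of \<open>w\<close> is found through the approximations: each test
    integral of \<open>w\<close> is a limit of integrals bounded by \<open>grid_var\<close>, which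
    is eventually at most \<open>c + \<eta>\<close>.\<close>
  have TVw: "total_var w a b = ereal c"
  proof (rule antisym)
    show "total_var w a b \<le> ereal c"
      unfolding total_var_def
    proof (rule SUP_least)
      fix q assume q: "q \<in> test_fns a b"
      obtain \<phi> \<phi>' where [simp]: "q = (\<phi>, \<phi>')" by (cases q)
      have "integral {a..b} (\<lambda>t. w t * \<phi>' t) \<le> c + \<eta>" if "\<eta> > 0" for \<eta>
      proof (rule tendsto_upperbound[OF test(1)])
        show "(\<phi>, \<phi>') \<in> test_fns a b" using q by simp
        show "\<forall>\<^sub>F h in sequentially. integral {a..b} (\<lambda>t. g h t * \<phi>' t) \<le> c + \<eta>"
        proof -
          have "(\<phi>, \<phi>') \<in> test_fns a b" using q by simp
          from test(2)[OF this] varc[OF that] show ?thesis by eventually_elim (rule order.trans)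
        qed
      qed simp
      then show "ereal (integral {a..b} (\<lambda>t. w t * snd q t)) \<le> ereal c" by (simp add: field_le_epsilon)
    qed
    have "ereal c = ereal (integral {a..b} (\<lambda>t. w t * snd (\<phi>0, \<phi>0') t))" using \<phi>0(2) by (simp add: integral_unique)
    also have "\<dots> \<le> total_var w a b" unfolding total_var_def by (rule SUP_upper[OF \<phi>0(1)])
    finally show "ereal c \<le> total_var w a b" .
  qed
  show "(\<lambda>h. total_var (g h) a b) \<longlonglongrightarrow> total_var w a b"
    unfolding TVw
  proof (rule ereal_tendsto_squeeze)
    fix \<eta> :: real assume \<eta>: "\<eta> > 0"
    have "(\<lambda>h. integral {a..b} (\<lambda>t. g h t * \<phi>0' t)) \<longlonglongrightarrow> c" using test(1)[OF \<phi>0(1)] \<phi>0(2) by (simp add: integral_unique)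
    then have "\<forall>\<^sub>F h in sequentially. integral {a..b} (\<lambda>t. g h t * \<phi>0' t) > c - \<eta>" using \<eta> by (intro order_tendstoD) auto
    then show "\<forall>\<^sub>F h in sequentially. ereal (c - \<eta>) \<le> total_var (g h) a b \<and> total_var (g h) a b \<le> ereal (c + \<eta>)"
      using varc[OF \<eta>] \<delta> room[of "- a"] gG
    proof eventually_elim
      case (elim h)
      have "ereal (c - \<eta>) \<le> ereal (integral {a..b} (\<lambda>t. g h t * snd (\<phi>0, \<phi>0') t))" using elim(1) by simp
      also have "\<dots> \<le> total_var (g h) a b" unfolding total_var_def by (rule SUP_upper[OF \<phi>0(1)])
      finally have 1: "ereal (c - \<eta>) \<le> total_var (g h) a b" .
      have "total_var (g h) a b \<le> ereal (grid_var (A h) (p h) (\<delta> h) a b)"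
        unfolding total_var_def
      proof (rule SUP_least)
        fix q assume q: "q \<in> test_fns a b"
        obtain \<phi> \<phi>' where [simp]: "q = (\<phi>, \<phi>')" by (cases q)
        have "p h + a / \<delta> h \<ge> 0" using elim by (simp add: field_simps)
        then obtain I where I: "((\<lambda>t. G h t * \<phi>' t) has_integral I) {a..b}" "\<bar>I\<bar> \<le> grid_var (A h) (p h) (\<delta> h) a b"
          using grid_fun_test_integral[of \<phi> \<phi>' a b "\<delta> h" "p h" "A h"] q ab elim(3) unfolding G_def by auto
        have "integral {a..b} (\<lambda>t. g h t * \<phi>' t) = integral {a..b} (\<lambda>t. G h t * \<phi>' t)" using elim by (intro integral_cong) simp
        then show "ereal (integral {a..b} (\<lambda>t. g h t * snd q t)) \<le> ereal (grid_var (A h) (p h) (\<delta> h) a b)"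
          using I by (simp add: integral_unique)
      qed
      also have "\<dots> \<le> ereal (c + \<eta>)" using elim(2) by simp
      finally show ?case using 1 by simp
    qed
  qed
qed

section \<open>Translations of the staircase\<close>

lemma staircase_shift: "staircase (x + 2 * real_of_int m) = staircase x + 2 * real_of_int m"
proof -
  have "(x + 2 * real_of_int m + 1) / 2 = (x + 1) / 2 + real_of_int m" by (simp add: add_divide_distrib)
  then show ?thesis unfolding staircase_def by (simp only: floor_add_int[symmetric] of_int_add distrib_left)
qed

lemma staircase_bound: "\<bar>staircase x\<bar> \<le> \<bar>x\<bar> + 1"
proof -
  have "real_of_int \<lfloor>(x + 1) / 2\<rfloor> \<le> (x + 1) / 2" "(x + 1) / 2 < real_of_int \<lfloor>(x + 1) / 2\<rfloor> + 1" by linarith+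
  then have "2 * real_of_int \<lfloor>(x + 1) / 2\<rfloor> \<le> x + 1" "x - 1 < 2 * real_of_int \<lfloor>(x + 1) / 2\<rfloor>" by (simp_all add: field_simps)
  then show ?thesis unfolding staircase_def by linarith
qed

lemma staircase_HV_on_cell:
  assumes "H > 0" "2 * H * real_of_int m - H \<le> x" "x < 2 * H * real_of_int m + H"
  shows "staircase_HV H V x = V * (2 * real_of_int m)"
  using assms by (intro staircase_HV_plateau) auto

lemma staircase_const_interior:
  assumes H: "H > 0" and m: "2 * H * real_of_int m - H < t - s" "t - s < 2 * H * real_of_int m + H"
  shows "loc_const_at (\<lambda>t. staircase_HV H V (t - s) + c) t"
proof -
  define e where "e = min (t - s - (2 * H * real_of_int m - H)) (2 * H * real_of_int m + H - (t - s))"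
  have "e > 0" using m by (simp add: e_def)
  moreover have "staircase_HV H V (z - s) + c = V * (2 * real_of_int m) + c" if "\<bar>z - t\<bar> < e" for z
  proof -
    have "2 * H * real_of_int m - H \<le> z - s" "z - s < 2 * H * real_of_int m + H" using that unfolding e_def by linarith+
    then show ?thesis using staircase_HV_on_cell[OF H] by simp
  qed
  ultimately show ?thesis unfolding loc_const_at_def by (metis abs_zero diff_self)
qed

text \<open>Outside the left ends of plateaus the function is locally constant, and at such an end
  the one-sided limits differ by \<open>2 * V\<close>. For \<open>V \<noteq> 0\<close> these ends
  are thus genuine jump points.\<close>

lemma staircase_loc_const:
  assumes H: "H > 0" and j: "\<not> jump_point (\<lambda>t. staircase_HV H V (t - s) + c) t"
  shows "loc_const_at (\<lambda>t. staircase_HV H V (t - s) + c) t"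
proof (cases "V = 0")
  case True
  then show ?thesis unfolding loc_const_at_def staircase_HV_def by (intro exI[of _ 1]) auto
next
  case V: False
  define m where "m = \<lfloor>((t - s) / H + 1) / 2\<rfloor>"
  have m: "2 * H * real_of_int m - H \<le> t - s" "t - s < 2 * H * real_of_int m + H"
  proof -
    have "real_of_int m \<le> ((t - s) / H + 1) / 2" "((t - s) / H + 1) / 2 < real_of_int m + 1" unfolding m_def by linarith+
    then show "2 * H * real_of_int m - H \<le> t - s" "t - s < 2 * H * real_of_int m + H" using H by (simp_all add: field_simps)
  qed
  show ?thesis
  proof (cases "2 * H * real_of_int m - H = t - s")
    case True
    define r where "r = V * (2 * real_of_int m) + c"
    define l where "l = V * (2 * real_of_int (m - 1)) + c"
    have "\<forall>\<^sub>F z in at_right t. staircase_HV H V (z - s) + c = r"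
      unfolding eventually_at_right_field
    proof (intro exI[of _ "t + H"] conjI allI impI)
      fix z assume "t < z" "z < t + H"
      then show "staircase_HV H V (z - s) + c = r" unfolding r_def using True H by (subst staircase_HV_on_cell[of H m]) auto
    qed (use H in auto)
    moreover have "\<forall>\<^sub>F z in at_left t. staircase_HV H V (z - s) + c = l"
      unfolding eventually_at_left_field
    proof (intro exI[of _ "t - H"] conjI allI impI)
      fix z assume "t - H < z" "z < t"
      then show "staircase_HV H V (z - s) + c = l" unfolding l_def using True H
        by (subst staircase_HV_on_cell[of H "m - 1"]) (auto simp: algebra_simps)
    qed (use H in auto)
    moreover have "l \<noteq> r" using V by (simp add: l_def r_def)
    ultimately have "jump_point (\<lambda>t. staircase_HV H V (t - s) + c) t"
      unfolding jump_point_def by (intro exI[of _ l] exI[of _ r] conjI tendsto_eventually)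
    then show ?thesis using j by blast
  next
    case False
    then show ?thesis using m by (intro staircase_const_interior[OF H]) auto
  qed
qed

lemma staircase_jumps_finite:
  assumes H: "H > 0"
  shows "finite {t. \<bar>t\<bar> \<le> R \<and> \<not> loc_const_at (\<lambda>t. staircase_HV H V (t - s) + c) t}"
proof -
  define K where "K = (R + \<bar>s\<bar>) / H + 1"
  have "{t. \<bar>t\<bar> \<le> R \<and> \<not> loc_const_at (\<lambda>t. staircase_HV H V (t - s) + c) t} \<subseteq> (\<lambda>m. s + (2 * H * real_of_int m - H)) ` {\<lfloor>- K\<rfloor>..\<lceil>K\<rceil>}"
  proof
    fix t assume "t \<in> {t. \<bar>t\<bar> \<le> R \<and> \<not> loc_const_at (\<lambda>t. staircase_HV H V (t - s) + c) t}"
    then have t: "\<bar>t\<bar> \<le> R" "\<not> loc_const_at (\<lambda>t. staircase_HV H V (t - s) + c) t" by auto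
    define m where "m = \<lfloor>((t - s) / H + 1) / 2\<rfloor>"
    have fl: "real_of_int m \<le> ((t - s) / H + 1) / 2" "((t - s) / H + 1) / 2 < real_of_int m + 1" unfolding m_def by linarith+
    then have m: "2 * H * real_of_int m - H \<le> t - s" "t - s < 2 * H * real_of_int m + H" using H by (simp_all add: field_simps)
    have "2 * H * real_of_int m - H = t - s"
    proof (rule ccontr)
      assume ne: "2 * H * real_of_int m - H \<noteq> t - s"
      then have "loc_const_at (\<lambda>t. staircase_HV H V (t - s) + c) t" using m by (intro staircase_const_interior[OF H]) auto
      then show False using t by blast
    qed
    then have eq: "t = s + (2 * H * real_of_int m - H)" by simp
    have "\<bar>(t - s) / H\<bar> \<le> (R + \<bar>s\<bar>) / H"
    proof -
      have "\<bar>t - s\<bar> \<le> R + \<bar>s\<bar>" using t(1) by linarith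
      then show ?thesis using H by (simp add: abs_divide divide_right_mono)
    qed
    moreover have "2 * real_of_int m \<le> (t - s) / H + 1" "(t - s) / H + 1 < 2 * real_of_int m + 2" using fl by (simp_all add: field_simps)
    ultimately have "- K \<le> real_of_int m" "real_of_int m \<le> K" unfolding K_def by linarith+
    then have "m \<in> {\<lfloor>- K\<rfloor>..\<lceil>K\<rceil>}" by (auto simp: floor_le_iff le_ceiling_iff)
    then show "t \<in> (\<lambda>m. s + (2 * H * real_of_int m - H)) ` {\<lfloor>- K\<rfloor>..\<lceil>K\<rceil>}" using eq by blast
  qed
  then show ?thesis by (rule finite_subset) simp
qed

text \<open>Oblique translation slides the graph in the direction \<open>(H, V)\<close>, so a change
  of parameter is a horizontal and a vertical shift at once.\<close>

lemma obl_change_parameter: "obl H V \<tau>1 z = obl H V \<tau>2 (z + H * (\<tau>2 - \<tau>1)) + V * (\<tau>1 - \<tau>2)"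
  by (simp add: obl_def algebra_simps)

text \<open>A parameter increase of 2 slides the graph by one full step in both directions and maps
  it to itself.\<close>

lemma obl_periodic:
  assumes "H > 0 \<or> V = 0"
  shows "obl H V (\<tau> + 2) = obl H V \<tau>"
proof
  fix z
  show "obl H V (\<tau> + 2) z = obl H V \<tau> z"
  proof (cases "V = 0")
    case False
    then have H: "H > 0" using assms by simp
    have "(z - H * (\<tau> + 2)) / H = (z - H * \<tau>) / H + 2 * real_of_int (-1)" using H by (simp add: field_simps)
    then have "staircase ((z - H * (\<tau> + 2)) / H) = staircase ((z - H * \<tau>) / H) - 2"
      using staircase_shift[of "(z - H * \<tau>) / H" "-1"] by simp
    then show ?thesis unfolding obl_def staircase_HV_def by (simp only: distrib_left right_diff_distrib)
  qed (simp add: obl_def staircase_HV_def)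
qed

lemma shadows_mono:
  assumes "shadows Y W g R \<eta>" "R' \<le> R" "\<eta> \<le> \<eta>'"
  shows "shadows Y W g R' \<eta>'"
  using assms unfolding shadows_def by (meson order_trans add_left_mono)

text \<open>For each \<open>n\<close> the witness of the finest attainable scale is taken. The
  resulting sequence works at all scales, as finer scales imply coarser ones.\<close>

lemma diagonal_choice:
  fixes P :: "nat \<Rightarrow> nat \<Rightarrow> 'a \<Rightarrow> bool"
  assumes ev: "\<And>j. \<forall>\<^sub>F n in sequentially. \<exists>t\<in>T. P j n t"
    and mono: "\<And>i j n t. i \<le> j \<Longrightarrow> P j n t \<Longrightarrow> P i n t" and ne: "T \<noteq> {}"
  obtains t where "\<forall>n. t n \<in> T" "\<forall>j. \<forall>\<^sub>F n in sequentially. P j n (t n)"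
proof -
  \<comment> \<open>The restriction \<open>j \<le> n\<close> makes the set finite, so that a maximal
    scale exists even if all scales are attainable.\<close>
  define J where "J n = {j. j \<le> n \<and> (\<exists>t\<in>T. P j n t)}" for n
  have fin: "finite (J n)" for n by (rule finite_subset[of _ "{..n}"]) (auto simp: J_def)
  have "\<exists>t. t \<in> T \<and> (J n \<noteq> {} \<longrightarrow> P (Max (J n)) n t)" for n
  proof (cases "J n = {}")
    case False
    then have "Max (J n) \<in> J n" using fin by (intro Max_in) auto
    then show ?thesis by (auto simp: J_def)
  qed (use ne in auto)
  then obtain t where t: "\<And>n. t n \<in> T" "\<And>n. J n \<noteq> {} \<Longrightarrow> P (Max (J n)) n (t n)" by metis
  have "\<forall>\<^sub>F n in sequentially. P j n (t n)" for j
    using ev[of j] eventually_ge_at_top[of j]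
  proof eventually_elim
    case (elim n)
    then have j: "j \<in> J n" by (simp add: J_def)
    then have "j \<le> Max (J n)" using fin by simp
    then show ?case using t(2)[of n] j mono by blast
  qed
  then show thesis using that t(1) by blast
qed

lemma eventually_all_scales:
  assumes P: "\<And>j. \<forall>\<^sub>F n in F. P (real j) (1 / real (Suc j)) n"
    and mono: "\<And>R R' \<eta> \<eta>' n. R' \<le> R \<Longrightarrow> \<eta> \<le> \<eta>' \<Longrightarrow> P R \<eta> n \<Longrightarrow> P R' \<eta>' n" and \<eta>: "\<eta> > 0"
  shows "\<forall>\<^sub>F n in F. P R \<eta> n"
proof -
  obtain j where j: "real j \<ge> max R (1 / \<eta>)" using real_arch_simple by blast
  have "1 / \<eta> \<le> real (Suc j)" using j by simp
  then have "1 / real (Suc j) \<le> \<eta>" using \<eta> by (simp add: field_simps)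
  with j show ?thesis using P[of j] by (auto elim!: eventually_mono intro: mono)
qed

section \<open>Convergence of the blow-ups and the four claims\<close>

context staircase_setup begin

lemma V_zero_or_H_pos: "H > 0 \<or> V = 0"
  using H_zero H_pos(1) by blast

lemma PC_u: "n \<ge> 2 \<Longrightarrow> PC n (u n)"
  using u_min by (simp add: PM_minimizer_def)

lemma u_cell:
  assumes n: "n \<ge> 2" and i: "real i \<le> real n * t" "real n * t < real i + 1" "i < n"
  shows "u n t = u n (real i / real n)"
proof -
  have "real i / real n \<le> t" "t < (real i + 1) / real n" using i n by (simp_all add: field_simps)
  then show ?thesis using PC_u[OF n] i(3) unfolding PC_def by blast
qed

lemma rescaled_u:
  assumes n: "n \<ge> 2" and p: "0 \<le> real (k n) + t / mesh n" "real (k n) + t / mesh n < real n"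
  shows "u n (x n + omega n * t) = u n (real (nat \<lfloor>real (k n) + t / mesh n\<rfloor>) / real n)"
proof (rule u_cell[OF n])
  have "real n * (x n + omega n * t) = real (k n) + t / mesh n"
    using n x_def omega_pos[OF n] by (simp add: mesh_def field_simps)
  then show "real (nat \<lfloor>real (k n) + t / mesh n\<rfloor>) \<le> real n * (x n + omega n * t)"
    "real n * (x n + omega n * t) < real (nat \<lfloor>real (k n) + t / mesh n\<rfloor>) + 1" using p by linarith+
  show "nat \<lfloor>real (k n) + t / mesh n\<rfloor> < n" using p by linarith
qed

lemma cell_index_pos:
  assumes n: "n \<ge> 2" and p: "0 \<le> real (k n) + t / mesh n"
  shows "y n (nat \<lfloor>real (k n) + t / mesh n\<rfloor>) \<le> t" "t < y n (nat \<lfloor>real (k n) + t / mesh n\<rfloor>) + mesh n"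
proof -
  have m: "mesh n > 0" using mesh_pos[OF n] .
  have "real (nat \<lfloor>real (k n) + t / mesh n\<rfloor>) - real (k n) \<le> t / mesh n" "t / mesh n < real (nat \<lfloor>real (k n) + t / mesh n\<rfloor>) - real (k n) + 1"
    using p by linarith+
  then show "y n (nat \<lfloor>real (k n) + t / mesh n\<rfloor>) \<le> t" "t < y n (nat \<lfloor>real (k n) + t / mesh n\<rfloor>) + mesh n"
    using m by (auto simp: gpos_def field_simps)
qed

lemma index_in_range:
  "\<forall>\<^sub>F n in sequentially. \<forall>t. \<bar>t\<bar> \<le> R \<longrightarrow> 0 \<le> real (k n) + t / mesh n \<and> real (k n) + t / mesh n < real n"
  using room[of "\<bar>R\<bar> + 1"] eventually_ge_at_top[of 2]
proof eventually_elim
  case (elim n)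
  have m: "mesh n > 0" using mesh_pos elim by simp
  show ?case
  proof (intro allI impI conjI)
    fix t assume t: "\<bar>t\<bar> \<le> R"
    have "- t \<le> real (k n) * mesh n" using t elim(1) by linarith
    then show "0 \<le> real (k n) + t / mesh n" using m by (simp add: field_simps)
    have "t < (real n - real (k n)) * mesh n" using t elim(1) by linarith
    then show "real (k n) + t / mesh n < real n" using m by (simp add: field_simps)
  qed
qed

lemma variation_bound:
  assumes "\<eta> > 0"
  shows "\<forall>\<^sub>F n in sequentially. \<forall>a b. a \<le> b \<longrightarrow> \<bar>y n a\<bar> \<le> R \<longrightarrow> \<bar>y n b\<bar> \<le> R \<longrightarrow>
     (\<Sum>i\<in>{a..<b}. \<bar>W n (Suc i) - W n i\<bar>) \<le> \<bar>W n b - W n a\<bar> + \<eta>"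
  using shadowing[OF assms, of R] by eventually_elim (auto simp: shadows_def)

text \<open>Common to all four claims: \<open>s\<close> is the rescaled shift of the centre,
  \<open>e\<close> the subtracted value (of \<open>f\<close> or of \<open>u\<close>), and
  \<open>N\<close> a subsequence or the identity. Only the graph closeness remains to be checked
  each time; the variation estimate is invariant under these shifts.\<close>

lemma convergence_of_blow_ups:
  fixes N :: "nat \<Rightarrow> nat" and s e x' :: "nat \<Rightarrow> real"
  assumes N: "filterlim N at_top sequentially" and s: "\<And>h. \<bar>s h\<bar> \<le> S"
    and x': "\<forall>\<^sub>F h in sequentially. x' h = x (N h) + omega (N h) * s h"
    and Q: "\<And>R \<eta>. \<eta> > 0 \<Longrightarrow> \<forall>\<^sub>F h in sequentially. \<forall>i. \<bar>y (N h) i\<bar> \<le> R \<longrightarrow>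
         (\<exists>z. \<bar>z - (y (N h) i - s h)\<bar> \<le> \<eta> \<and> \<bar>W (N h) i - (e h - f (x (N h))) / omega (N h) - (staircase_HV H V (z - s0) + c0)\<bar> \<le> \<eta>)"
  shows "loc_strict_conv (\<lambda>h. - x' h / omega (N h)) (\<lambda>h. (1 - x' h) / omega (N h))
     (\<lambda>h t. (u (N h) (x' h + omega (N h) * t) - e h) / omega (N h)) (\<lambda>t. staircase_HV H V (t - s0) + c0)"
proof -
  note evN = eventually_compose_filterlim[OF _ N]
  define E where "E h = (e h - f (x (N h))) / omega (N h)" for h
  define p where "p h = real (k (N h)) + s h / mesh (N h)" for h
  have N2: "\<forall>\<^sub>F h in sequentially. N h \<ge> 2" by (rule evN[OF eventually_ge_at_top])
  have S0: "S \<ge> 0" using s[of 0] by linarith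
  have roomN: "\<forall>\<^sub>F h in sequentially. p h * mesh (N h) \<ge> R \<and> x' h / omega (N h) \<ge> R \<and> (1 - x' h) / omega (N h) \<ge> R" for R
    using evN[OF room[of "R + S"]] N2 x'
  proof eventually_elim
    case (elim h)
    have w: "omega (N h) > 0" and m: "mesh (N h) > 0" using omega_pos mesh_pos elim by auto
    have "x' h / omega (N h) = real (k (N h)) * mesh (N h) + s h" "(1 - x' h) / omega (N h) = (real (N h) - real (k (N h))) * mesh (N h) - s h"
      using elim x_def w by (auto simp: mesh_def field_simps)
    moreover have "p h * mesh (N h) = real (k (N h)) * mesh (N h) + s h" using m by (simp add: p_def distrib_right)
    ultimately show ?case using elim(1) s[of h] by linarith
  qed
  have rep: "\<forall>\<^sub>F h in sequentially. \<forall>t. \<bar>t\<bar> \<le> R \<longrightarrow> (u (N h) (x' h + omega (N h) * t) - e h) / omega (N h)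
       = grid_fun (\<lambda>i. W (N h) i - E h) (p h) (mesh (N h)) t \<and> 0 \<le> real (k (N h)) + (s h + t) / mesh (N h)" for R
    using evN[OF index_in_range[of "S + R"]] N2 x'
  proof eventually_elim
    case (elim h)
    have w: "omega (N h) > 0" using omega_pos elim by auto
    show ?case
    proof (intro allI impI)
      fix t assume t: "\<bar>t\<bar> \<le> R"
      have "\<bar>s h + t\<bar> \<le> S + R" using t s[of h] by linarith
      then have r: "0 \<le> real (k (N h)) + (s h + t) / mesh (N h)" "real (k (N h)) + (s h + t) / mesh (N h) < real (N h)" using elim(1) by auto
      have "x' h + omega (N h) * t = x (N h) + omega (N h) * (s h + t)" using elim(3) by (simp add: algebra_simps)
      then have "u (N h) (x' h + omega (N h) * t) = u (N h) (real (nat \<lfloor>real (k (N h)) + (s h + t) / mesh (N h)\<rfloor>) / real (N h))"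
        using rescaled_u[OF elim(2) r] by simp
      moreover have "real (k (N h)) + (s h + t) / mesh (N h) = p h + t / mesh (N h)" by (simp add: p_def add_divide_distrib)
      ultimately show "(u (N h) (x' h + omega (N h) * t) - e h) / omega (N h) = grid_fun (\<lambda>i. W (N h) i - E h) (p h) (mesh (N h)) t
          \<and> 0 \<le> real (k (N h)) + (s h + t) / mesh (N h)"
        using r by (simp add: grid_fun_def W_def E_def diff_divide_distrib)
    qed
  qed
  have idx: "nat \<lfloor>p h + t / mesh (N h)\<rfloor> = nat \<lfloor>real (k (N h)) + (s h + t) / mesh (N h)\<rfloor>" for h t
    by (simp add: p_def add_divide_distrib add.assoc)
  show ?thesis
  proof (rule loc_strict_convI[where A = "\<lambda>h i. W (N h) i - E h" and p = p and \<delta> = "\<lambda>h. mesh (N h)"])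
    show "filterlim (\<lambda>h. - x' h / omega (N h)) at_bot sequentially" unfolding filterlim_at_bot
    proof
      fix Z show "\<forall>\<^sub>F h in sequentially. - x' h / omega (N h) \<le> Z" using roomN[of "- Z"] by eventually_elim simp
    qed
    show "filterlim (\<lambda>h. (1 - x' h) / omega (N h)) at_top sequentially" unfolding filterlim_at_top
    proof
      fix Z show "\<forall>\<^sub>F h in sequentially. Z \<le> (1 - x' h) / omega (N h)" using roomN[of Z] by eventually_elim simp
    qed
    show "\<forall>\<^sub>F h in sequentially. mesh (N h) > 0" using N2 by eventually_elim (rule mesh_pos)
    show "\<forall>\<^sub>F h in sequentially. R \<le> p h * mesh (N h)" for R using roomN[of R] by eventually_elim simp
    show "\<forall>\<^sub>F h in sequentially. \<forall>t. \<bar>t\<bar> \<le> R \<longrightarrow> (u (N h) (x' h + omega (N h) * t) - e h) / omega (N h)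
       = grid_fun (\<lambda>i. W (N h) i - E h) (p h) (mesh (N h)) t" for R using rep[of R] by eventually_elim simp
    show "\<forall>\<^sub>F h in sequentially. \<forall>t. \<bar>t\<bar> \<le> R \<longrightarrow> (\<exists>z. \<bar>z - t\<bar> \<le> \<eta> \<and> \<bar>(u (N h) (x' h + omega (N h) * t) - e h) / omega (N h) - (staircase_HV H V (z - s0) + c0)\<bar> \<le> \<eta>)"
      if \<eta>: "\<eta> > 0" for R \<eta>
    proof -
      have "\<forall>\<^sub>F n in sequentially. mesh n < min 1 (\<eta> / 2)" using mesh_tendsto_0 \<eta> by (intro order_tendstoD) auto
      from Q[OF half_gt_zero[OF \<eta>], of "S + \<bar>R\<bar> + 1"] rep[of R] N2 evN[OF this] show ?thesis
      proof eventually_elim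
        case (elim h)
        show ?case
        proof (intro allI impI)
          fix t assume t: "\<bar>t\<bar> \<le> R"
          define i where "i = nat \<lfloor>real (k (N h)) + (s h + t) / mesh (N h)\<rfloor>"
          have r: "0 \<le> real (k (N h)) + (s h + t) / mesh (N h)" using elim(2) t by blast
          have yi: "y (N h) i \<le> s h + t" "s h + t < y (N h) i + mesh (N h)" using cell_index_pos[OF elim(3) r] by (auto simp: i_def)
          then have "\<bar>y (N h) i\<bar> \<le> S + \<bar>R\<bar> + 1" using t s[of h] elim(4) by linarith
          then obtain z where z: "\<bar>z - (y (N h) i - s h)\<bar> \<le> \<eta> / 2" "\<bar>W (N h) i - E h - (staircase_HV H V (z - s0) + c0)\<bar> \<le> \<eta> / 2"
            using elim(1) unfolding E_def by blast
          have "(u (N h) (x' h + omega (N h) * t) - e h) / omega (N h) = W (N h) i - E h"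
            using elim(2) t unfolding grid_fun_def idx i_def by blast
          moreover have "\<bar>z - t\<bar> \<le> \<eta>" using z(1) yi elim(4) by linarith
          ultimately show "\<exists>z. \<bar>z - t\<bar> \<le> \<eta> \<and> \<bar>(u (N h) (x' h + omega (N h) * t) - e h) / omega (N h) - (staircase_HV H V (z - s0) + c0)\<bar> \<le> \<eta>"
            using z(2) \<eta> by (intro exI[of _ z]) auto
        qed
      qed
    qed
    show "\<forall>\<^sub>F h in sequentially. \<forall>a b. - R \<le> a \<longrightarrow> a < b \<longrightarrow> b \<le> R \<longrightarrow> grid_var (\<lambda>i. W (N h) i - E h) (p h) (mesh (N h)) a b
       \<le> \<bar>(u (N h) (x' h + omega (N h) * b) - e h) / omega (N h) - (u (N h) (x' h + omega (N h) * a) - e h) / omega (N h)\<bar> + \<eta>"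
      if \<eta>: "\<eta> > 0" for R \<eta>
    proof -
      have "\<forall>\<^sub>F n in sequentially. mesh n < 1" using mesh_tendsto_0 by (intro order_tendstoD) auto
      from evN[OF variation_bound[OF \<eta>, of "S + \<bar>R\<bar> + 1"]] rep[of R] N2 evN[OF this] show ?thesis
      proof eventually_elim
        case (elim h)
        have m: "mesh (N h) > 0" using mesh_pos elim by simp
        show ?case
        proof (intro allI impI)
          fix a b assume ab: "- R \<le> a" "a < b" "b \<le> R"
          define i where "i t = nat \<lfloor>real (k (N h)) + (s h + t) / mesh (N h)\<rfloor>" for t
          have t: "\<bar>y (N h) (i t)\<bar> \<le> S + \<bar>R\<bar> + 1 \<and> (u (N h) (x' h + omega (N h) * t) - e h) / omega (N h) = W (N h) (i t) - E h" if "\<bar>t\<bar> \<le> R" for t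
          proof
            have r: "0 \<le> real (k (N h)) + (s h + t) / mesh (N h)" using elim(2) that by blast
            have "y (N h) (i t) \<le> s h + t" "s h + t < y (N h) (i t) + mesh (N h)" using cell_index_pos[OF elim(3) r] by (auto simp: i_def)
            then show "\<bar>y (N h) (i t)\<bar> \<le> S + \<bar>R\<bar> + 1" using that s[of h] elim(4) by linarith
            show "(u (N h) (x' h + omega (N h) * t) - e h) / omega (N h) = W (N h) (i t) - E h"
              using elim(2) that unfolding grid_fun_def idx i_def by blast
          qed
          have "\<bar>a\<bar> \<le> R" "\<bar>b\<bar> \<le> R" using ab by auto
          note t[OF this(1)] t[OF this(2)]
          moreover have "i a \<le> i b" unfolding i_def using ab m by (intro nat_mono floor_mono) (simp add: divide_right_mono)
          ultimately have "(\<Sum>q\<in>{i a..<i b}. \<bar>W (N h) (Suc q) - W (N h) q\<bar>) \<le> \<bar>W (N h) (i b) - W (N h) (i a)\<bar> + \<eta>" using elim(1) by blast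
          then show "grid_var (\<lambda>i. W (N h) i - E h) (p h) (mesh (N h)) a b
            \<le> \<bar>(u (N h) (x' h + omega (N h) * b) - e h) / omega (N h) - (u (N h) (x' h + omega (N h) * a) - e h) / omega (N h)\<bar> + \<eta>"
            using t[OF \<open>\<bar>a\<bar> \<le> R\<close>] t[OF \<open>\<bar>b\<bar> \<le> R\<close>] unfolding grid_var_def idx i_def[symmetric] by simp
        qed
      qed
    qed
    show "(\<lambda>t. staircase_HV H V (t - s0) + c0) \<in> borel_measurable borel"
      unfolding staircase_HV_def staircase_def by measurable
    show "\<exists>B. \<forall>t. \<bar>t\<bar> \<le> R \<longrightarrow> \<bar>staircase_HV H V (t - s0) + c0\<bar> \<le> B" for R
    proof (intro exI allI impI)
      fix t assume t: "\<bar>t\<bar> \<le> R"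
      have "\<bar>(t - s0) / H\<bar> \<le> (R + \<bar>s0\<bar>) / H"
      proof -
        have "\<bar>t - s0\<bar> \<le> R + \<bar>s0\<bar>" using t by linarith
        then show ?thesis using H_nonneg by (simp add: abs_divide divide_right_mono)
      qed
      then have "\<bar>staircase ((t - s0) / H)\<bar> \<le> (R + \<bar>s0\<bar>) / H + 1" using staircase_bound[of "(t - s0) / H"] by linarith
      then have "\<bar>V * staircase ((t - s0) / H)\<bar> \<le> \<bar>V\<bar> * ((R + \<bar>s0\<bar>) / H + 1)" unfolding abs_mult by (intro mult_left_mono) auto
      then show "\<bar>staircase_HV H V (t - s0) + c0\<bar> \<le> \<bar>V\<bar> * ((R + \<bar>s0\<bar>) / H + 1) + \<bar>c0\<bar>" unfolding staircase_HV_def by linarith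
    qed
    have const: "loc_const_at (\<lambda>t. staircase_HV H V (t - s0) + c0) t" if "V = 0" for t
      unfolding loc_const_at_def staircase_HV_def using that by (intro exI[of _ 1]) auto
    show "loc_const_at (\<lambda>t. staircase_HV H V (t - s0) + c0) t" if "\<not> jump_point (\<lambda>t. staircase_HV H V (t - s0) + c0) t" for t
      using V_zero_or_H_pos staircase_loc_const[OF _ that] const by blast
    show "finite {t. \<bar>t\<bar> \<le> R \<and> \<not> loc_const_at (\<lambda>t. staircase_HV H V (t - s0) + c0) t}" for R
      using V_zero_or_H_pos staircase_jumps_finite const by (cases "V = 0") auto
  qed
qed

text \<open>The plateau of height \<open>V * \<tau>\<close> is centred at \<open>H * \<tau>\<close>
  with half-length \<open>H\<close>, hence contains a neighbourhood of the origin exactly when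
  \<open>\<bar>\<tau>\<bar> < 1\<close>.\<close>

lemma obl_near_centre:
  assumes "\<bar>z\<bar> < H * (1 - \<bar>\<tau>\<bar>)"
  shows "obl H V \<tau> z = V * \<tau>"
proof -
  have "H \<noteq> 0" using assms by auto
  then have H: "H > 0" using H_nonneg by simp
  have "\<bar>H * \<tau>\<bar> = H * \<bar>\<tau>\<bar>" using H by (simp add: abs_mult)
  then have "\<bar>z - H * \<tau>\<bar> < H" using assms unfolding right_diff_distrib by simp
  then have "staircase_HV H V (z - H * \<tau>) = V * (2 * real_of_int 0)" by (intro staircase_HV_on_cell[OF H]) auto
  then show ?thesis by (simp add: obl_def)
qed

text \<open>The parameters delivered by the shadowing estimate depend on \<open>R\<close> and
  \<eta>; the diagonal choice makes one sequence serve all scales.\<close>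

lemma oblique_parameters:
  obtains \<tau> where "\<forall>n. \<tau> n \<in> {-1..1}" "\<And>R \<eta>. \<eta> > 0 \<Longrightarrow> \<forall>\<^sub>F n in sequentially. shadows (y n) (W n) (obl H V (\<tau> n)) R \<eta>"
proof -
  obtain \<tau> where t: "\<forall>n. \<tau> n \<in> {-1..1::real}" "\<forall>j. \<forall>\<^sub>F n in sequentially. shadows (y n) (W n) (obl H V (\<tau> n)) (real j) (1 / real (Suc j))"
  proof (rule diagonal_choice[of "{-1..1::real}" "\<lambda>j n \<tau>. shadows (y n) (W n) (obl H V \<tau>) (real j) (1 / real (Suc j))"])
    show "\<forall>\<^sub>F n in sequentially. \<exists>\<tau>\<in>{-1..1}. shadows (y n) (W n) (obl H V \<tau>) (real j) (1 / real (Suc j))" for j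
      by (rule shadowing) simp
    show "shadows (y n) (W n) (obl H V \<tau>) (real i) (1 / real (Suc i))"
      if "i \<le> j" "shadows (y n) (W n) (obl H V \<tau>) (real j) (1 / real (Suc j))" for i j n \<tau>
      using that by (intro shadows_mono[OF that(2)]) (auto simp: frac_le)
  qed auto
  have "\<forall>\<^sub>F n in sequentially. shadows (y n) (W n) (obl H V (\<tau> n)) R \<eta>" if "\<eta> > 0" for R \<eta>
    by (rule eventually_all_scales[OF _ _ that]) (use t(2) in \<open>auto intro: shadows_mono\<close>)
  then show thesis using that t(1) by blast
qed

lemma f_increment:
  assumes s: "\<And>n. \<bar>s n\<bar> \<le> S" and \<eta>: "\<eta> > 0"
  shows "\<forall>\<^sub>F n in sequentially. \<bar>(f (x n + omega n * s n) - f (x n)) / omega n - M * s n\<bar> \<le> \<eta>"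
proof -
  have S: "S \<ge> 0" using s[of 0] by linarith
  define e1 where "e1 = \<eta> / (S + 1)"
  have e1: "e1 > 0" using \<eta> S by (simp add: e1_def)
  obtain \<rho> where \<rho>: "\<rho> > 0" "{xinf - \<rho>..xinf + \<rho>} \<subseteq> {0..1}"
    and lin: "\<forall>s t. \<bar>s - xinf\<bar> \<le> \<rho> \<longrightarrow> \<bar>t - xinf\<bar> \<le> \<rho> \<longrightarrow> \<bar>f t - f s - M * (t - s)\<bar> \<le> e1 * \<bar>t - s\<bar>"
    by (rule f_linear[OF e1])
  have "\<forall>\<^sub>F n in sequentially. dist (x n) xinf < \<rho> / 2" using x_lim \<rho> by (intro tendstoD) auto
  moreover have "\<forall>\<^sub>F n in sequentially. omega n < \<rho> / (2 * (S + 1))" using omega_tendsto_0 \<rho> S by (intro order_tendstoD) auto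
  ultimately show ?thesis using eventually_ge_at_top[of 2]
  proof eventually_elim
    case (elim n)
    have w: "omega n > 0" using omega_pos elim by simp
    have "\<bar>omega n * s n\<bar> \<le> omega n * (S + 1)" unfolding abs_mult using s[of n] w by (intro mult_mono) auto
    also have "\<dots> \<le> \<rho> / (2 * (S + 1)) * (S + 1)" using elim S by (intro mult_right_mono) auto
    also have "\<dots> = \<rho> / 2" using S by (simp add: field_simps)
    finally have "\<bar>omega n * s n\<bar> \<le> \<rho> / 2" .
    then have "\<bar>x n - xinf\<bar> \<le> \<rho>" "\<bar>x n + omega n * s n - xinf\<bar> \<le> \<rho>" using elim(1) \<rho>(1) unfolding dist_real_def by linarith+
    then have "\<bar>f (x n + omega n * s n) - f (x n) - M * (x n + omega n * s n - x n)\<bar> \<le> e1 * \<bar>x n + omega n * s n - x n\<bar>" using lin by blast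
    also have "\<dots> = omega n * (e1 * \<bar>s n\<bar>)" using w by (simp add: abs_mult)
    also have "\<dots> \<le> omega n * (e1 * (S + 1))" using w e1 s[of n] by (intro mult_left_mono) auto
    also have "e1 * (S + 1) = \<eta>" using S by (simp add: e1_def)
    finally have "\<bar>f (x n + omega n * s n) - f (x n) - M * (omega n * s n)\<bar> \<le> omega n * \<eta>" by simp
    moreover have "(f (x n + omega n * s n) - f (x n)) / omega n - M * s n = (f (x n + omega n * s n) - f (x n) - M * (omega n * s n)) / omega n"
      using w by (simp add: field_simps)
    ultimately show ?case using w by (simp add: abs_divide divide_le_eq mult.commute)
  qed
qed

lemma centres:
  assumes s: "\<And>n. \<bar>s n\<bar> \<le> S" "\<And>n. s n \<le> H"
  obtains x' where "\<forall>n. 0 < x' n \<and> x' n < 1" "\<forall>\<^sub>F n in sequentially. x' n = x n + omega n * s n"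
    "limsup (\<lambda>n. ereal ((x' n - x n) / omega n)) \<le> ereal H"
proof -
  \<comment> \<open>The centres must lie in \<open>(0, 1)\<close> for every \<open>n\<close>,
    including small ones; the value \<open>1 / 2\<close> is a default for finitely many
    indices.\<close>
  define x' where "x' n = (if 0 < x n + omega n * s n \<and> x n + omega n * s n < 1 then x n + omega n * s n else 1 / 2)" for n
  have ev: "\<forall>\<^sub>F n in sequentially. x' n = x n + omega n * s n"
    using room[of "S + 1"] eventually_ge_at_top[of 2]
  proof eventually_elim
    case (elim n)
    have w: "omega n > 0" using omega_pos elim by simp
    have "real (k n) * mesh n = x n / omega n" "(real n - real (k n)) * mesh n = (1 - x n) / omega n"
      using x_def elim w by (auto simp: mesh_def field_simps)
    then have "(S + 1) * omega n \<le> x n" "(S + 1) * omega n \<le> 1 - x n" using elim(1) w by (auto simp: le_divide_eq)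
    moreover have "\<bar>omega n * s n\<bar> \<le> S * omega n" unfolding abs_mult using s(1)[of n] w by (simp add: mult.commute mult_left_mono)
    ultimately have "0 < x n + omega n * s n" "x n + omega n * s n < 1" using w unfolding distrib_right by linarith+
    then show ?case by (simp add: x'_def)
  qed
  show thesis
  proof (rule that[OF _ ev])
    show "\<forall>n. 0 < x' n \<and> x' n < 1" by (simp add: x'_def)
    show "limsup (\<lambda>n. ereal ((x' n - x n) / omega n)) \<le> ereal H"
    proof (rule Limsup_bounded)
      show "\<forall>\<^sub>F n in sequentially. ereal ((x' n - x n) / omega n) \<le> ereal H"
        using ev eventually_ge_at_top[of 2]
      proof eventually_elim
        case (elim n)
        then show ?case using s(2)[of n] omega_pos[of n] by simp
      qed
    qed
  qed
qed

lemma W_at_centre: "n \<ge> 2 \<Longrightarrow> W n (k n) = (u n (x n) - f (x n)) / omega n"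
  using x_def by (simp add: W_def)

text \<open>A shift of the centre by \<open>s\<close> moves the positions by \<open>s\<close>, and
  the reference height along the tangent by \<open>M * s\<close>. As \<open>V = M * H\<close>, this
  is the slide that turns the parameter \<tau>n into \<tau>.\<close>

lemma shadow_near:
  assumes sh: "shadows (y n) (W n) (obl H V \<tau>n) R \<eta>" and i: "\<bar>y n i\<bar> \<le> R"
    and s: "s = H * (\<tau>n - \<tau>)"
  shows "\<exists>z. \<bar>z - (y n i - s)\<bar> \<le> \<eta> \<and> \<bar>W n i - M * s - obl H V \<tau> z\<bar> \<le> \<eta>"
proof -
  obtain z where z: "\<bar>z - y n i\<bar> \<le> \<eta>" "\<bar>W n i - obl H V \<tau>n z\<bar> \<le> \<eta>" using sh i unfolding shadows_def by blast
  have "obl H V \<tau>n z = obl H V \<tau> (z - s) + M * s"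
    using obl_change_parameter[of H V \<tau>n z \<tau>] by (simp add: s V_def algebra_simps)
  then show ?thesis using z by (intro exI[of _ "z - s"]) auto
qed

lemma oblique_limits:
  assumes N: "filterlim N at_top sequentially"
  shows "\<exists>r. strict_mono r \<and> (\<exists>w\<in>Obl H V.
           loc_strict_conv (\<lambda>h. - x (N (r h)) / omega (N (r h))) (\<lambda>h. (1 - x (N (r h))) / omega (N (r h)))
             (\<lambda>h y. (u (N (r h)) (x (N (r h)) + omega (N (r h)) * y) - f (x (N (r h)))) / omega (N (r h))) w)"
proof -
  obtain \<tau> where \<tau>: "\<forall>n. \<tau> n \<in> {-1..1}" "\<And>R \<eta>. \<eta> > 0 \<Longrightarrow> \<forall>\<^sub>F n in sequentially. shadows (y n) (W n) (obl H V (\<tau> n)) R \<eta>"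
    by (rule oblique_parameters) blast
  have "seq_compact {-1..1::real}" by (intro compact_imp_seq_compact compact_Icc)
  moreover have "\<forall>h. \<tau> (N h) \<in> {-1..1}" using \<tau>(1) by blast
  ultimately obtain l r where r: "l \<in> {-1..1}" "strict_mono r" "((\<lambda>h. \<tau> (N h)) \<circ> r) \<longlonglongrightarrow> l" by (rule seq_compactE)
  have rl: "(\<lambda>h. \<tau> (N (r h))) \<longlonglongrightarrow> l" using r(3) by (simp add: comp_def)
  have Nr: "filterlim (\<lambda>h. N (r h)) at_top sequentially" using filterlim_compose[OF N filterlim_subseq[OF r(2)]] .
  have "loc_strict_conv (\<lambda>h. - x (N (r h)) / omega (N (r h))) (\<lambda>h. (1 - x (N (r h))) / omega (N (r h)))
     (\<lambda>h t. (u (N (r h)) (x (N (r h)) + omega (N (r h)) * t) - f (x (N (r h)))) / omega (N (r h))) (\<lambda>t. staircase_HV H V (t - H * l) + V * l)"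
  proof (rule convergence_of_blow_ups[OF Nr, of "\<lambda>_. 0" 0])
    fix R \<eta> :: real assume \<eta>: "\<eta> > 0"
    \<comment> \<open>Passing from the parameter at index \<open>h\<close> to its limit displaces
      the graph by \<open>H * \<bar>d\<bar>\<close> horizontally and
      \<open>\<bar>V\<bar> * \<bar>d\<bar>\<close> vertically.\<close>
    have "(\<lambda>h. (H + \<bar>V\<bar>) * \<bar>\<tau> (N (r h)) - l\<bar>) \<longlonglongrightarrow> (H + \<bar>V\<bar>) * \<bar>l - l\<bar>" by (intro tendsto_intros rl)
    then have "\<forall>\<^sub>F h in sequentially. (H + \<bar>V\<bar>) * \<bar>\<tau> (N (r h)) - l\<bar> < \<eta> / 2" using \<eta> by (intro order_tendstoD) auto
    with eventually_compose_filterlim[OF \<tau>(2)[OF half_gt_zero[OF \<eta>], of R] Nr]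
    show "\<forall>\<^sub>F h in sequentially. \<forall>i. \<bar>y (N (r h)) i\<bar> \<le> R \<longrightarrow> (\<exists>z. \<bar>z - (y (N (r h)) i - 0)\<bar> \<le> \<eta> \<and>
        \<bar>W (N (r h)) i - (f (x (N (r h))) - f (x (N (r h)))) / omega (N (r h)) - (staircase_HV H V (z - H * l) + V * l)\<bar> \<le> \<eta>)"
    proof eventually_elim
      case (elim h)
      show ?case
      proof (intro allI impI)
        fix i assume i: "\<bar>y (N (r h)) i\<bar> \<le> R"
        define d where "d = \<tau> (N (r h)) - l"
        obtain z where z: "\<bar>z - (y (N (r h)) i - H * d)\<bar> \<le> \<eta> / 2" "\<bar>W (N (r h)) i - M * (H * d) - obl H V l z\<bar> \<le> \<eta> / 2"
          using shadow_near[OF elim(1) i, of "H * d" l] by (auto simp: d_def)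
        have p: "H * \<bar>d\<bar> \<ge> 0" "\<bar>V\<bar> * \<bar>d\<bar> \<ge> 0" "\<bar>H * d\<bar> = H * \<bar>d\<bar>" "\<bar>M * (H * d)\<bar> = \<bar>V\<bar> * \<bar>d\<bar>"
          using H_nonneg by (auto simp: abs_mult V_def)
        have "H * \<bar>d\<bar> + \<bar>V\<bar> * \<bar>d\<bar> \<le> \<eta> / 2" using elim(2) by (simp add: d_def distrib_right)
        then have "\<bar>H * d\<bar> \<le> \<eta> / 2" "\<bar>M * (H * d)\<bar> \<le> \<eta> / 2" using p by linarith+
        then show "\<exists>z. \<bar>z - (y (N (r h)) i - 0)\<bar> \<le> \<eta> \<and>
          \<bar>W (N (r h)) i - (f (x (N (r h))) - f (x (N (r h)))) / omega (N (r h)) - (staircase_HV H V (z - H * l) + V * l)\<bar> \<le> \<eta>"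
          using z unfolding obl_def div_0 diff_self diff_0_right by (intro exI[of _ z] conjI) linarith+
      qed
    qed
  qed auto
  then show ?thesis using r(1,2) unfolding Obl_def by blast
qed

lemma oblique_attained:
  assumes w: "w \<in> Obl H V"
  shows "\<exists>x' :: nat \<Rightarrow> real. (\<forall>n. 0 < x' n \<and> x' n < 1)
        \<and> limsup (\<lambda>n. ereal ((x' n - x n) / omega n)) \<le> ereal H
        \<and> loc_strict_conv (\<lambda>n. - x' n / omega n) (\<lambda>n. (1 - x' n) / omega n)
             (\<lambda>n y. (u n (x' n + omega n * y) - f (x' n)) / omega n) w"
proof -
  obtain l where l: "l \<in> {-1..1}" "w = (\<lambda>t. staircase_HV H V (t - H * l) + V * l)" using w unfolding Obl_def by blast
  obtain \<tau> where \<tau>: "\<forall>n. \<tau> n \<in> {-1..1}" "\<And>R \<eta>. \<eta> > 0 \<Longrightarrow> \<forall>\<^sub>F n in sequentially. shadows (y n) (W n) (obl H V (\<tau> n)) R \<eta>"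
    by (rule oblique_parameters) blast
  \<comment> \<open>Both choices describe the same function. The second is taken when the first
    would require a shift larger than \<open>H\<close>, so that the bound on the limsup
    holds.\<close>
  define l' where "l' n = (if \<tau> n - l \<le> 1 then l else l + 2)" for n
  have obl_l': "obl H V (l' n) = obl H V l" for n using obl_periodic[OF V_zero_or_H_pos] by (simp add: l'_def)
  define s where "s n = H * (\<tau> n - l' n)" for n
  have d: "\<tau> n - l' n \<le> 1" "\<bar>\<tau> n - l' n\<bar> \<le> 3" for n using \<tau>(1)[rule_format, of n] l(1) by (auto simp: l'_def)
  have s: "s n \<le> H" "\<bar>s n\<bar> \<le> H * 3" for n
  proof -
    show "s n \<le> H" using mult_left_mono[OF d(1) H_nonneg, of n] by (simp add: s_def)
    show "\<bar>s n\<bar> \<le> H * 3" using mult_left_mono[OF d(2) H_nonneg, of n] H_nonneg by (simp add: s_def abs_mult)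
  qed
  obtain x' where x': "\<forall>n. 0 < x' n \<and> x' n < 1" "\<forall>\<^sub>F n in sequentially. x' n = x n + omega n * s n"
    "limsup (\<lambda>n. ereal ((x' n - x n) / omega n)) \<le> ereal H" by (rule centres[OF s(2,1)])
  have "loc_strict_conv (\<lambda>n. - x' n / omega n) (\<lambda>n. (1 - x' n) / omega n)
     (\<lambda>n t. (u n (x' n + omega n * t) - f (x' n)) / omega n) (\<lambda>t. staircase_HV H V (t - H * l) + V * l)"
  proof (rule convergence_of_blow_ups[OF filterlim_ident s(2) x'(2)])
    fix R \<eta> :: real assume \<eta>: "\<eta> > 0"
    show "\<forall>\<^sub>F n in sequentially. \<forall>i. \<bar>y n i\<bar> \<le> R \<longrightarrow> (\<exists>z. \<bar>z - (y n i - s n)\<bar> \<le> \<eta> \<and>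
        \<bar>W n i - (f (x' n) - f (x n)) / omega n - (staircase_HV H V (z - H * l) + V * l)\<bar> \<le> \<eta>)"
      using \<tau>(2)[OF half_gt_zero[OF \<eta>], of R] f_increment[where s = s and S = "H * 3", OF s(2) half_gt_zero[OF \<eta>]] x'(2)
    proof eventually_elim
      case (elim n)
      show ?case
      proof (intro allI impI)
        fix i assume i: "\<bar>y n i\<bar> \<le> R"
        obtain z where z: "\<bar>z - (y n i - s n)\<bar> \<le> \<eta> / 2" "\<bar>W n i - M * s n - obl H V (l' n) z\<bar> \<le> \<eta> / 2"
          using shadow_near[OF elim(1) i s_def] by blast
        have "\<bar>(f (x' n) - f (x n)) / omega n - M * s n\<bar> \<le> \<eta> / 2" using elim(2,3) by simp
        then show "\<exists>z. \<bar>z - (y n i - s n)\<bar> \<le> \<eta> \<and> \<bar>W n i - (f (x' n) - f (x n)) / omega n - (staircase_HV H V (z - H * l) + V * l)\<bar> \<le> \<eta>"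
          using z \<eta> unfolding obl_l' obl_def by (intro exI[of _ z] conjI) linarith+
      qed
    qed
  qed
  then show ?thesis using x' l(2) by blast
qed

lemma obl_bound:
  assumes "\<bar>z\<bar> \<le> 1" "\<bar>\<tau>\<bar> \<le> 1"
  shows "\<bar>obl H V \<tau> z\<bar> \<le> \<bar>V\<bar> * ((1 + H) / H + 1) + \<bar>V\<bar>"
proof -
  have "\<bar>H * \<tau>\<bar> \<le> H" using assms H_nonneg by (simp add: abs_mult mult_left_le)
  then have "\<bar>z - H * \<tau>\<bar> \<le> 1 + H" using assms by linarith
  then have "\<bar>(z - H * \<tau>) / H\<bar> \<le> (1 + H) / H" using H_nonneg by (simp add: abs_divide divide_right_mono)
  then have "\<bar>staircase ((z - H * \<tau>) / H)\<bar> \<le> (1 + H) / H + 1" using staircase_bound[of "(z - H * \<tau>) / H"] by linarith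
  then have "\<bar>V * staircase ((z - H * \<tau>) / H)\<bar> \<le> \<bar>V\<bar> * ((1 + H) / H + 1)" unfolding abs_mult by (intro mult_left_mono) auto
  moreover have "\<bar>V * \<tau>\<bar> \<le> \<bar>V\<bar>" using assms by (simp add: abs_mult mult_left_le)
  ultimately show ?thesis unfolding obl_def staircase_HV_def by linarith
qed

text \<open>\<open>E\<close> is a limit of values near the origin, hence the height of a plateau
  whose closure contains the origin. Subtracting it brings that plateau to height zero, and its
  centre in units of \<open>H\<close> is the required parameter. If the origin is a jump, either
  neighbouring plateau may occur.\<close>

lemma obl_minus_plateau:
  assumes l: "l \<in> {-1..1}" and E: "\<And>\<eta>. \<eta> > 0 \<Longrightarrow> \<exists>z. \<bar>z\<bar> \<le> \<eta> \<and> \<bar>E - obl H V l z\<bar> \<le> \<eta>"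
  shows "\<exists>\<tau>\<in>{-1..1}. \<forall>t. obl H V l t - E = staircase_HV H V (t - H * \<tau>)"
proof (cases "V = 0")
  case True
  have "\<bar>E\<bar> \<le> 0 + \<eta>" if "\<eta> > 0" for \<eta> using E[OF that] True by (auto simp: obl_def staircase_HV_def)
  then have "\<bar>E\<bar> \<le> 0" by (rule field_le_epsilon)
  then show ?thesis using True by (intro bexI[of _ 0]) (auto simp: obl_def staircase_HV_def)
next
  case V: False
  then have H: "H > 0" using V_zero_or_H_pos by blast
  have *: "\<exists>m. \<bar>E - V * (2 * real_of_int m + l)\<bar> \<le> \<eta> \<and> \<bar>H * (l + 2 * real_of_int m)\<bar> \<le> H + \<eta>" if \<eta>: "\<eta> > 0" for \<eta>
  proof -
    obtain z where z: "\<bar>z\<bar> \<le> \<eta>" "\<bar>E - obl H V l z\<bar> \<le> \<eta>" using E[OF \<eta>] by blast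
    define m where "m = \<lfloor>((z - H * l) / H + 1) / 2\<rfloor>"
    have "real_of_int m \<le> ((z - H * l) / H + 1) / 2" "((z - H * l) / H + 1) / 2 < real_of_int m + 1" unfolding m_def by linarith+
    then have m: "2 * H * real_of_int m - H \<le> z - H * l" "z - H * l < 2 * H * real_of_int m + H" using H by (simp_all add: field_simps)
    then have "obl H V l z = V * (2 * real_of_int m + l)" unfolding obl_def by (simp add: staircase_HV_on_cell[OF H] distrib_left)
    moreover have "\<bar>H * (l + 2 * real_of_int m)\<bar> \<le> H + \<eta>"
    proof -
      have "H * (l + 2 * real_of_int m) = H * l + 2 * H * real_of_int m" by (simp add: algebra_simps)
      then show ?thesis using m z(1) by linarith
    qed
    ultimately show ?thesis using z by (intro exI[of _ m]) auto
  qed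
  \<comment> \<open>Distinct plateau heights are at least \<open>2 * \<bar>V\<bar>\<close> apart, so
    at tolerance \<open>\<bar>V\<bar> / 4\<close> the plateau is unique and is the same for all
    smaller \<eta>.\<close>
  obtain m0 where m0: "\<bar>E - V * (2 * real_of_int m0 + l)\<bar> \<le> \<bar>V\<bar> / 4" using *[of "\<bar>V\<bar> / 4"] V by auto
  have uniq: "\<bar>E - V * (2 * real_of_int m0 + l)\<bar> \<le> \<eta> \<and> \<bar>H * (l + 2 * real_of_int m0)\<bar> \<le> H + \<eta>" if \<eta>: "\<eta> > 0" for \<eta>
  proof -
    have "min \<eta> (\<bar>V\<bar> / 4) > 0" using \<eta> V by simp
    then obtain m where m: "\<bar>E - V * (2 * real_of_int m + l)\<bar> \<le> min \<eta> (\<bar>V\<bar> / 4)" "\<bar>H * (l + 2 * real_of_int m)\<bar> \<le> H + min \<eta> (\<bar>V\<bar> / 4)" using * by blast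
    have "m = m0"
    proof (rule ccontr)
      assume "m \<noteq> m0"
      then have "1 \<le> \<bar>real_of_int m - real_of_int m0\<bar>" by linarith
      then have "\<bar>V\<bar> * 2 \<le> \<bar>V\<bar> * (2 * \<bar>real_of_int m - real_of_int m0\<bar>)" by (intro mult_left_mono) auto
      also have "\<dots> = \<bar>V * (2 * real_of_int m + l) - V * (2 * real_of_int m0 + l)\<bar>"
      proof -
        have "V * (2 * real_of_int m + l) - V * (2 * real_of_int m0 + l) = V * (2 * (real_of_int m - real_of_int m0))" by (simp add: algebra_simps)
        then show ?thesis by (simp only: abs_mult abs_numeral)
      qed
      also have "\<dots> \<le> \<bar>V\<bar> / 4 + \<bar>V\<bar> / 4" using m(1) m0 by linarith
      finally show False using V by simp
    qed
    then show ?thesis using m by auto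
  qed
  have "\<bar>E - V * (2 * real_of_int m0 + l)\<bar> \<le> 0" by (rule field_le_epsilon) (use uniq in auto)
  then have E0: "E = V * (2 * real_of_int m0 + l)" by simp
  have "\<bar>H * (l + 2 * real_of_int m0)\<bar> \<le> H" by (rule field_le_epsilon) (use uniq in auto)
  then have "H * \<bar>l + 2 * real_of_int m0\<bar> \<le> H * 1" using H by (simp add: abs_mult)
  then have "\<bar>l + 2 * real_of_int m0\<bar> \<le> 1" using H by (simp only: mult_le_cancel_left_pos)
  moreover have "obl H V l t - E = staircase_HV H V (t - H * (l + 2 * real_of_int m0))" for t
  proof -
    have "(t - H * (l + 2 * real_of_int m0)) / H = (t - H * l) / H + 2 * real_of_int (- m0)" using H by (simp add: field_simps)
    then have "staircase ((t - H * (l + 2 * real_of_int m0)) / H) = staircase ((t - H * l) / H) - 2 * real_of_int m0"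
      using staircase_shift[of "(t - H * l) / H" "- m0"] by simp
    then show ?thesis unfolding obl_def staircase_HV_def E0 by (simp only: distrib_left right_diff_distrib)
  qed
  ultimately show ?thesis by (intro bexI[of _ "l + 2 * real_of_int m0"]) (auto simp: abs_le_iff)
qed

text \<open>When the limit of the oblique parameters puts a jump at the origin, it does not decide
  the value of the blow-up at the centre. A limit of that value is therefore extracted together with
  the parameter.\<close>

lemma horizontal_limits:
  assumes N: "filterlim N at_top sequentially"
  shows "\<exists>r. strict_mono r \<and> (\<exists>v\<in>Orz H V.
           loc_strict_conv (\<lambda>h. - x (N (r h)) / omega (N (r h))) (\<lambda>h. (1 - x (N (r h))) / omega (N (r h)))
             (\<lambda>h y. (u (N (r h)) (x (N (r h)) + omega (N (r h)) * y) - u (N (r h)) (x (N (r h)))) / omega (N (r h))) v)"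
proof -
  obtain \<tau> where \<tau>: "\<forall>n. \<tau> n \<in> {-1..1}" "\<And>R \<eta>. \<eta> > 0 \<Longrightarrow> \<forall>\<^sub>F n in sequentially. shadows (y n) (W n) (obl H V (\<tau> n)) R \<eta>"
    by (rule oblique_parameters) blast
  define B where "B = \<bar>V\<bar> * ((1 + H) / H + 1) + \<bar>V\<bar> + 1"
  define E where "E n = (u n (x n) - f (x n)) / omega n" for n
  have yk: "y n (k n) = 0" for n by (simp add: gpos_def)
  have EW: "\<forall>\<^sub>F n in sequentially. E n = W n (k n)" using eventually_ge_at_top[of 2] by eventually_elim (simp add: E_def W_at_centre)
  have EB: "\<forall>\<^sub>F n in sequentially. \<bar>E n\<bar> \<le> B"
    using \<tau>(2)[OF zero_less_one, of 0] EW
  proof eventually_elim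
    case (elim n)
    obtain z where z: "\<bar>z\<bar> \<le> 1" "\<bar>W n (k n) - obl H V (\<tau> n) z\<bar> \<le> 1" using elim(1) yk[of n] unfolding shadows_def by force
    moreover have "\<bar>\<tau> n\<bar> \<le> 1" using \<tau>(1)[rule_format, of n] by (auto simp: abs_le_iff)
    ultimately show ?case using obl_bound[of z "\<tau> n"] elim(2) unfolding B_def by linarith
  qed
  have B0: "B \<ge> 0" unfolding B_def using H_nonneg by (intro add_nonneg_nonneg mult_nonneg_nonneg) auto
  \<comment> \<open>The centre values are bounded only eventually; clipping puts every pair into a
    compact set without affecting the limit.\<close>
  define E' where "E' n = max (- B) (min B (E n))" for n
  have "seq_compact ({-1..1::real} \<times> {-B..B})" by (intro compact_imp_seq_compact compact_Times compact_Icc)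
  moreover have "\<forall>h. (\<tau> (N h), E' (N h)) \<in> {-1..1} \<times> {-B..B}" using \<tau>(1) B0 by (auto simp: E'_def)
  ultimately obtain q r where q: "q \<in> {-1..1} \<times> {-B..B}" and r: "strict_mono r" and lim: "((\<lambda>h. (\<tau> (N h), E' (N h))) \<circ> r) \<longlonglongrightarrow> q"
    by (rule seq_compactE)
  define l where "l = fst q"
  define E0 where "E0 = snd q"
  have l: "l \<in> {-1..1}" using q by (auto simp: l_def)
  have \<tau>l: "(\<lambda>h. \<tau> (N (r h))) \<longlonglongrightarrow> l" using tendsto_fst[OF lim] by (simp add: comp_def l_def)
  have E'0: "(\<lambda>h. E' (N (r h))) \<longlonglongrightarrow> E0" using tendsto_snd[OF lim] by (simp add: comp_def E0_def)
  have Nr: "filterlim (\<lambda>h. N (r h)) at_top sequentially" using filterlim_compose[OF N filterlim_subseq[OF r]] .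
  have main: "\<forall>\<^sub>F h in sequentially. (\<forall>i. \<bar>y (N (r h)) i\<bar> \<le> R \<longrightarrow> (\<exists>z. \<bar>z - y (N (r h)) i\<bar> \<le> \<eta> \<and> \<bar>W (N (r h)) i - E (N (r h)) - (obl H V l z - E0)\<bar> \<le> \<eta>))
      \<and> \<bar>E (N (r h)) - E0\<bar> \<le> \<eta> / 2 \<and> E (N (r h)) = W (N (r h)) (k (N (r h)))
      \<and> (\<forall>i. \<bar>y (N (r h)) i\<bar> \<le> R \<longrightarrow> (\<exists>z. \<bar>z - y (N (r h)) i\<bar> \<le> \<eta> \<and> \<bar>W (N (r h)) i - obl H V l z\<bar> \<le> \<eta> / 2))"
    if \<eta>: "\<eta> > 0" for R \<eta>
  proof -
    have \<eta>4: "\<eta> / 4 > 0" using \<eta> by simp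
    have "(\<lambda>h. (H + \<bar>V\<bar>) * \<bar>\<tau> (N (r h)) - l\<bar>) \<longlonglongrightarrow> (H + \<bar>V\<bar>) * \<bar>l - l\<bar>" by (intro tendsto_intros \<tau>l)
    then have "\<forall>\<^sub>F h in sequentially. (H + \<bar>V\<bar>) * \<bar>\<tau> (N (r h)) - l\<bar> < \<eta> / 4" using \<eta> by (intro order_tendstoD) auto
    moreover have "\<forall>\<^sub>F h in sequentially. dist (E' (N (r h))) E0 < \<eta> / 2" using E'0 \<eta> by (intro tendstoD) auto
    ultimately show ?thesis
      using eventually_compose_filterlim[OF \<tau>(2)[OF \<eta>4, of R] Nr] eventually_compose_filterlim[OF EB Nr] eventually_compose_filterlim[OF EW Nr]
    proof eventually_elim
      case (elim h)
      have "E' (N (r h)) = E (N (r h))" using elim(4) unfolding E'_def by (auto simp: abs_le_iff)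
      then have Eh: "\<bar>E (N (r h)) - E0\<bar> \<le> \<eta> / 2" using elim(2) by (simp add: dist_real_def)
      have near: "\<exists>z. \<bar>z - y (N (r h)) i\<bar> \<le> \<eta> \<and> \<bar>W (N (r h)) i - obl H V l z\<bar> \<le> \<eta> / 2" if i: "\<bar>y (N (r h)) i\<bar> \<le> R" for i
      proof -
        define d where "d = \<tau> (N (r h)) - l"
        obtain z where z: "\<bar>z - (y (N (r h)) i - H * d)\<bar> \<le> \<eta> / 4" "\<bar>W (N (r h)) i - M * (H * d) - obl H V l z\<bar> \<le> \<eta> / 4"
          using shadow_near[OF elim(3) i, of "H * d" l] by (auto simp: d_def)
        have p: "H * \<bar>d\<bar> \<ge> 0" "\<bar>V\<bar> * \<bar>d\<bar> \<ge> 0" "\<bar>H * d\<bar> = H * \<bar>d\<bar>" "\<bar>M * (H * d)\<bar> = \<bar>V\<bar> * \<bar>d\<bar>"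
          using H_nonneg by (auto simp: abs_mult V_def)
        have "H * \<bar>d\<bar> + \<bar>V\<bar> * \<bar>d\<bar> \<le> \<eta> / 4" using elim(1) by (simp add: d_def distrib_right)
        then have "\<bar>H * d\<bar> \<le> \<eta> / 4" "\<bar>M * (H * d)\<bar> \<le> \<eta> / 4" using p by linarith+
        then show ?thesis using z by (intro exI[of _ z] conjI) linarith+
      qed
      show ?case
      proof (intro allI impI conjI Eh elim(5) near)
        fix i assume "\<bar>y (N (r h)) i\<bar> \<le> R"
        then obtain z where "\<bar>z - y (N (r h)) i\<bar> \<le> \<eta>" "\<bar>W (N (r h)) i - obl H V l z\<bar> \<le> \<eta> / 2" using near by blast
        then show "\<exists>z. \<bar>z - y (N (r h)) i\<bar> \<le> \<eta> \<and> \<bar>W (N (r h)) i - E (N (r h)) - (obl H V l z - E0)\<bar> \<le> \<eta>"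
          using Eh by (intro exI[of _ z] conjI) linarith+
      qed
    qed
  qed
  have "\<exists>z. \<bar>z\<bar> \<le> \<eta> \<and> \<bar>E0 - obl H V l z\<bar> \<le> \<eta>" if \<eta>: "\<eta> > 0" for \<eta>
  proof -
    obtain h where h: "\<bar>E (N (r h)) - E0\<bar> \<le> \<eta> / 2" "E (N (r h)) = W (N (r h)) (k (N (r h)))"
      "\<forall>i. \<bar>y (N (r h)) i\<bar> \<le> 0 \<longrightarrow> (\<exists>z. \<bar>z - y (N (r h)) i\<bar> \<le> \<eta> \<and> \<bar>W (N (r h)) i - obl H V l z\<bar> \<le> \<eta> / 2)"
      using eventually_happens[OF main[OF \<eta>, of 0]] by auto
    obtain z where "\<bar>z\<bar> \<le> \<eta>" "\<bar>W (N (r h)) (k (N (r h))) - obl H V l z\<bar> \<le> \<eta> / 2" using h(3) yk by force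
    then show ?thesis using h(1,2) by (intro exI[of _ z] conjI) linarith+
  qed
  then obtain \<sigma> where \<sigma>: "\<sigma> \<in> {-1..1}" "\<And>t. obl H V l t - E0 = staircase_HV H V (t - H * \<sigma>)"
    using obl_minus_plateau[OF l] by blast
  have "loc_strict_conv (\<lambda>h. - x (N (r h)) / omega (N (r h))) (\<lambda>h. (1 - x (N (r h))) / omega (N (r h)))
     (\<lambda>h t. (u (N (r h)) (x (N (r h)) + omega (N (r h)) * t) - u (N (r h)) (x (N (r h)))) / omega (N (r h))) (\<lambda>t. staircase_HV H V (t - H * \<sigma>) + 0)"
  proof (rule convergence_of_blow_ups[OF Nr, of "\<lambda>_. 0" 0])
    fix R \<eta> :: real assume \<eta>: "\<eta> > 0"
    show "\<forall>\<^sub>F h in sequentially. \<forall>i. \<bar>y (N (r h)) i\<bar> \<le> R \<longrightarrow> (\<exists>z. \<bar>z - (y (N (r h)) i - 0)\<bar> \<le> \<eta> \<and>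
        \<bar>W (N (r h)) i - (u (N (r h)) (x (N (r h))) - f (x (N (r h)))) / omega (N (r h)) - (staircase_HV H V (z - H * \<sigma>) + 0)\<bar> \<le> \<eta>)"
      using main[OF \<eta>, of R] unfolding E_def \<sigma>(2) diff_zero add_0_right by eventually_elim blast
  qed auto
  then show ?thesis using r \<sigma>(1) unfolding Orz_def by (intro exI[of _ r] conjI bexI[of _ "\<lambda>t. staircase_HV H V (t - H * \<sigma>)"]) auto
qed

text \<open>States the closeness for a shift \<open>s\<close> whose choice may depend on the scale,
  in the form needed to select one shift per \<open>n\<close> diagonally.\<close>

definition horizontal_near :: "real \<Rightarrow> real \<Rightarrow> real \<Rightarrow> nat \<Rightarrow> real \<Rightarrow> bool" where
  "horizontal_near \<tau> R \<eta> n s \<longleftrightarrow> (\<forall>i. \<bar>y n i\<bar> \<le> R \<longrightarrow> (\<exists>z. \<bar>z - (y n i - s)\<bar> \<le> \<eta> \<and>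
      \<bar>W n i - (u n (x n + omega n * s) - f (x n)) / omega n - staircase_HV H V (z - H * \<tau>)\<bar> \<le> \<eta>))"

lemma horizontal_near_mono:
  "horizontal_near \<tau> R \<eta> n s \<Longrightarrow> R' \<le> R \<Longrightarrow> \<eta> \<le> \<eta>' \<Longrightarrow> horizontal_near \<tau> R' \<eta>' n s"
  unfolding horizontal_near_def by (meson order_trans)

text \<open>For \<open>\<tau> = \<plusminus>1\<close> the limit jumps at the origin, so the centre is placed slightly inside a plateau, at a
  parameter \<open>\<tau>' \<in> (-1, 1)\<close> close to \<open>\<tau>\<close>, where the value of the blow-up at the centre is controlled.\<close>

lemma horizontal_near_exists:
  assumes t: "\<tau> \<in> {-1..1}" and \<eta>: "\<eta> > 0"
  shows "\<forall>\<^sub>F n in sequentially. \<exists>s\<in>{s. s \<le> H \<and> \<bar>s\<bar> \<le> H * 3}. horizontal_near \<tau> R \<eta> n s"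
proof -
  obtain \<tau>n where \<tau>n: "\<forall>n. \<tau>n n \<in> {-1..1}" "\<And>R \<eta>. \<eta> > 0 \<Longrightarrow> \<forall>\<^sub>F n in sequentially. shadows (y n) (W n) (obl H V (\<tau>n n)) R \<eta>"
    by (rule oblique_parameters) blast
  show ?thesis
  proof (cases "H > 0")
    case False
    then have HV: "H = 0" "V = 0" using H_nonneg V_zero_or_H_pos by auto
    have "\<forall>\<^sub>F n in sequentially. horizontal_near \<tau> R \<eta> n 0"
      using \<tau>n(2)[OF half_gt_zero[OF \<eta>], of "\<bar>R\<bar>"] eventually_ge_at_top[of 2]
    proof eventually_elim
      case (elim n)
      have W: "\<bar>W n i\<bar> \<le> \<eta> / 2" if "\<bar>y n i\<bar> \<le> \<bar>R\<bar>" for i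
        using elim(1) that unfolding shadows_def by (auto simp: obl_def staircase_HV_def HV)
      have "\<bar>W n (k n)\<bar> \<le> \<eta> / 2" by (rule W) (simp add: gpos_def)
      then have 0: "\<bar>(u n (x n) - f (x n)) / omega n\<bar> \<le> \<eta> / 2" using W_at_centre[OF elim(2)] by simp
      show ?case unfolding horizontal_near_def
      proof (intro allI impI)
        fix i assume "\<bar>y n i\<bar> \<le> R"
        then have "\<bar>W n i\<bar> \<le> \<eta> / 2" by (intro W) simp
        then have "\<bar>W n i - (u n (x n) - f (x n)) / omega n\<bar> \<le> \<eta>" using 0 by linarith
        then show "\<exists>z. \<bar>z - (y n i - 0)\<bar> \<le> \<eta> \<and> \<bar>W n i - (u n (x n + omega n * 0) - f (x n)) / omega n - staircase_HV H V (z - H * \<tau>)\<bar> \<le> \<eta>"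
          using \<eta> by (intro exI[of _ "y n i"]) (simp add: staircase_HV_def HV)
      qed
    qed
    then show ?thesis by eventually_elim (use HV in auto)
  next
    case H: True
    \<comment> \<open>Replacing \<tau> by \<tau>' moves the staircase horizontally by at most
      \<open>H * \<kappa> \<le> \<eta> / 2\<close>, and leaves the origin at distance at least
      \<open>H * \<kappa>\<close> from the ends of its plateau.\<close>
    define \<kappa> where "\<kappa> = min (1 / 2) (\<eta> / (2 * H))"
    have \<kappa>: "\<kappa> > 0" "\<kappa> \<le> 1 / 2" "H * \<kappa> \<le> \<eta> / 2"
    proof -
      show "\<kappa> > 0" "\<kappa> \<le> 1 / 2" using \<eta> H by (auto simp: \<kappa>_def)
      have "H * \<kappa> \<le> H * (\<eta> / (2 * H))" using H by (intro mult_left_mono) (auto simp: \<kappa>_def)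
      then show "H * \<kappa> \<le> \<eta> / 2" using H by simp
    qed
    define \<tau>' where "\<tau>' = \<tau> * (1 - \<kappa>)"
    have t': "1 - \<bar>\<tau>'\<bar> \<ge> \<kappa>" "\<bar>\<tau> - \<tau>'\<bar> \<le> \<kappa>" "\<tau>' \<in> {-1..1}"
    proof -
      have a: "\<bar>\<tau>\<bar> \<le> 1" using t by (auto simp: abs_le_iff)
      have "\<bar>\<tau>'\<bar> \<le> 1 * (1 - \<kappa>)" unfolding \<tau>'_def abs_mult using \<kappa> a by (intro mult_mono) auto
      then show "1 - \<bar>\<tau>'\<bar> \<ge> \<kappa>" "\<tau>' \<in> {-1..1}" using \<kappa> by (auto simp: abs_le_iff)
      have "\<tau> - \<tau>' = \<tau> * \<kappa>" by (simp add: \<tau>'_def algebra_simps)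
      then have "\<bar>\<tau> - \<tau>'\<bar> = \<bar>\<tau>\<bar> * \<kappa>" using \<kappa> by (simp add: abs_mult)
      also have "\<dots> \<le> 1 * \<kappa>" using a \<kappa> by (intro mult_right_mono) auto
      finally show "\<bar>\<tau> - \<tau>'\<bar> \<le> \<kappa>" by simp
    qed
    \<comment> \<open>Together with a mesh below \<open>H * \<kappa> / 4\<close>, this places the
      point shadowing the centre within \<open>H * \<kappa>\<close> of the origin, hence inside the
      plateau of height \<open>V * \<tau>'\<close>.\<close>
    define e where "e = min (\<eta> / 2) (H * \<kappa> / 4)"
    have e: "e > 0" "e \<le> \<eta> / 2" "e \<le> H * \<kappa> / 4" using \<eta> H \<kappa> by (auto simp: e_def)
    have "\<forall>\<^sub>F n in sequentially. mesh n < min 1 (H * \<kappa> / 4)" using mesh_tendsto_0 H \<kappa> by (intro order_tendstoD) auto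
    with \<tau>n(2)[OF e(1), of "max R (H * 3 + 1)"] index_in_range[of "H * 3"] eventually_ge_at_top[of 2] show ?thesis
    proof eventually_elim
      case (elim n)
      define l where "l = (if \<tau>n n - \<tau>' \<le> 1 then \<tau>' else \<tau>' + 2)"
      have obl_l: "obl H V l = obl H V \<tau>'" using obl_periodic[OF V_zero_or_H_pos] by (simp add: l_def)
      define s where "s = H * (\<tau>n n - l)"
      have d: "\<tau>n n - l \<le> 1" "\<bar>\<tau>n n - l\<bar> \<le> 3" using \<tau>n(1)[rule_format, of n] t'(3) by (auto simp: l_def)
      have s: "s \<le> H" "\<bar>s\<bar> \<le> H * 3"
        using mult_left_mono[OF d(1) H_nonneg] mult_left_mono[OF d(2) H_nonneg] H by (simp_all add: s_def abs_mult)
      define i0 where "i0 = nat \<lfloor>real (k n) + s / mesh n\<rfloor>"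
      have r: "0 \<le> real (k n) + s / mesh n" "real (k n) + s / mesh n < real n" using elim(2) s by auto
      have Wi0: "(u n (x n + omega n * s) - f (x n)) / omega n = W n i0" using rescaled_u[OF elim(3) r] by (simp add: W_def i0_def)
      have yi0: "y n i0 \<le> s" "s < y n i0 + mesh n" using cell_index_pos[OF elim(3) r(1)] by (auto simp: i0_def)
      then have "\<bar>y n i0\<bar> \<le> max R (H * 3 + 1)" using s elim(4) by linarith
      then obtain z0 where z0: "\<bar>z0 - (y n i0 - s)\<bar> \<le> e" "\<bar>W n i0 - M * s - obl H V l z0\<bar> \<le> e"
        using shadow_near[OF elim(1) _ s_def] by blast
      have Hk: "H * \<kappa> > 0" using H \<kappa> by simp
      have "\<bar>z0\<bar> < H * \<kappa>" using z0(1) yi0 elim(4) e Hk by linarith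
      also have "\<dots> \<le> H * (1 - \<bar>\<tau>'\<bar>)" using t' H by (intro mult_left_mono) auto
      finally have "obl H V l z0 = V * \<tau>'" unfolding obl_l by (rule obl_near_centre)
      then have v0: "\<bar>W n i0 - M * s - V * \<tau>'\<bar> \<le> e" using z0 by simp
      have "horizontal_near \<tau> R \<eta> n s"
        unfolding horizontal_near_def Wi0
      proof (intro allI impI)
        fix i assume "\<bar>y n i\<bar> \<le> R"
        then have "\<bar>y n i\<bar> \<le> max R (H * 3 + 1)" by simp
        then obtain z where z: "\<bar>z - (y n i - s)\<bar> \<le> e" "\<bar>W n i - M * s - obl H V l z\<bar> \<le> e"
          using shadow_near[OF elim(1) _ s_def] by blast
        \<comment> \<open>The height \<open>V * \<tau>'\<close> cancels against the value at the
          centre, so the passage from \<tau>' to \<tau> is a purely horizontal shift.\<close>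
        define z' where "z' = z + H * (\<tau> - \<tau>')"
        have "z' - H * \<tau> = z - H * \<tau>'" by (simp add: z'_def algebra_simps)
        then have ob: "obl H V l z = staircase_HV H V (z' - H * \<tau>) + V * \<tau>'" unfolding obl_l obl_def by simp
        have "\<bar>H * (\<tau> - \<tau>')\<bar> \<le> H * \<kappa>" using t' H by (simp add: abs_mult)
        then have "\<bar>z' - (y n i - s)\<bar> \<le> \<eta>" using z(1) e \<kappa>(3) unfolding z'_def by linarith
        moreover have "\<bar>W n i - W n i0 - staircase_HV H V (z' - H * \<tau>)\<bar> \<le> \<eta>" using z(2) v0 e unfolding ob by linarith
        ultimately show "\<exists>z. \<bar>z - (y n i - s)\<bar> \<le> \<eta> \<and> \<bar>W n i - W n i0 - staircase_HV H V (z - H * \<tau>)\<bar> \<le> \<eta>" by blast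
      qed
      then show ?case using s by blast
    qed
  qed
qed

text \<open>The shift obtained for a given tolerance depends on it through \<tau>', so a single
  sequence of centres results only from the diagonal choice over shrinking tolerances.\<close>

lemma horizontal_attained:
  assumes v: "v \<in> Orz H V"
  shows "\<exists>x' :: nat \<Rightarrow> real. (\<forall>n. 0 < x' n \<and> x' n < 1)
        \<and> limsup (\<lambda>n. ereal ((x' n - x n) / omega n)) \<le> ereal H
        \<and> loc_strict_conv (\<lambda>n. - x' n / omega n) (\<lambda>n. (1 - x' n) / omega n)
             (\<lambda>n y. (u n (x' n + omega n * y) - u n (x' n)) / omega n) v"
proof -
  obtain \<tau> where \<tau>: "\<tau> \<in> {-1..1}" "v = (\<lambda>t. staircase_HV H V (t - H * \<tau>))" using v unfolding Orz_def by blast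
  define T where "T = {s. s \<le> H \<and> \<bar>s\<bar> \<le> H * 3}"
  obtain s where s: "\<forall>n. s n \<in> T" "\<forall>j. \<forall>\<^sub>F n in sequentially. horizontal_near \<tau> (real j) (1 / real (Suc j)) n (s n)"
  proof (rule diagonal_choice[of T "\<lambda>j. horizontal_near \<tau> (real j) (1 / real (Suc j))"])
    show "\<forall>\<^sub>F n in sequentially. \<exists>t\<in>T. horizontal_near \<tau> (real j) (1 / real (Suc j)) n t" for j
      unfolding T_def by (rule horizontal_near_exists[OF \<tau>(1)]) simp
    show "horizontal_near \<tau> (real i) (1 / real (Suc i)) n t"
      if "i \<le> j" "horizontal_near \<tau> (real j) (1 / real (Suc j)) n t" for i j n t
      using that by (intro horizontal_near_mono[OF that(2)]) (auto simp: frac_le)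
    show "T \<noteq> {}" using H_nonneg by (auto simp: T_def intro!: exI[of _ 0])
  qed
  have sb: "\<bar>s n\<bar> \<le> H * 3" "s n \<le> H" for n using s(1) by (auto simp: T_def)
  have near: "\<forall>\<^sub>F n in sequentially. horizontal_near \<tau> R \<eta> n (s n)" if "\<eta> > 0" for R \<eta>
    by (rule eventually_all_scales[OF _ _ that]) (use s(2) in \<open>auto intro: horizontal_near_mono\<close>)
  obtain x' where x': "\<forall>n. 0 < x' n \<and> x' n < 1" "\<forall>\<^sub>F n in sequentially. x' n = x n + omega n * s n"
    "limsup (\<lambda>n. ereal ((x' n - x n) / omega n)) \<le> ereal H" by (rule centres[OF sb])
  have "loc_strict_conv (\<lambda>n. - x' n / omega n) (\<lambda>n. (1 - x' n) / omega n)
     (\<lambda>n t. (u n (x' n + omega n * t) - u n (x' n)) / omega n) (\<lambda>t. staircase_HV H V (t - H * \<tau>) + 0)"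
  proof (rule convergence_of_blow_ups[OF filterlim_ident sb(1) x'(2)])
    fix R \<eta> :: real assume \<eta>: "\<eta> > 0"
    show "\<forall>\<^sub>F n in sequentially. \<forall>i. \<bar>y n i\<bar> \<le> R \<longrightarrow> (\<exists>z. \<bar>z - (y n i - s n)\<bar> \<le> \<eta> \<and>
        \<bar>W n i - (u n (x' n) - f (x n)) / omega n - (staircase_HV H V (z - H * \<tau>) + 0)\<bar> \<le> \<eta>)"
      using near[OF \<eta>, of R] x'(2) by eventually_elim (simp add: horizontal_near_def)
  qed
  then show ?thesis using x' \<tau>(2) by auto
qed

end

theorem theorem2p8:
  fixes \<beta> :: real and f f' :: "real \<Rightarrow> real" and u :: "nat \<Rightarrow> real \<Rightarrow> real"
    and k :: "nat \<Rightarrow> nat" and x :: "nat \<Rightarrow> real" and xinf H V :: real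
  assumes beta_pos: "\<beta> > 0"
    and f_deriv: "\<forall>t\<in>{0..1}. (f has_real_derivative f' t) (at t within {0..1})"
    and f'_cont: "continuous_on {0..1} f'"
    and u_min: "\<forall>n\<ge>2. PM_minimizer \<beta> f n (u n)"
    and k_range: "\<forall>n\<ge>2. k n < n"
    and x_def: "\<forall>n\<ge>2. x n = real (k n) / real n"
    and x_lim: "x \<longlonglongrightarrow> xinf"
    and x_inf: "0 < xinf" "xinf < 1"
    and H_def: "H = (1 / (\<beta> * \<bar>f' xinf\<bar>^2)) powr (1/3)"
    and V_def: "V = f' xinf * H"
  shows
    "(\<forall>N :: nat \<Rightarrow> nat. filterlim N at_top sequentially \<longrightarrow>
        (\<exists>r. strict_mono r \<and> (\<exists>w\<in>Obl H V.
           loc_strict_conv (\<lambda>h. - x (N (r h)) / omega (N (r h)))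
                           (\<lambda>h. (1 - x (N (r h))) / omega (N (r h)))
                           (\<lambda>h y. (u (N (r h)) (x (N (r h)) + omega (N (r h)) * y) - f (x (N (r h))))
                                    / omega (N (r h))) w)))
   \<and> (\<forall>N :: nat \<Rightarrow> nat. filterlim N at_top sequentially \<longrightarrow>
        (\<exists>r. strict_mono r \<and> (\<exists>v\<in>Orz H V.
           loc_strict_conv (\<lambda>h. - x (N (r h)) / omega (N (r h)))
                           (\<lambda>h. (1 - x (N (r h))) / omega (N (r h)))
                           (\<lambda>h y. (u (N (r h)) (x (N (r h)) + omega (N (r h)) * y) - u (N (r h)) (x (N (r h))))
                                    / omega (N (r h))) v)))
   \<and> (\<forall>w\<in>Obl H V. \<exists>x' :: nat \<Rightarrow> real. (\<forall>n. 0 < x' n \<and> x' n < 1)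
        \<and> limsup (\<lambda>n. ereal ((x' n - x n) / omega n)) \<le> ereal H
        \<and> loc_strict_conv (\<lambda>n. - x' n / omega n) (\<lambda>n. (1 - x' n) / omega n)
             (\<lambda>n y. (u n (x' n + omega n * y) - f (x' n)) / omega n) w)
   \<and> (\<forall>v\<in>Orz H V. \<exists>x' :: nat \<Rightarrow> real. (\<forall>n. 0 < x' n \<and> x' n < 1)
        \<and> limsup (\<lambda>n. ereal ((x' n - x n) / omega n)) \<le> ereal H
        \<and> loc_strict_conv (\<lambda>n. - x' n / omega n) (\<lambda>n. (1 - x' n) / omega n)
             (\<lambda>n y. (u n (x' n + omega n * y) - u n (x' n)) / omega n) v)"
proof -
  have S: "staircase_setup \<beta> f f' u k x xinf H V"
    by unfold_locales (fact assms)+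
  show ?thesis
    by (intro conjI allI impI ballI staircase_setup.oblique_limits[OF S] staircase_setup.horizontal_limits[OF S]
        staircase_setup.oblique_attained[OF S] staircase_setup.horizontal_attained[OF S])
qed

end
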